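(* Let $f:\mathbb{R}^n\to\mathbb{R}$ be $\mu$-strongly convex with $\mu>0$ and minimizer $x^*$, let $x^0\in\mathbb{R}^n$, $R_0\ge\|x^0-x^*\|_2$, $R_0>0$, and $Q=B_{7R_0}(x^* )=\{x\in\mathbb{R}^n: \|x-x^*\|_2\le 7R_0\}$. Assume that the stochastic gradient satisfies the oracle condition (unbiasedness and variance at most $\sigma^2$) on $Q$ with $\sigma>0$, and that $f$ satisfies the smoothness conditions with exponent $\nu\in[0,1]$ and constant $M_\nu>0$ on $Q$ (oracle condition and smoothness conditions are spelled out in the context). Let $\varepsilon>0$ and $\beta\in(0,1)$. Then there exists a choice of the parameters of R-clipped-SGD such that R-clipped-SGD started at $x^0$ achieves $f(\hat x^\tau)-f(x^* )\le\varepsilon$ with probability at least $1-\beta$ after $$\mathcal{O}\left(\max\left\{D_1^{\frac{2}{1+\nu}}\ln\frac{\mu R_0^2}{\varepsilon},\ D_2^{\frac{2}{1+\nu}},\ \max\left\{D_1\ln\frac{\mu R_0^2}{\varepsilon},D_2\right\}\ln\frac{D}{\beta}\right\}\right)$$ iterations of clipped-SGD in total, and requires $$\mathcal{O}\left(\max\left\{D_1^{\frac{2}{1+\nu}}\ln\frac{\mu R_0^2}{\varepsilon},\ D_2^{\frac{2}{1+\nu}},\ \max\left\{D_1\ln\frac{\mu R_0^2}{\varepsilon},D_2,\frac{\sigma^2}{\mu\varepsilon}\right\}\ln\frac{D}{\beta}\right\}\right)$$ oracle calls, where $$D_1=\frac{M_\nu}{\mu R_0^{1-\nu}},\quad D_2=\frac{M_\nu}{\mu^{\frac{1+\nu}{2}}\varepsilon^{\frac{1-\nu}{2}}},\quad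 D=\left(D_1^{\frac{2}{1+\nu}}+D_1\right)\ln\frac{\mu R_0^2}{\varepsilon}+D_2+D_2^{\frac{2}{1+\nu}}.$$
   Context: Problem: minimize $f(x)=\mathbb{E}_\xi[f(x,\xi)]$ over $\mathbb{R}^n$; $x^*$ is the solution. $f$ is $\mu$-strongly convex if $f(y)\ge f(x)+\langle\nabla f(x),y-x\rangle+\frac\mu2\|y-x\|_2^2$ for all $x,y$. Oracle condition on $Q$: at each $x\in\mathbb{R}^n$ one can sample a stochastic gradient $\nabla f(x,\xi)$ with $\mathbb{E}_\xi\|\nabla f(x,\xi)-\nabla f(x)\|_2^2<\infty$, and for $x\in Q$: $\mathbb{E}_\xi[\nabla f(x,\xi)]=\nabla f(x)$ and $\mathbb{E}_\xi\|\nabla f(x,\xi)-\nabla f(x)\|_2^2\le\sigma^2$. No other tail assumption is made. Smoothness conditions on $Q$ with $(\nu,M_\nu)$: (i) $\|\nabla f(x)-\nabla f(y)\|_2\le M_\nu\|x-y\|_2^\nu$ for all $x,y\in Q$; (ii) $\|\nabla f(x)\|_2\le\left(\frac{1+\nu}{\nu}\right)^{\frac{\nu}{1+\nu}}M_\nu^{\frac{1}{1+\nu}}(f(x)-f(x^* ))^{\frac{\nu}{1+\nu}}$ for all $x\in Q$ (for $\nu=0$ the factor $(\frac{1+\nu}{\nu})^{\frac{\nu}{1+\nu}}$ is its limit $1$, so the bound reads $\|\nabla f(x)\|_2\le M_0$); (iii) $\|\nabla f(x)\|_2^2\le 2(1/\delta)^{\frac{1-\nu}{1+\nu}}M_\nu^{\frac{2}{1+\nu}}(f(x)-f(x^*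 ))+\delta^{\frac{2\nu}{1+\nu}}M_\nu^{\frac{2}{1+\nu}}$ for all $x\in Q$, $\delta>0$. For $\nu=0$, $f$ need not be differentiable and $\nabla f(x)$ denotes a subgradient (with $\nabla f(x^* )=0$). Clipping: $\mathrm{clip}(g,\lambda)=\min\{1,\lambda/\|g\|_2\}\,g$ (and $\mathrm{clip}(0,\lambda)=0$). Algorithm clipped-SGD with starting point $x^0$, number of iterations $N$, batch size $m\in\mathbb{Z}_{\ge1}$, stepsize $\gamma>0$, clipping parameter $B>0$: set $\lambda=B/\gamma$. For $k=0,\dots,N-1$: draw fresh i.i.d. samples $\xi_1^k,\dots,\xi_m^k$, let $\nabla f(x^k,\boldsymbol\xi^k)=\frac1m\sum_{i=1}^m\nabla f(x^k,\xi_i^k)$ and $\widetilde\nabla f(x^k,\boldsymbol\xi^k)=\mathrm{clip}(\nabla f(x^k,\boldsymbol\xi^k),\lambda)$; $x^{k+1}=x^k-\gamma\widetilde\nabla f(x^k,\boldsymbol\xi^k)$. Output: $\bar x^N=\frac1N\sum_{k=0}^{N-1}x^k$. Algorithm R-clipped-SGD with starting point $x^0$, number of restarts $\tau$, iteration numbers $N_1,\dots,N_\tau$, batch sizes $m_1,\dots,m_\tau$, stepsizes $\gamma_1,\dots,\gamma_\tau$, clipping parameters $B_1,\dots,B_\tau$: set $\hat x^0=x^0$; for $t=1,\dots,\tau$ run clipped-SGD for $N_t$ iterations from starting point $\hat x^{t-1}$ with batch size $m_t$, stepsize $\gamma_t$, clipping parameter $B_t$, using fresh samples, and let $\hat x^t$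 be its output. Output: $\hat x^\tau$. The number of oracle calls is the total number of computed stochastic gradients $\nabla f(x,\xi)$. All parameters may depend on $\nu,M_\nu,R_0,\sigma,\mu,\varepsilon,\beta$. $\mathcal{O}(\cdot)$ hides numerical constant factors (for fixed $\nu$), independent of $f,n,M_\nu,R_0,\sigma,\mu,\varepsilon,\beta$.
   Formalization: The logarithm ln(μR₀²/ε) is read as max{0, ln(μR₀²/ε)} throughout, since for ε > μR₀² the printed D can be negative and ln(D/β) undefined; zero restarts (τ = 0, output x⁰) are allowed. *)

theory Defs
  imports "HOL-Probability.Probability"
begin

section \<open>The space of real n-vectors with the dimension as a variable\<close>

text \<open>
  The numerical constant in the complexity bounds and the parameters of the method must not depend
  on the dimension, so the dimension has to be quantified inside the statement. Vectors of
  dimension \<open>n\<close> are therefore functions \<open>nat \<Rightarrow> real\<close> vanishing outside \<open>{..<n}\<close>;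
  the Euclidean norm of \<open>x\<close> is \<open>L2_set x {..<n}\<close>.
\<close>

definition Rn :: "nat \<Rightarrow> (nat \<Rightarrow> real) set" where
  "Rn n = {x. \<forall>i\<ge>n. x i = 0}"

abbreviation nrm :: "nat \<Rightarrow> (nat \<Rightarrow> real) \<Rightarrow> real" where
  "nrm n x \<equiv> L2_set x {..<n}"

definition ip :: "nat \<Rightarrow> (nat \<Rightarrow> real) \<Rightarrow> (nat \<Rightarrow> real) \<Rightarrow> real" where
  "ip n x y = (\<Sum>i<n. x i * y i)"

definition vdiff :: "(nat \<Rightarrow> real) \<Rightarrow> (nat \<Rightarrow> real) \<Rightarrow> nat \<Rightarrow> real" where
  "vdiff x y = (\<lambda>i. x i - y i)"

definition cballn :: "nat \<Rightarrow> (nat \<Rightarrow> real) \<Rightarrow> real \<Rightarrow> (nat \<Rightarrow> real) set" where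
  "cballn n c r = {x \<in> Rn n. nrm n (vdiff x c) \<le> r}"

text \<open>
  The topology on \<open>nat \<Rightarrow> real\<close> is the product topology; on \<^term>\<open>Rn n\<close> it coincides with
  the Euclidean one, so the following is the usual Borel space.
\<close>

definition borel_Rn :: "nat \<Rightarrow> (nat \<Rightarrow> real) measure" where
  "borel_Rn n = restrict_space borel (Rn n)"


section \<open>Assumptions on the objective and on the oracle\<close>

definition has_gradient :: "nat \<Rightarrow> ((nat \<Rightarrow> real) \<Rightarrow> real) \<Rightarrow> (nat \<Rightarrow> real) \<Rightarrow> (nat \<Rightarrow> real) \<Rightarrow> bool" where
  "has_gradient n f v x \<longleftrightarrow> v \<in> Rn n \<and>
     (\<forall>e>0. \<exists>d>0. \<forall>y\<in>Rn n. nrm n (vdiff y x) < d \<longrightarrow>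
        \<bar>f y - f x - ip n v (vdiff y x)\<bar> \<le> e * nrm n (vdiff y x))"

definition is_subgradient :: "nat \<Rightarrow> ((nat \<Rightarrow> real) \<Rightarrow> real) \<Rightarrow> (nat \<Rightarrow> real) \<Rightarrow> (nat \<Rightarrow> real) \<Rightarrow> bool" where
  "is_subgradient n f v x \<longleftrightarrow> v \<in> Rn n \<and> (\<forall>y\<in>Rn n. f y \<ge> f x + ip n v (vdiff y x))"

text \<open>
  \<open>g\<close> is what the symbol \<open>\<nabla>f\<close> stands for: the gradient if \<open>\<nu> > 0\<close>; for \<open>\<nu> = 0\<close> the function
  need not be differentiable and \<open>g\<close> is a selection of subgradients that is zero at the minimizer.
\<close>

definition grad_map ::
  "nat \<Rightarrow> real \<Rightarrow> ((nat \<Rightarrow> real) \<Rightarrow> real) \<Rightarrow> ((nat \<Rightarrow> real) \<Rightarrow> nat \<Rightarrow> real) \<Rightarrow> (nat \<Rightarrow> real) \<Rightarrow> bool" where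
  "grad_map n \<nu> f g xs \<longleftrightarrow>
     (if \<nu> = 0 then (\<forall>x\<in>Rn n. is_subgradient n f (g x) x) \<and> g xs = (\<lambda>i. 0)
      else (\<forall>x\<in>Rn n. has_gradient n f (g x) x))"

definition strongly_convex ::
  "nat \<Rightarrow> real \<Rightarrow> ((nat \<Rightarrow> real) \<Rightarrow> real) \<Rightarrow> ((nat \<Rightarrow> real) \<Rightarrow> nat \<Rightarrow> real) \<Rightarrow> bool" where
  "strongly_convex n \<mu> f g \<longleftrightarrow>
     (\<forall>x\<in>Rn n. \<forall>y\<in>Rn n.
        f y \<ge> f x + ip n (g x) (vdiff y x) + \<mu> / 2 * (nrm n (vdiff y x))\<^sup>2)"

definition is_minimizer :: "nat \<Rightarrow> ((nat \<Rightarrow> real) \<Rightarrow> real) \<Rightarrow> (nat \<Rightarrow> real) \<Rightarrow> bool" where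
  "is_minimizer n f xs \<longleftrightarrow> xs \<in> Rn n \<and> (\<forall>x\<in>Rn n. f xs \<le> f x)"

text \<open>
  The case \<open>\<nu> = 0\<close> of the second condition is separate because \<open>0 powr 0 = 0\<close> and
  \<open>(1 + \<nu>) / 0 = 0\<close> here.
\<close>

definition smoothness_on ::
  "nat \<Rightarrow> ((nat \<Rightarrow> real) \<Rightarrow> real) \<Rightarrow> ((nat \<Rightarrow> real) \<Rightarrow> nat \<Rightarrow> real) \<Rightarrow> (nat \<Rightarrow> real) \<Rightarrow> real \<Rightarrow> real \<Rightarrow>
   (nat \<Rightarrow> real) set \<Rightarrow> bool" where
  "smoothness_on n f g xs \<nu> M Q \<longleftrightarrow>
     (\<forall>x\<in>Q. \<forall>y\<in>Q. nrm n (vdiff (g x) (g y)) \<le> M * nrm n (vdiff x y) powr \<nu>) \<and>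
     (\<forall>x\<in>Q. nrm n (g x) \<le>
        (if \<nu> = 0 then M
         else ((1 + \<nu>) / \<nu>) powr (\<nu> / (1 + \<nu>)) * M powr (1 / (1 + \<nu>))
              * (f x - f xs) powr (\<nu> / (1 + \<nu>)))) \<and>
     (\<forall>x\<in>Q. \<forall>\<delta>>0. (nrm n (g x))\<^sup>2 \<le>
        2 * (1 / \<delta>) powr ((1 - \<nu>) / (1 + \<nu>)) * M powr (2 / (1 + \<nu>)) * (f x - f xs)
        + \<delta> powr (2 * \<nu> / (1 + \<nu>)) * M powr (2 / (1 + \<nu>)))"

text \<open>
  \<open>P\<close> is the law of \<open>\<xi>\<close> and \<open>G x \<xi>\<close> the stochastic gradient. The vector expectation is taken
  coordinatewise. Finiteness of the second moment makes all the integrals proper. Joint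
  measurability makes the iterates random variables.
\<close>

definition oracle_on ::
  "nat \<Rightarrow> 'b measure \<Rightarrow> ((nat \<Rightarrow> real) \<Rightarrow> 'b \<Rightarrow> nat \<Rightarrow> real) \<Rightarrow> ((nat \<Rightarrow> real) \<Rightarrow> nat \<Rightarrow> real) \<Rightarrow>
   real \<Rightarrow> (nat \<Rightarrow> real) set \<Rightarrow> bool" where
  "oracle_on n P G g \<sigma> Q \<longleftrightarrow>
     prob_space P \<and>
     (\<lambda>(x, \<xi>). G x \<xi>) \<in> borel_Rn n \<Otimes>\<^sub>M P \<rightarrow>\<^sub>M borel_Rn n \<and>
     (\<forall>x\<in>Rn n. integrable P (\<lambda>\<xi>. (nrm n (vdiff (G x \<xi>) (g x)))\<^sup>2)) \<and>
     (\<forall>x\<in>Q. (\<forall>i<n. (\<integral>\<xi>. G x \<xi> i \<partial>P) = g x i) \<and>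
             (\<integral>\<xi>. (nrm n (vdiff (G x \<xi>) (g x)))\<^sup>2 \<partial>P) \<le> \<sigma>\<^sup>2)"


section \<open>The algorithms\<close>

definition clip :: "nat \<Rightarrow> (nat \<Rightarrow> real) \<Rightarrow> real \<Rightarrow> nat \<Rightarrow> real" where
  "clip n v c = (\<lambda>i. min 1 (c / nrm n v) * v i)"

definition minibatch ::
  "((nat \<Rightarrow> real) \<Rightarrow> 'b \<Rightarrow> nat \<Rightarrow> real) \<Rightarrow> nat \<Rightarrow> (nat \<Rightarrow> real) \<Rightarrow> (nat \<Rightarrow> 'b) \<Rightarrow> nat \<Rightarrow> real" where
  "minibatch G m x \<xi> = (\<lambda>i. (\<Sum>j<m. G x (\<xi> j) i) / real m)"

text \<open>\<open>\<xi> k j\<close> is the \<open>j\<close>-th sample (counted from \<open>0\<close>) of iteration \<open>k\<close>.\<close>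

primrec clipped_SGD_iterate ::
  "nat \<Rightarrow> ((nat \<Rightarrow> real) \<Rightarrow> 'b \<Rightarrow> nat \<Rightarrow> real) \<Rightarrow> nat \<Rightarrow> real \<Rightarrow> real \<Rightarrow> (nat \<Rightarrow> real) \<Rightarrow>
   (nat \<Rightarrow> nat \<Rightarrow> 'b) \<Rightarrow> nat \<Rightarrow> nat \<Rightarrow> real" where
  "clipped_SGD_iterate n G m \<gamma> B x0 \<xi> 0 = x0"
| "clipped_SGD_iterate n G m \<gamma> B x0 \<xi> (Suc k) =
     (let x = clipped_SGD_iterate n G m \<gamma> B x0 \<xi> k
      in (\<lambda>i. x i - \<gamma> * clip n (minibatch G m x (\<xi> k)) (B / \<gamma>) i))"

definition clipped_SGD ::
  "nat \<Rightarrow> ((nat \<Rightarrow> real) \<Rightarrow> 'b \<Rightarrow> nat \<Rightarrow> real) \<Rightarrow> nat \<Rightarrow> nat \<Rightarrow> real \<Rightarrow> real \<Rightarrow> (nat \<Rightarrow> real) \<Rightarrow>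
   (nat \<Rightarrow> nat \<Rightarrow> 'b) \<Rightarrow> nat \<Rightarrow> real" where
  "clipped_SGD n G N m \<gamma> B x0 \<xi> =
     (\<lambda>i. (\<Sum>k<N. clipped_SGD_iterate n G m \<gamma> B x0 \<xi> k i) / real N)"

text \<open>
  The restarts are numbered from \<open>1\<close>, so the values of the parameter sequences at \<open>0\<close> are unused;
  \<open>\<omega> (t, k, j)\<close> is the \<open>j\<close>-th sample of iteration \<open>k\<close> of restart \<open>t\<close>.
\<close>

primrec R_clipped_SGD ::
  "nat \<Rightarrow> ((nat \<Rightarrow> real) \<Rightarrow> 'b \<Rightarrow> nat \<Rightarrow> real) \<Rightarrow> (nat \<Rightarrow> nat) \<Rightarrow> (nat \<Rightarrow> nat) \<Rightarrow> (nat \<Rightarrow> real) \<Rightarrow>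
   (nat \<Rightarrow> real) \<Rightarrow> (nat \<Rightarrow> real) \<Rightarrow> (nat \<times> nat \<times> nat \<Rightarrow> 'b) \<Rightarrow> nat \<Rightarrow> nat \<Rightarrow> real" where
  "R_clipped_SGD n G N m \<gamma> B x0 \<omega> 0 = x0"
| "R_clipped_SGD n G N m \<gamma> B x0 \<omega> (Suc t) =
     clipped_SGD n G (N (Suc t)) (m (Suc t)) (\<gamma> (Suc t)) (B (Suc t))
       (R_clipped_SGD n G N m \<gamma> B x0 \<omega> t) (\<lambda>k j. \<omega> (Suc t, k, j))"

text \<open>Independent samples with law \<open>P\<close>, one for each index.\<close>

definition samples :: "'b measure \<Rightarrow> (nat \<times> nat \<times> nat \<Rightarrow> 'b) measure" where
  "samples P = PiM UNIV (\<lambda>_. P)"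

definition total_iterations :: "nat \<Rightarrow> (nat \<Rightarrow> nat) \<Rightarrow> nat" where
  "total_iterations \<tau> N = (\<Sum>t=1..\<tau>. N t)"

definition oracle_calls :: "nat \<Rightarrow> (nat \<Rightarrow> nat) \<Rightarrow> (nat \<Rightarrow> nat) \<Rightarrow> nat" where
  "oracle_calls \<tau> N m = (\<Sum>t=1..\<tau>. N t * m t)"


section \<open>The complexity expressions\<close>

definition D1 :: "real \<Rightarrow> real \<Rightarrow> real \<Rightarrow> real \<Rightarrow> real" where
  "D1 \<nu> M \<mu> R0 = M / (\<mu> * R0 powr (1 - \<nu>))"

definition D2 :: "real \<Rightarrow> real \<Rightarrow> real \<Rightarrow> real \<Rightarrow> real" where
  "D2 \<nu> M \<mu> \<epsilon> = M / (\<mu> powr ((1 + \<nu>) / 2) * \<epsilon> powr ((1 - \<nu>) / 2))"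

text \<open>
  \<open>ln (\<mu> R0\<^sup>2 / \<epsilon>)\<close>, which is meant for \<open>\<epsilon> \<le> \<mu> R0\<^sup>2\<close>. For larger \<open>\<epsilon>\<close> the logarithm is negative and
  \<open>DD\<close> below could become negative, with \<open>ln (DD / \<beta>)\<close> meaningless; it is read as \<open>0\<close> then.
\<close>

definition log_ratio :: "real \<Rightarrow> real \<Rightarrow> real \<Rightarrow> real" where
  "log_ratio \<mu> R0 \<epsilon> = max 0 (ln (\<mu> * R0\<^sup>2 / \<epsilon>))"

definition DD :: "real \<Rightarrow> real \<Rightarrow> real \<Rightarrow> real \<Rightarrow> real \<Rightarrow> real" where
  "DD \<nu> M \<mu> R0 \<epsilon> =
     (D1 \<nu> M \<mu> R0 powr (2 / (1 + \<nu>)) + D1 \<nu> M \<mu> R0) * log_ratio \<mu> R0 \<epsilon>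
     + D2 \<nu> M \<mu> \<epsilon> + D2 \<nu> M \<mu> \<epsilon> powr (2 / (1 + \<nu>))"

definition iteration_bound :: "real \<Rightarrow> real \<Rightarrow> real \<Rightarrow> real \<Rightarrow> real \<Rightarrow> real \<Rightarrow> real" where
  "iteration_bound \<nu> M \<mu> R0 \<epsilon> \<beta> = Max
     {D1 \<nu> M \<mu> R0 powr (2 / (1 + \<nu>)) * log_ratio \<mu> R0 \<epsilon>,
      D2 \<nu> M \<mu> \<epsilon> powr (2 / (1 + \<nu>)),
      Max {D1 \<nu> M \<mu> R0 * log_ratio \<mu> R0 \<epsilon>, D2 \<nu> M \<mu> \<epsilon>} * ln (DD \<nu> M \<mu> R0 \<epsilon> / \<beta>)}"

definition oracle_bound :: "real \<Rightarrow> real \<Rightarrow> real \<Rightarrow> real \<Rightarrow> real \<Rightarrow> real \<Rightarrow> real \<Rightarrow> real" where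
  "oracle_bound \<nu> M \<mu> R0 \<sigma> \<epsilon> \<beta> = Max
     {D1 \<nu> M \<mu> R0 powr (2 / (1 + \<nu>)) * log_ratio \<mu> R0 \<epsilon>,
      D2 \<nu> M \<mu> \<epsilon> powr (2 / (1 + \<nu>)),
      Max {D1 \<nu> M \<mu> R0 * log_ratio \<mu> R0 \<epsilon>, D2 \<nu> M \<mu> \<epsilon>, \<sigma>\<^sup>2 / (\<mu> * \<epsilon>)} * ln (DD \<nu> M \<mu> R0 \<epsilon> / \<beta>)}"

end

theory Submission
  imports Defs
begin

text \<open>
  Clipping bounds every step of the method. Hence the exponential moments of a step exist although only
  the variance of the oracle is finite, and an exponential Markov inequality for a stopped
  supermartingale gives a failure probability \<open>exp (- \<theta>)\<close> at the price of a factor \<open>\<theta>\<close> only in the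
  terms that are linear in \<open>M\<close> and in the batch size.

  \<^emph>\<open>One step.\<close> Clipping at level \<open>B / \<gamma>\<close> is the projection onto a ball. If the gradient lies in the ball of
  half that radius, clipping does not increase the variance (\<open>nrm_vdiff_clip_le\<close>), and its bias is at
  most the variance divided by twice the level (\<open>nrm_vdiff_clip_le_sq\<close>). The squared distance to the
  minimizer after the step differs from its value after the exact gradient step by a random variable
  \<open>Y\<close> that is bounded by a multiple of \<open>B * R\<close>, so \<open>exp (s * Y) \<le> 1 + s * Y + (s * Y)\<^sup>2\<close> as soon as \<open>s * B * R\<close>
  is small, and the expectation is controlled by the bias and the variance (\<open>clipped_step_mgf\<close>). The
  exact gradient step decreases the squared distance by about \<open>\<gamma>\<close> times the gap \<open>f x - f xs\<close>, because
  the third smoothness condition makes \<open>f\<close> behave like a function with Lipschitz gradient up to an error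
  of the size of the accuracy. Altogether, with \<open>s = 2 * \<theta> / R\<^sup>2\<close> and accuracy \<open>e\<close>, the expectation of
  \<open>exp (s * (squared distance + \<gamma> * accumulated gaps))\<close> grows by at most the factor \<open>exp (s * \<gamma> * e / 2)\<close> in a
  step (\<open>step_mgf\<close>).

  \<^emph>\<open>One run.\<close> This estimate needs the iterate to be within distance \<open>2 * R\<close> of the minimizer. The process
  is therefore frozen at the value \<open>exp (4 * s * R\<^sup>2)\<close> once it leaves that ball. If \<open>N * \<gamma> * e = 3 * R\<^sup>2\<close>, the
  expectation after \<open>N\<close> steps is at most \<open>exp (5 / 2 * s * R\<^sup>2)\<close>, whereas leaving the ball or missing the
  accuracy \<open>e\<close> on average both make the process at least \<open>exp (3 * s * R\<^sup>2)\<close>. So a run started within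
  distance \<open>R\<close> fails with probability at most \<open>exp (- s * R\<^sup>2 / 2) = exp (- \<theta>)\<close> (\<open>clipped_SGD_failure\<close>).

  \<^emph>\<open>Restarts.\<close> By strong convexity a gap of \<open>\<mu> * R\<^sup>2 / 4\<close> means a squared distance of at most \<open>R\<^sup>2 / 2\<close>. If
  \<open>\<epsilon> \<le> \<mu> * R0\<^sup>2\<close>, about \<open>log 2 (\<mu> * R0\<^sup>2 / \<epsilon>)\<close> runs, each with this target, reach the accuracy \<open>\<epsilon>\<close>
  (\<open>halving_schedule\<close>); their costs form geometric sums that interpolate between the terms with \<open>D1\<close> and
  \<open>D2\<close> (\<open>restart_sum_le\<close>). If \<open>\<epsilon> > \<mu> * R0\<^sup>2\<close>, one run does it (\<open>single_run_schedule\<close>), and if \<open>\<epsilon>\<close> is larger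
  than \<open>M * R0 powr (1 + \<nu>)\<close>, the starting point is good enough. A union bound over the runs, with
  \<open>\<theta> = ln (3 * \<tau> / \<beta>)\<close>, gives the confidence level (\<open>R_clipped_SGD_failure\<close>).
\<close>

section \<open>Euclidean geometry and clipping\<close>

lemma ip_self: "ip n x x = (nrm n x)\<^sup>2"
  by (simp add: ip_def L2_set_def sum_nonneg power2_eq_square)

lemma abs_ip_le: "\<bar>ip n x y\<bar> \<le> nrm n x * nrm n y"
proof -
  have "\<bar>ip n x y\<bar> \<le> (\<Sum>i<n. \<bar>x i\<bar> * \<bar>y i\<bar>)"
    unfolding ip_def by (rule order_trans[OF sum_abs]) (simp add: abs_mult)
  also have "\<dots> \<le> nrm n x * nrm n y"
    by (rule L2_set_mult_ineq)
  finally show ?thesis .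
qed

lemma ip_le: "ip n x y \<le> nrm n x * nrm n y"
  using abs_ip_le[of n x y] by linarith

lemma ip_vdiff_right: "ip n x (vdiff y z) = ip n x y - ip n x z"
  by (simp add: ip_def vdiff_def algebra_simps sum_subtractf)

lemma nrm_sub_scale_sq:
  "(nrm n (\<lambda>i. x i - c * y i))\<^sup>2 = (nrm n x)\<^sup>2 - 2 * c * ip n x y + c\<^sup>2 * (nrm n y)\<^sup>2"
  by (simp add: ip_self[symmetric])
     (simp add: ip_def algebra_simps sum.distrib sum_subtractf sum_distrib_left power2_eq_square)

lemma nrm_vdiff_sq: "(nrm n (vdiff x y))\<^sup>2 = (nrm n x)\<^sup>2 - 2 * ip n x y + (nrm n y)\<^sup>2"
  using nrm_sub_scale_sq[where c = 1 and x = x and y = y and n = n] by (simp add: vdiff_def)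

lemma nrm_scale: "nrm n (\<lambda>i. c * x i) = \<bar>c\<bar> * nrm n x"
  by (simp add: L2_set_def power_mult_distrib sum_distrib_left[symmetric] real_sqrt_mult)

lemma nrm_vdiff_le: "nrm n (vdiff x y) \<le> nrm n x + nrm n y"
proof -
  have "nrm n (\<lambda>i. x i + (- 1) * y i) \<le> nrm n x + nrm n (\<lambda>i. (- 1) * y i)"
    by (rule L2_set_triangle_ineq)
  then show ?thesis
    by (simp only: nrm_scale) (simp add: vdiff_def)
qed

lemma nrm_le_add_vdiff: "nrm n x \<le> nrm n y + nrm n (vdiff x y)"
  using L2_set_triangle_ineq[of y "vdiff x y" "{..<n}"] by (simp add: vdiff_def)

lemma nrm_vdiff_commute: "nrm n (vdiff x y) = nrm n (vdiff y x)"
  by (simp add: L2_set_def vdiff_def power2_commute)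

lemma coordinate_sq_le: "i < n \<Longrightarrow> (x i)\<^sup>2 \<le> (nrm n x)\<^sup>2"
  using member_le_sum[of i "{..<n}" "\<lambda>i. (x i)\<^sup>2"] by (simp add: L2_set_def sum_nonneg)

lemma clip_eq_self: "nrm n v \<le> c \<Longrightarrow> nrm n v \<noteq> 0 \<Longrightarrow> clip n v c = v"
  and clip_eq_scale: "0 < c \<Longrightarrow> c < nrm n v \<Longrightarrow> clip n v c = (\<lambda>i. c / nrm n v * v i)"
proof -
  show "clip n v c = v" if "nrm n v \<le> c" "nrm n v \<noteq> 0"
  proof -
    have "nrm n v > 0"
      using that(2) L2_set_nonneg[of v "{..<n}"] by linarith
    then have "1 \<le> c / nrm n v"
      using that(1) by simp
    then show ?thesis by (simp add: clip_def)
  qed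
  show "clip n v c = (\<lambda>i. c / nrm n v * v i)" if "0 < c" "c < nrm n v"
  proof -
    have "c / nrm n v \<le> 1"
      using that by simp
    then show ?thesis by (simp add: clip_def min_def)
  qed
qed

lemma nrm_clip:
  assumes "c > 0"
  shows "nrm n (clip n v c) = min (nrm n v) c"
proof -
  consider "nrm n v = 0" | "nrm n v \<noteq> 0" "nrm n v \<le> c" | "c < nrm n v" by linarith
  then show ?thesis
  proof cases
    case 1
    have "nrm n (clip n v c) = \<bar>min 1 (c / nrm n v)\<bar> * nrm n v"
      unfolding clip_def by (rule nrm_scale)
    then show ?thesis using 1 assms by simp
  next
    case 2
    then show ?thesis by (simp add: clip_eq_self)
  next
    case 3
    have "nrm n (clip n v c) = \<bar>c / nrm n v\<bar> * nrm n v"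
      unfolding clip_eq_scale[OF assms 3] by (rule nrm_scale)
    then show ?thesis using 3 assms by simp
  qed
qed

lemma nrm_vdiff_clip:
  assumes "c > 0"
  shows "nrm n (vdiff v (clip n v c)) = max 0 (nrm n v - c)"
proof -
  have "vdiff v (clip n v c) = (\<lambda>i. (1 - min 1 (c / nrm n v)) * v i)"
    by (rule ext) (simp add: vdiff_def clip_def left_diff_distrib)
  then have eq: "nrm n (vdiff v (clip n v c)) = \<bar>1 - min 1 (c / nrm n v)\<bar> * nrm n v"
    by (simp only: nrm_scale)
  consider "nrm n v = 0" | "nrm n v \<noteq> 0" "nrm n v \<le> c" | "c < nrm n v" by linarith
  then show ?thesis
  proof cases
    case 1
    then show ?thesis using eq assms by simp
  next
    case 2
    then show ?thesis by (simp add: clip_eq_self vdiff_def L2_set_0')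
  next
    case 3
    then have "c / nrm n v \<le> 1" "nrm n v > 0" using assms by simp_all
    then have "nrm n (vdiff v (clip n v c)) = (1 - c / nrm n v) * nrm n v"
      unfolding eq by (simp add: min_def)
    also have "\<dots> = nrm n v - c"
      using \<open>nrm n v > 0\<close> by (simp add: left_diff_distrib)
    finally show ?thesis using 3 by simp
  qed
qed

text \<open>
  Clipping at level \<open>c\<close> is the projection onto the ball of radius \<open>c\<close>, hence it does not increase
  the distance to a point of that ball. This is why clipping does not increase the variance.
\<close>

lemma nrm_vdiff_clip_le:
  assumes c: "c > 0" and g: "nrm n g \<le> c"
  shows "nrm n (vdiff (clip n v c) g) \<le> nrm n (vdiff v g)"
proof (cases "nrm n v \<le> c")
  case True
  then have "nrm n (vdiff v (clip n v c)) = 0"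
    using c by (simp add: nrm_vdiff_clip)
  then have eq: "\<forall>i<n. v i = clip n v c i"
    by (simp add: L2_set_eq_0_iff vdiff_def)
  have "nrm n (vdiff (clip n v c) g) = nrm n (vdiff v g)"
    using eq by (intro L2_set_cong) (auto simp: vdiff_def)
  then show ?thesis by simp
next
  case False
  define a where "a = c / nrm n v"
  have a: "0 < a" "a < 1" "a * nrm n v = c"
    using False c by (simp_all add: a_def)
  have cl: "clip n v c = (\<lambda>i. a * v i)"
    unfolding a_def using False c by (intro clip_eq_scale) auto
  have ipa: "ip n (\<lambda>i. a * v i) g = a * ip n v g"
    by (simp add: ip_def sum_distrib_left mult_ac)
  have "ip n v g \<le> nrm n v * c"
    using ip_le[of n v g] mult_left_mono[OF g, of "nrm n v"] by simp
  also have "\<dots> = a * (nrm n v)\<^sup>2"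
    using a(3) by (simp add: power2_eq_square)
  finally have "2 * ip n v g \<le> 2 * a * (nrm n v)\<^sup>2"
    by simp
  also have "\<dots> \<le> (1 + a) * (nrm n v)\<^sup>2"
    using a by (intro mult_right_mono) auto
  finally have "0 \<le> (1 - a) * ((1 + a) * (nrm n v)\<^sup>2 - 2 * ip n v g)"
    using a by simp
  also have "\<dots> = (nrm n (vdiff v g))\<^sup>2 - (nrm n (vdiff (clip n v c) g))\<^sup>2"
  proof -
    have "(nrm n (\<lambda>i. a * v i))\<^sup>2 = a\<^sup>2 * (nrm n v)\<^sup>2"
      by (simp only: nrm_scale power_mult_distrib power2_abs)
    moreover have "(1 - a) * ((1 + a) * X - 2 * p) = X - 2 * p + Y - (a\<^sup>2 * X - 2 * (a * p) + Y)"
      for X Y p :: real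
      by (simp add: algebra_simps power2_eq_square)
    ultimately show ?thesis
      unfolding cl by (simp only: nrm_vdiff_sq ipa)
  qed
  finally have "(nrm n (vdiff (clip n v c) g))\<^sup>2 \<le> (nrm n (vdiff v g))\<^sup>2"
    by simp
  then show ?thesis
    by (rule power2_le_imp_le) simp
qed

text \<open>
  Only deviations larger than \<open>c / 2\<close> are cut off if the mean \<open>g\<close> is at most half the level, so the
  error of clipping is of second order in \<open>v - g\<close>; its expectation is then the variance over \<open>2 * c\<close>.
\<close>

lemma nrm_vdiff_clip_le_sq:
  assumes c: "c > 0" and g: "2 * nrm n g \<le> c"
  shows "nrm n (vdiff v (clip n v c)) \<le> (nrm n (vdiff v g))\<^sup>2 / (2 * c)"
proof -
  define r where "r = nrm n (vdiff v g)"
  have "0 \<le> (r - c)\<^sup>2" by simp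
  then have "2 * c * (r - c / 2) \<le> r\<^sup>2"
    by (simp add: power2_eq_square algebra_simps)
  moreover have "nrm n v - c \<le> r - c / 2"
    using nrm_le_add_vdiff[of v n g] g by (simp add: r_def)
  ultimately have "2 * c * (nrm n v - c) \<le> r\<^sup>2"
    using mult_left_mono[of "nrm n v - c" "r - c / 2" "2 * c"] c by linarith
  then show ?thesis
    using c by (simp add: nrm_vdiff_clip r_def[symmetric] pos_le_divide_eq max_def mult.commute)
qed

text \<open>
  For nonpositive exponents this is \<open>1 \<le> (1 + z) * (1 - z + z\<^sup>2)\<close> combined with \<open>1 + z \<le> exp z\<close>.
\<close>

lemma exp_le_quadratic:
  fixes y :: real
  assumes "\<bar>y\<bar> \<le> 1"
  shows "exp y \<le> 1 + y + y\<^sup>2"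
proof (cases "y \<ge> 0")
  case True
  then show ?thesis using assms exp_bound[of y] by simp
next
  case False
  define z where "z = - y"
  have z: "0 \<le> z" "z \<le> 1" using False assms by (auto simp: z_def)
  have "1 \<le> (1 + z) * (1 - z + z\<^sup>2)"
    using z by (simp add: algebra_simps power2_eq_square)
  also have "\<dots> \<le> exp z * (1 - z + z\<^sup>2)"
  proof (rule mult_right_mono)
    show "0 \<le> 1 - z + z\<^sup>2" using z zero_le_power2[of z] by linarith
  qed (use exp_ge_add_one_self[of z] in simp)
  finally have "exp (- z) \<le> 1 - z + z\<^sup>2"
    by (simp add: exp_minus inverse_eq_divide pos_divide_le_eq mult.commute)
  then show ?thesis by (simp add: z_def)
qed

section \<open>One step from a fixed point\<close>

text \<open>
  The vector \<open>d\<close> is the position relative to the minimizer and \<open>g\<close> the gradient. The squared distance after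
  the step is compared with that after the exact step, which leads to \<open>u = d - \<gamma> * g\<close>. The difference
  \<open>Y\<close> is bounded because of clipping, its mean is only due to the bias of clipping and to the variance
  \<open>V\<close>, and its second moment is at most \<open>43 * R\<^sup>2 * \<gamma>\<^sup>2 * V\<close>. Centering at the exact step, instead of at
  \<open>d\<close>, keeps the squared norm of the gradient out of the term that carries the factor \<open>s\<close>.
\<close>

lemma (in prob_space) clipped_step_mgf:
  fixes v :: "'a \<Rightarrow> nat \<Rightarrow> real"
  assumes meas: "\<And>i. i < n \<Longrightarrow> (\<lambda>\<omega>. v \<omega> i) \<in> borel_measurable M"
    and sq: "integrable M (\<lambda>\<omega>. (nrm n (vdiff (v \<omega>) g))\<^sup>2)"
    and mean: "\<And>i. i < n \<Longrightarrow> expectation (\<lambda>\<omega>. v \<omega> i) = g i"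
    and var: "expectation (\<lambda>\<omega>. (nrm n (vdiff (v \<omega>) g))\<^sup>2) \<le> V"
    and R: "nrm n d \<le> 2 * R"
    and B: "0 < B" "B \<le> R" and \<gamma>: "\<gamma> > 0" and g: "2 * nrm n g \<le> B / \<gamma>"
    and s: "s > 0" "10 * s * B * R \<le> 1"
  shows "(\<integral>\<^sup>+\<omega>. ennreal (exp (s * (nrm n (\<lambda>i. d i - \<gamma> * clip n (v \<omega>) (B / \<gamma>) i))\<^sup>2)) \<partial>M)
    \<le> ennreal (exp (s * ((nrm n d)\<^sup>2 - 2 * \<gamma> * ip n g d + \<gamma>\<^sup>2 * (nrm n g)\<^sup>2
          + \<gamma>\<^sup>2 * V * (5 * R / (2 * B) + 1 + 43 * s * R\<^sup>2))))"
proof -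
  define c where "c = B / \<gamma>"
  define z where "z \<omega> = clip n (v \<omega>) c" for \<omega>
  define u where "u = (\<lambda>i. d i - \<gamma> * g i)"
  define r where "r \<omega> = nrm n (vdiff (v \<omega>) g)" for \<omega>
  define q where "q \<omega> = nrm n (vdiff (z \<omega>) g)" for \<omega>
  define Y where "Y \<omega> = - 2 * \<gamma> * ip n u (vdiff (z \<omega>) g) + \<gamma>\<^sup>2 * (q \<omega>)\<^sup>2" for \<omega>
  have c: "c > 0" "\<gamma> * c = B" using B \<gamma> by (auto simp: c_def)
  have gc: "2 * nrm n g \<le> c" using g by (simp add: c_def)
  have R0: "R > 0" using B by simp
  note [measurable] = meas
  have [measurable]: "(\<lambda>\<omega>. nrm n (v \<omega>)) \<in> borel_measurable M"
    unfolding L2_set_def by measurable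
  have [measurable]: "(\<lambda>\<omega>. z \<omega> i) \<in> borel_measurable M" if "i < n" for i
    using that unfolding z_def clip_def by measurable
  have r[measurable]: "r \<in> borel_measurable M" and q[measurable]: "q \<in> borel_measurable M"
    unfolding r_def q_def L2_set_def vdiff_def by measurable
  have uz[measurable]: "(\<lambda>\<omega>. ip n u (vdiff (z \<omega>) g)) \<in> borel_measurable M"
    unfolding ip_def vdiff_def by measurable
  have Ym[measurable]: "Y \<in> borel_measurable M"
    unfolding Y_def by measurable
  have split: "(nrm n (\<lambda>i. d i - \<gamma> * z \<omega> i))\<^sup>2 = (nrm n u)\<^sup>2 + Y \<omega>" for \<omega>
  proof -
    have "(\<lambda>i. d i - \<gamma> * z \<omega> i) = (\<lambda>i. u i - \<gamma> * vdiff (z \<omega>) g i)"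
      by (auto simp: u_def vdiff_def algebra_simps)
    then show ?thesis
      by (simp only: nrm_sub_scale_sq Y_def q_def)
  qed
  have u_sq: "(nrm n u)\<^sup>2 = (nrm n d)\<^sup>2 - 2 * \<gamma> * ip n g d + \<gamma>\<^sup>2 * (nrm n g)\<^sup>2"
    unfolding u_def nrm_sub_scale_sq by (simp add: ip_def mult.commute)
  have u_le: "nrm n u \<le> 5 / 2 * R"
  proof -
    have "nrm n u \<le> nrm n d + nrm n (\<lambda>i. \<gamma> * g i)"
      using nrm_vdiff_le[where n = n and x = d and y = "\<lambda>i. \<gamma> * g i"] by (simp add: u_def vdiff_def)
    also have "nrm n (\<lambda>i. \<gamma> * g i) = \<gamma> * nrm n g"
      using \<gamma> by (simp add: nrm_scale)
    also have "\<gamma> * nrm n g \<le> \<gamma> * (c / 2)"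
      using gc \<gamma> by (intro mult_left_mono) auto
    also have "\<dots> \<le> R / 2" using c B by simp
    finally show ?thesis using R by simp
  qed
  have q_le: "q \<omega> \<le> r \<omega>" for \<omega>
    unfolding q_def r_def z_def using c gc L2_set_nonneg[of g "{..<n}"]
    by (intro nrm_vdiff_clip_le) linarith+
  have q_le': "q \<omega> \<le> 3 / 2 * c" for \<omega>
  proof -
    have "q \<omega> \<le> nrm n (z \<omega>) + nrm n g"
      unfolding q_def by (rule nrm_vdiff_le)
    then show ?thesis using gc nrm_clip[OF c(1), of n "v \<omega>"] by (simp add: z_def)
  qed
  have q0: "0 \<le> q \<omega>" "0 \<le> r \<omega>" for \<omega> by (simp_all add: q_def r_def)
  have uzg: "\<bar>ip n u (vdiff (z \<omega>) g)\<bar> \<le> 5 / 2 * R * q \<omega>" for \<omega>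
  proof -
    have "\<bar>ip n u (vdiff (z \<omega>) g)\<bar> \<le> nrm n u * q \<omega>"
      unfolding q_def by (rule abs_ip_le)
    also have "\<dots> \<le> 5 / 2 * R * q \<omega>"
      using u_le q0 by (intro mult_right_mono) auto
    finally show ?thesis .
  qed
  have gq: "\<gamma> * q \<omega> \<le> 3 / 2 * B" for \<omega>
  proof -
    have "\<gamma> * q \<omega> \<le> \<gamma> * (3 / 2 * c)"
      using q_le' \<gamma> by (intro mult_left_mono) auto
    also have "\<dots> = 3 / 2 * B"
      using c(2) by simp
    finally show ?thesis .
  qed
  have Y_q: "\<bar>Y \<omega>\<bar> \<le> 13 / 2 * R * (\<gamma> * q \<omega>)" for \<omega>
  proof -
    have "\<gamma> * q \<omega> * (\<gamma> * q \<omega>) \<le> 3 / 2 * R * (\<gamma> * q \<omega>)"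
      using gq[of \<omega>] B \<gamma> q0[of \<omega>] by (intro mult_right_mono) auto
    moreover have "\<bar>2 * \<gamma> * ip n u (vdiff (z \<omega>) g)\<bar> \<le> 2 * \<gamma> * (5 / 2 * R * q \<omega>)"
      using uzg[of \<omega>] \<gamma> by (simp add: abs_mult)
    moreover have "\<bar>Y \<omega>\<bar> \<le> \<bar>2 * \<gamma> * ip n u (vdiff (z \<omega>) g)\<bar> + (\<gamma> * q \<omega>) * (\<gamma> * q \<omega>)"
      unfolding Y_def by (rule order_trans[OF abs_triangle_ineq]) (simp add: power2_eq_square abs_mult mult_ac)
    ultimately show ?thesis by (simp add: algebra_simps)
  qed
  have sY: "\<bar>s * Y \<omega>\<bar> \<le> 1" for \<omega>
  proof -
    have "13 / 2 * R * (\<gamma> * q \<omega>) \<le> 13 / 2 * R * (3 / 2 * B)"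
      using R0 gq by (intro mult_left_mono) auto
    also have "\<dots> \<le> 10 * B * R" using B by simp
    finally have "\<bar>Y \<omega>\<bar> \<le> 10 * B * R" using Y_q[of \<omega>] by linarith
    then have "s * \<bar>Y \<omega>\<bar> \<le> s * (10 * B * R)" using s by (intro mult_left_mono) auto
    then have "s * \<bar>Y \<omega>\<bar> \<le> 10 * s * B * R" by (simp add: mult_ac)
    moreover have "\<bar>s * Y \<omega>\<bar> = s * \<bar>Y \<omega>\<bar>" using s by (simp add: abs_mult)
    ultimately show ?thesis using s by linarith
  qed
  have r_int: "integrable M (\<lambda>\<omega>. (r \<omega>)\<^sup>2)" using sq by (simp add: r_def)
  have r_var: "expectation (\<lambda>\<omega>. (r \<omega>)\<^sup>2) \<le> V" using var by (simp add: r_def)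
  have V0: "0 \<le> V" by (rule order_trans[OF _ r_var]) simp
  have q_int: "integrable M (\<lambda>\<omega>. (q \<omega>)\<^sup>2)"
    by (rule Bochner_Integration.integrable_bound[OF r_int])
       (use q_le q0 in \<open>auto intro!: power_mono\<close>)
  have q_var: "expectation (\<lambda>\<omega>. (q \<omega>)\<^sup>2) \<le> V"
    by (rule order_trans[OF integral_mono[OF q_int r_int] r_var]) (use q_le q0 in \<open>auto intro!: power_mono\<close>)
  have vi: "integrable M (\<lambda>\<omega>. v \<omega> i)" if i: "i < n" for i
  proof -
    have [measurable]: "(\<lambda>\<omega>. v \<omega> i) \<in> borel_measurable M" using i by (rule meas)
    have "integrable M (\<lambda>\<omega>. (v \<omega> i - g i)\<^sup>2)"
      by (rule Bochner_Integration.integrable_bound[OF r_int])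
         (use coordinate_sq_le[OF i, of "vdiff (v _) g"] in \<open>auto simp: r_def vdiff_def\<close>)
    then have "integrable M (\<lambda>\<omega>. v \<omega> i - g i)"
      by (rule square_integrable_imp_integrable[rotated]) simp
    then have "integrable M (\<lambda>\<omega>. (v \<omega> i - g i) + g i)"
      by (rule Bochner_Integration.integrable_add) simp
    then show ?thesis by simp
  qed
  have mean0_int: "integrable M (\<lambda>\<omega>. ip n u (vdiff (v \<omega>) g))"
    unfolding ip_def vdiff_def using vi by (intro Bochner_Integration.integrable_sum) auto
  have mean0: "expectation (\<lambda>\<omega>. ip n u (vdiff (v \<omega>) g)) = 0"
  proof -
    have "expectation (\<lambda>\<omega>. ip n u (vdiff (v \<omega>) g)) = (\<Sum>i<n. expectation (\<lambda>\<omega>. u i * (v \<omega> i - g i)))"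
      unfolding ip_def vdiff_def using vi by (intro Bochner_Integration.integral_sum) auto
    also have "\<dots> = 0"
      using vi mean by (intro sum.neutral) (auto simp: prob_space)
    finally show ?thesis .
  qed
  have bdd: "integrable M h" if "h \<in> borel_measurable M" "\<And>\<omega>. \<bar>h \<omega>\<bar> \<le> b" for h :: "'a \<Rightarrow> real" and b
    using that by (intro integrable_const_bound[where B = b]) auto
  have uz_int: "integrable M (\<lambda>\<omega>. ip n u (vdiff (z \<omega>) g))"
  proof (rule bdd[of _ "5 / 2 * R * (3 / 2 * c)"])
    fix \<omega>
    have "5 / 2 * R * q \<omega> \<le> 5 / 2 * R * (3 / 2 * c)"
      using q_le'[of \<omega>] R0 by (intro mult_left_mono) auto
    then show "\<bar>ip n u (vdiff (z \<omega>) g)\<bar> \<le> 5 / 2 * R * (3 / 2 * c)"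
      using uzg[of \<omega>] by linarith
  qed simp
  \<comment> \<open>The unclipped estimate \<open>v\<close> has the mean \<open>g\<close>, so only the part that is cut off contributes.\<close>
  have bias: "- expectation (\<lambda>\<omega>. ip n u (vdiff (z \<omega>) g)) \<le> 5 / 2 * R * (V / (2 * c))"
  proof -
    have "- expectation (\<lambda>\<omega>. ip n u (vdiff (z \<omega>) g))
      = expectation (\<lambda>\<omega>. ip n u (vdiff (v \<omega>) g) - ip n u (vdiff (z \<omega>) g))"
      using mean0 mean0_int uz_int by simp
    also have "\<dots> \<le> expectation (\<lambda>\<omega>. 5 / 2 * R * ((r \<omega>)\<^sup>2 / (2 * c)))"
    proof (rule integral_mono)
      fix \<omega>
      have "ip n u (vdiff (v \<omega>) g) - ip n u (vdiff (z \<omega>) g) = ip n u (vdiff (v \<omega>) (z \<omega>))"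
        by (simp add: ip_vdiff_right)
      also have "\<dots> \<le> nrm n u * nrm n (vdiff (v \<omega>) (z \<omega>))" by (rule ip_le)
      also have "\<dots> \<le> 5 / 2 * R * ((r \<omega>)\<^sup>2 / (2 * c))"
        using u_le R0 nrm_vdiff_clip_le_sq[OF c(1) gc, of "v \<omega>"]
        by (intro mult_mono) (auto simp: z_def r_def)
      finally show "ip n u (vdiff (v \<omega>) g) - ip n u (vdiff (z \<omega>) g) \<le> 5 / 2 * R * ((r \<omega>)\<^sup>2 / (2 * c))" .
    qed (use mean0_int uz_int r_int in auto)
    also have "\<dots> = 5 / 2 * R * (expectation (\<lambda>\<omega>. (r \<omega>)\<^sup>2) / (2 * c))"
      by simp
    also have "\<dots> \<le> 5 / 2 * R * (V / (2 * c))"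
      using r_var R0 c by (intro mult_left_mono divide_right_mono) auto
    finally show ?thesis .
  qed
  have Y_int: "integrable M Y"
    unfolding Y_def using uz_int q_int by auto
  have EY: "expectation Y \<le> \<gamma>\<^sup>2 * V * (5 * R / (2 * B) + 1)"
  proof -
    have "expectation Y = 2 * \<gamma> * (- expectation (\<lambda>\<omega>. ip n u (vdiff (z \<omega>) g)))
        + \<gamma>\<^sup>2 * expectation (\<lambda>\<omega>. (q \<omega>)\<^sup>2)"
      unfolding Y_def using uz_int q_int by simp
    also have "\<dots> \<le> 2 * \<gamma> * (5 / 2 * R * (V / (2 * c))) + \<gamma>\<^sup>2 * V"
      using bias q_var \<gamma> by (intro add_mono mult_left_mono) auto
    also have "\<dots> = \<gamma>\<^sup>2 * V * (5 * R / (2 * B) + 1)"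
      using \<gamma> B by (simp add: c_def field_simps power2_eq_square)
    finally show ?thesis .
  qed
  have Y2_le: "(Y \<omega>)\<^sup>2 \<le> 43 * R\<^sup>2 * \<gamma>\<^sup>2 * (q \<omega>)\<^sup>2" for \<omega>
  proof -
    have "\<bar>Y \<omega>\<bar>\<^sup>2 \<le> (13 / 2 * R * (\<gamma> * q \<omega>))\<^sup>2"
      by (rule power_mono[OF Y_q]) simp
    also have "\<dots> = 169 / 4 * (R\<^sup>2 * \<gamma>\<^sup>2 * (q \<omega>)\<^sup>2)"
      by (simp add: power2_eq_square)
    also have "\<dots> \<le> 43 * (R\<^sup>2 * \<gamma>\<^sup>2 * (q \<omega>)\<^sup>2)"
      by (intro mult_right_mono) auto
    finally show ?thesis by (simp add: mult_ac)
  qed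
  have Y2_int: "integrable M (\<lambda>\<omega>. (Y \<omega>)\<^sup>2)"
    by (rule Bochner_Integration.integrable_bound[of _ "\<lambda>\<omega>. 43 * R\<^sup>2 * \<gamma>\<^sup>2 * (q \<omega>)\<^sup>2"])
       (use q_int Y2_le in auto)
  have EY2: "expectation (\<lambda>\<omega>. (Y \<omega>)\<^sup>2) \<le> 43 * R\<^sup>2 * \<gamma>\<^sup>2 * V"
  proof -
    have "expectation (\<lambda>\<omega>. (Y \<omega>)\<^sup>2) \<le> expectation (\<lambda>\<omega>. 43 * R\<^sup>2 * \<gamma>\<^sup>2 * (q \<omega>)\<^sup>2)"
      using Y2_int q_int Y2_le by (intro integral_mono) auto
    also have "\<dots> \<le> 43 * R\<^sup>2 * \<gamma>\<^sup>2 * V"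
      using q_var by (simp add: mult_left_mono)
    finally show ?thesis .
  qed
  have exp_int: "integrable M (\<lambda>\<omega>. exp (s * Y \<omega>))"
    by (rule bdd[of _ "exp 1"]) (use sY in \<open>auto simp: abs_le_iff\<close>)
  have "expectation (\<lambda>\<omega>. exp (s * Y \<omega>)) \<le> expectation (\<lambda>\<omega>. 1 + s * Y \<omega> + s\<^sup>2 * (Y \<omega>)\<^sup>2)"
    using exp_int Y_int Y2_int exp_le_quadratic[OF sY]
    by (intro integral_mono) (auto simp: power_mult_distrib)
  also have "\<dots> = 1 + s * expectation Y + s\<^sup>2 * expectation (\<lambda>\<omega>. (Y \<omega>)\<^sup>2)"
    using Y_int Y2_int by (simp add: prob_space)
  also have "\<dots> \<le> 1 + s * (\<gamma>\<^sup>2 * V * (5 * R / (2 * B) + 1)) + s\<^sup>2 * (43 * R\<^sup>2 * \<gamma>\<^sup>2 * V)"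
    using EY EY2 s by (intro add_mono mult_left_mono) auto
  also have "\<dots> = 1 + s * (\<gamma>\<^sup>2 * V * (5 * R / (2 * B) + 1 + 43 * s * R\<^sup>2))"
    by (simp add: algebra_simps power2_eq_square)
  also have "\<dots> \<le> exp (s * (\<gamma>\<^sup>2 * V * (5 * R / (2 * B) + 1 + 43 * s * R\<^sup>2)))"
    by (rule exp_ge_add_one_self)
  finally have main: "expectation (\<lambda>\<omega>. exp (s * Y \<omega>)) \<le> \<dots>" .
  have "(\<integral>\<^sup>+\<omega>. ennreal (exp (s * (nrm n (\<lambda>i. d i - \<gamma> * clip n (v \<omega>) (B / \<gamma>) i))\<^sup>2)) \<partial>M)
      = (\<integral>\<^sup>+\<omega>. ennreal (exp (s * (nrm n u)\<^sup>2) * exp (s * Y \<omega>)) \<partial>M)"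
    using split by (simp add: z_def c_def distrib_left exp_add)
  also have "\<dots> = ennreal (expectation (\<lambda>\<omega>. exp (s * (nrm n u)\<^sup>2) * exp (s * Y \<omega>)))"
    using exp_int by (intro nn_integral_eq_integral) auto
  also have "\<dots> = ennreal (exp (s * (nrm n u)\<^sup>2) * expectation (\<lambda>\<omega>. exp (s * Y \<omega>)))"
    by simp
  also have "\<dots> \<le> ennreal (exp (s * (nrm n u)\<^sup>2) *
      exp (s * (\<gamma>\<^sup>2 * V * (5 * R / (2 * B) + 1 + 43 * s * R\<^sup>2))))"
    using main by (intro ennreal_leI mult_left_mono) auto
  also have "\<dots> = ennreal (exp (s * ((nrm n d)\<^sup>2 - 2 * \<gamma> * ip n g d + \<gamma>\<^sup>2 * (nrm n g)\<^sup>2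
          + \<gamma>\<^sup>2 * V * (5 * R / (2 * B) + 1 + 43 * s * R\<^sup>2))))"
    by (simp add: u_sq exp_add[symmetric] distrib_left)
  finally show ?thesis .
qed

section \<open>Independent samples\<close>

lemma distr_PiM_UNIV_component:
  "prob_space P \<Longrightarrow> distr (PiM UNIV (\<lambda>_. P)) P (\<lambda>\<omega>. \<omega> i) = P"
  by (rule distr_PiM_component) auto

lemma indep_vars_PiM_coordinates:
  assumes P: "prob_space P"
  shows "prob_space.indep_vars (PiM UNIV (\<lambda>_. P)) (\<lambda>_. P) (\<lambda>i \<omega>. \<omega> i) UNIV"
proof -
  interpret prob_space "PiM UNIV (\<lambda>_. P)"
    by (rule prob_space_PiM) (rule P)
  have "distr (PiM UNIV (\<lambda>_. P)) (PiM UNIV (\<lambda>_. P)) (\<lambda>x. \<lambda>i\<in>UNIV. x i) = PiM UNIV (\<lambda>_. P)"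
    by (simp add: restrict_UNIV distr_id)
  also have "\<dots> = PiM UNIV (\<lambda>i. distr (PiM UNIV (\<lambda>_. P)) P (\<lambda>x. x i))"
    using P by (intro PiM_cong) (auto simp: distr_PiM_UNIV_component)
  finally show ?thesis
    by (subst indep_vars_iff_distr_eq_PiM) auto
qed

text \<open>
  A block of samples that does not occur in the first argument of \<open>h\<close> may be integrated separately,
  as if it were drawn afresh.
\<close>

lemma nn_integral_PiM_fresh_block:
  fixes P :: "'b measure" and I :: "'i set" and e :: "'j \<Rightarrow> 'i"
  assumes P: "prob_space P" and e: "inj e" "range e \<inter> I = {}"
    and h[measurable]: "h \<in> borel_measurable (PiM UNIV (\<lambda>_. P) \<Otimes>\<^sub>M PiM UNIV (\<lambda>_. P))"
    and dep: "\<And>\<omega> \<omega>' \<xi>. (\<And>i. i \<in> I \<Longrightarrow> \<omega> i = \<omega>' i) \<Longrightarrow> h (\<omega>, \<xi>) = h (\<omega>', \<xi>)"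
  shows "(\<integral>\<^sup>+\<omega>. h (\<omega>, \<lambda>j. \<omega> (e j)) \<partial>PiM UNIV (\<lambda>_. P))
    = (\<integral>\<^sup>+\<omega>. (\<integral>\<^sup>+\<xi>. h (\<omega>, \<xi>) \<partial>PiM UNIV (\<lambda>_. P)) \<partial>PiM UNIV (\<lambda>_. P))"
proof -
  define S where "S = PiM (UNIV :: 'i set) (\<lambda>_. P)"
  define T where "T = PiM (UNIV :: 'j set) (\<lambda>_. P)"
  interpret S: prob_space S unfolding S_def by (rule prob_space_PiM) (rule P)
  interpret T: prob_space T unfolding T_def by (rule prob_space_PiM) (rule P)
  obtain w where w: "w \<in> space S" using S.not_empty by blast
  \<comment> \<open>The history is completed to a full sample by fixed values outside \<open>I\<close>; this does not change \<open>h\<close>.\<close>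
  define X where "X \<omega> = (\<lambda>i. if i \<in> I then \<omega> i else w i)" for \<omega>
  define Y where "Y \<omega> = (\<lambda>j. \<omega> (e j))" for \<omega> :: "'i \<Rightarrow> 'b"
  have wP: "w i \<in> space P" for i
    using w by (auto simp: S_def space_PiM)
  have [measurable]: "h \<in> borel_measurable (S \<Otimes>\<^sub>M T)"
    using h by (simp add: S_def T_def)
  have pad: "X \<in> PiM I (\<lambda>_. P) \<rightarrow>\<^sub>M S"
    unfolding S_def
  proof (rule measurable_PiM_single')
    show "(\<lambda>\<omega>. X \<omega> i) \<in> PiM I (\<lambda>_. P) \<rightarrow>\<^sub>M P" for i
      using wP by (cases "i \<in> I") (auto simp: X_def)
  qed (use wP in \<open>auto simp: X_def space_PiM\<close>)
  \<comment> \<open>Independence of a pair is a notion for random variables of one type, so the block is kept as a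
    partial sample \<open>r\<close> indexed by the range of \<open>e\<close> and renamed by \<open>Y\<close> afterwards.\<close>
  define R where "R = PiM (range e) (\<lambda>_. P)"
  define r where "r \<omega> = restrict \<omega> (range e)" for \<omega> :: "'i \<Rightarrow> 'b"
  have sel[measurable]: "Y \<in> R \<rightarrow>\<^sub>M T"
    unfolding T_def R_def by (rule measurable_PiM_single') (auto simp: Y_def space_PiM)
  have coords: "S.indep_vars (\<lambda>_. P) (\<lambda>i \<omega>. \<omega> i) UNIV"
    unfolding S_def using P by (rule indep_vars_PiM_coordinates)
  have "S.indep_var (PiM I (\<lambda>_. P)) (\<lambda>\<omega>. restrict (\<lambda>i. \<omega> i) I) R (\<lambda>\<omega>. restrict (\<lambda>i. \<omega> i) (range e))"
    unfolding R_def using e(2) by (intro S.indep_var_restrict[OF coords]) auto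
  from S.indep_var_compose[OF this pad, of id R]
  have "S.indep_var S (X \<circ> (\<lambda>\<omega>. restrict (\<lambda>i. \<omega> i) I)) R r"
    by (simp add: comp_def r_def[abs_def])
  moreover have "X \<circ> (\<lambda>\<omega>. restrict (\<lambda>i. \<omega> i) I) = X"
    by (auto simp: X_def fun_eq_iff)
  ultimately have ind: "S.indep_var S X R r" by simp
  have X[measurable]: "X \<in> S \<rightarrow>\<^sub>M S" and r[measurable]: "r \<in> S \<rightarrow>\<^sub>M R"
    using S.indep_var_rv1[OF ind] S.indep_var_rv2[OF ind] .
  interpret R: prob_space "distr S R r"
    by (rule S.prob_space_distr) (rule r)
  have Yr: "Y (r \<omega>) = Y \<omega>" for \<omega>
    by (auto simp: Y_def r_def)
  have Y[measurable]: "Y \<in> S \<rightarrow>\<^sub>M T"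
    using measurable_compose[OF r sel] by (simp add: Yr)
  have T: "distr S T Y = T"
    using distr_PiM_reindex[where K = UNIV and M = "\<lambda>_. P" and f = e and I = UNIV] P e(1)
    by (simp add: S_def T_def Y_def[abs_def] restrict_UNIV)
  have joint: "distr S (S \<Otimes>\<^sub>M R) (\<lambda>\<omega>. (X \<omega>, r \<omega>)) = distr S S X \<Otimes>\<^sub>M distr S R r"
    using ind by (simp add: S.indep_var_distribution_eq)
  have hX: "h (X \<omega>, \<xi>) = h (\<omega>, \<xi>)" for \<omega> \<xi>
    by (rule dep) (simp add: X_def)
  have sec[measurable]: "(\<lambda>\<xi>. h (\<omega>, \<xi>)) \<in> borel_measurable T" if "\<omega> \<in> space S" for \<omega>
    using that by measurable
  have "(\<integral>\<^sup>+\<omega>. h (\<omega>, Y \<omega>) \<partial>S) = (\<integral>\<^sup>+\<omega>. h (X \<omega>, Y (r \<omega>)) \<partial>S)"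
    by (simp add: hX Yr)
  also have "\<dots> = (\<integral>\<^sup>+z. (case z of (x, y) \<Rightarrow> h (x, Y y)) \<partial>distr S (S \<Otimes>\<^sub>M R) (\<lambda>\<omega>. (X \<omega>, r \<omega>)))"
    by (subst nn_integral_distr) auto
  also have "\<dots> = (\<integral>\<^sup>+x. (\<integral>\<^sup>+y. h (x, Y y) \<partial>distr S R r) \<partial>distr S S X)"
    unfolding joint by (subst R.nn_integral_fst[symmetric]) auto
  also have "\<dots> = (\<integral>\<^sup>+\<omega>. (\<integral>\<^sup>+y. h (X \<omega>, Y y) \<partial>distr S R r) \<partial>S)"
    by (subst nn_integral_distr) auto
  also have "\<dots> = (\<integral>\<^sup>+\<omega>. (\<integral>\<^sup>+\<xi>. h (\<omega>, \<xi>) \<partial>T) \<partial>S)"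
  proof (rule nn_integral_cong)
    fix \<omega> assume \<omega>: "\<omega> \<in> space S"
    have "(\<integral>\<^sup>+y. h (X \<omega>, Y y) \<partial>distr S R r) = (\<integral>\<^sup>+y. h (\<omega>, Y y) \<partial>distr S R r)"
      by (simp add: hX)
    also have "\<dots> = (\<integral>\<^sup>+\<omega>'. h (\<omega>, Y (r \<omega>')) \<partial>S)"
      by (rule nn_integral_distr[OF r]) (use measurable_compose[OF sel sec[OF \<omega>]] in simp)
    also have "\<dots> = (\<integral>\<^sup>+\<xi>. h (\<omega>, \<xi>) \<partial>distr S T Y)"
      unfolding Yr by (rule nn_integral_distr[OF Y, symmetric]) (use sec[OF \<omega>] in simp)
    finally show "(\<integral>\<^sup>+y. h (X \<omega>, Y y) \<partial>distr S R r) = (\<integral>\<^sup>+\<xi>. h (\<omega>, \<xi>) \<partial>T)"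
      by (simp only: T)
  qed
  finally show ?thesis by (simp add: S_def T_def Y_def)
qed

lemma
  fixes \<phi> :: "'b \<Rightarrow> real"
  assumes P: "prob_space P" and \<phi>[measurable]: "\<phi> \<in> borel_measurable P"
  shows integral_PiM_coordinate: "(\<integral>\<xi>. \<phi> (\<xi> j) \<partial>PiM UNIV (\<lambda>_. P)) = (\<integral>x. \<phi> x \<partial>P)"
    and integrable_PiM_coordinate: "integrable P \<phi> \<Longrightarrow> integrable (PiM UNIV (\<lambda>_. P)) (\<lambda>\<xi>. \<phi> (\<xi> j))"
proof -
  have D: "distr (PiM UNIV (\<lambda>_. P)) P (\<lambda>\<xi>. \<xi> j) = P"
    using P by (rule distr_PiM_UNIV_component)
  have "(\<integral>\<xi>. \<phi> (\<xi> j) \<partial>PiM UNIV (\<lambda>_. P)) = (\<integral>x. \<phi> x \<partial>distr (PiM UNIV (\<lambda>_. P)) P (\<lambda>\<xi>. \<xi> j))"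
    by (subst integral_distr) auto
  then show "(\<integral>\<xi>. \<phi> (\<xi> j) \<partial>PiM UNIV (\<lambda>_. P)) = (\<integral>x. \<phi> x \<partial>P)" by (simp only: D)
  have "integrable (distr (PiM UNIV (\<lambda>_. P)) P (\<lambda>\<xi>. \<xi> j)) \<phi>
      = integrable (PiM UNIV (\<lambda>_. P)) (\<lambda>\<xi>. \<phi> (\<xi> j))"
    by (rule integrable_distr_eq) auto
  then show "integrable P \<phi> \<Longrightarrow> integrable (PiM UNIV (\<lambda>_. P)) (\<lambda>\<xi>. \<phi> (\<xi> j))" by (simp only: D)
qed

lemma
  fixes \<phi> :: "'b \<Rightarrow> real" and j k :: 'i
  assumes P: "prob_space P" and \<phi>[measurable]: "\<phi> \<in> borel_measurable P"
    and sq: "integrable P (\<lambda>x. (\<phi> x)\<^sup>2)" and mean: "(\<integral>x. \<phi> x \<partial>P) = 0"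
  shows integrable_PiM_product: "integrable (PiM UNIV (\<lambda>_. P)) (\<lambda>\<xi>. \<phi> (\<xi> j) * \<phi> (\<xi> k))"
    and integral_PiM_product: "(\<integral>\<xi>. \<phi> (\<xi> j) * \<phi> (\<xi> k) \<partial>PiM UNIV (\<lambda>_. P))
      = (if j = k then (\<integral>x. (\<phi> x)\<^sup>2 \<partial>P) else 0)"
proof -
  define T where "T = PiM (UNIV :: 'i set) (\<lambda>_. P)"
  interpret T: prob_space T unfolding T_def by (rule prob_space_PiM) (rule P)
  interpret P: prob_space P by (rule P)
  have int: "integrable T (\<lambda>\<xi>. \<phi> (\<xi> l))" for l
    unfolding T_def using P \<phi> P.square_integrable_imp_integrable[OF \<phi> sq]
    by (rule integrable_PiM_coordinate)
  have m0: "T.expectation (\<lambda>\<xi>. \<phi> (\<xi> l)) = 0" for l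
    unfolding T_def by (simp add: integral_PiM_coordinate[OF P \<phi>] mean)
  have ind: "T.indep_var borel (\<lambda>\<xi>. \<phi> (\<xi> j)) borel (\<lambda>\<xi>. \<phi> (\<xi> k))" if "j \<noteq> k"
  proof -
    have coords: "T.indep_vars (\<lambda>_. P) (\<lambda>i \<omega>. \<omega> i) UNIV"
      unfolding T_def using P by (rule indep_vars_PiM_coordinates)
    have "T.indep_var (PiM {j} (\<lambda>_. P)) (\<lambda>\<omega>. restrict (\<lambda>i. \<omega> i) {j}) (PiM {k} (\<lambda>_. P)) (\<lambda>\<omega>. restrict (\<lambda>i. \<omega> i) {k})"
      using that by (intro T.indep_var_restrict[OF coords]) auto
    then have "T.indep_var borel ((\<lambda>\<xi>. \<phi> (\<xi> j)) \<circ> (\<lambda>\<omega>. restrict (\<lambda>i. \<omega> i) {j}))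
        borel ((\<lambda>\<xi>. \<phi> (\<xi> k)) \<circ> (\<lambda>\<omega>. restrict (\<lambda>i. \<omega> i) {k}))"
      by (rule T.indep_var_compose) measurable
    then show ?thesis by (simp add: comp_def)
  qed
  have sq': "(\<lambda>x. (\<phi> x)\<^sup>2) \<in> borel_measurable P" by simp
  show "integrable (PiM UNIV (\<lambda>_. P)) (\<lambda>\<xi>. \<phi> (\<xi> j) * \<phi> (\<xi> k))"
  proof (cases "j = k")
    case True
    then show ?thesis
      using integrable_PiM_coordinate[OF P sq' sq, where j = k] by (simp add: power2_eq_square)
  next
    case False
    show ?thesis
      using T.indep_var_integrable[OF ind[OF False] int int] unfolding T_def .
  qed
  show "(\<integral>\<xi>. \<phi> (\<xi> j) * \<phi> (\<xi> k) \<partial>PiM UNIV (\<lambda>_. P)) = (if j = k then (\<integral>x. (\<phi> x)\<^sup>2 \<partial>P) else 0)"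
  proof (cases "j = k")
    case True
    then show ?thesis
      using integral_PiM_coordinate[OF P sq', of k] by (simp add: power2_eq_square)
  next
    case False
    show ?thesis
      using T.indep_var_lebesgue_integral[OF ind[OF False] int int] m0 False unfolding T_def by simp
  qed
qed

text \<open>
  Averaging \<open>m\<close> independent estimates divides the variance by \<open>m\<close>: in every coordinate the cross terms of
  the squared sum vanish.
\<close>

lemma minibatch_moments:
  fixes G :: "(nat \<Rightarrow> real) \<Rightarrow> 'b \<Rightarrow> nat \<Rightarrow> real" and g :: "nat \<Rightarrow> real"
  assumes P: "prob_space P"
    and meas: "\<And>i. i < n \<Longrightarrow> (\<lambda>\<xi>. G x \<xi> i) \<in> borel_measurable P"
    and sq: "integrable P (\<lambda>\<xi>. (nrm n (vdiff (G x \<xi>) g))\<^sup>2)"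
    and mean: "\<And>i. i < n \<Longrightarrow> (\<integral>\<xi>. G x \<xi> i \<partial>P) = g i"
    and var: "(\<integral>\<xi>. (nrm n (vdiff (G x \<xi>) g))\<^sup>2 \<partial>P) \<le> V"
    and m: "m \<ge> 1"
  shows "integrable (PiM UNIV (\<lambda>_. P)) (\<lambda>\<xi>. (nrm n (vdiff (minibatch G m x \<xi>) g))\<^sup>2)" (is ?int)
    and "i < n \<Longrightarrow> (\<integral>\<xi>. minibatch G m x \<xi> i \<partial>PiM UNIV (\<lambda>_. P)) = g i"
    and "(\<integral>\<xi>. (nrm n (vdiff (minibatch G m x \<xi>) g))\<^sup>2 \<partial>PiM UNIV (\<lambda>_. P)) \<le> V / m" (is ?var)
proof -
  define T where "T = PiM (UNIV :: nat set) (\<lambda>_. P)"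
  interpret T: prob_space T unfolding T_def by (rule prob_space_PiM) (rule P)
  interpret P: prob_space P by (rule P)
  define Z where "Z i \<xi> = G x \<xi> i - g i" for i \<xi>
  have Zm: "Z i \<in> borel_measurable P" if "i < n" for i
    using meas[OF that] unfolding Z_def by simp
  have Zsq: "integrable P (\<lambda>\<xi>. (Z i \<xi>)\<^sup>2)" if i: "i < n" for i
    by (rule Bochner_Integration.integrable_bound[OF sq])
       (use meas[OF i] coordinate_sq_le[OF i, of "vdiff (G x _) g"] in \<open>auto simp: Z_def vdiff_def\<close>)
  have Zint: "integrable P (Z i)" if "i < n" for i
    using P.square_integrable_imp_integrable[OF Zm[OF that] Zsq[OF that]] .
  have Gint: "integrable P (\<lambda>\<xi>. G x \<xi> i)" if "i < n" for i
  proof -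
    have "integrable P (\<lambda>\<xi>. Z i \<xi> + g i)"
      using Zint[OF that] by (rule Bochner_Integration.integrable_add) simp
    then show ?thesis by (simp add: Z_def)
  qed
  have Zmean: "(\<integral>\<xi>. Z i \<xi> \<partial>P) = 0" if "i < n" for i
    using Gint[OF that] mean[OF that] by (simp add: Z_def P.prob_space)
  have prod_int: "integrable T (\<lambda>\<xi>. Z i (\<xi> j) * Z i (\<xi> k))"
    and prod_eq: "(\<integral>\<xi>. Z i (\<xi> j) * Z i (\<xi> k) \<partial>T) = (if j = k then (\<integral>\<xi>. (Z i \<xi>)\<^sup>2 \<partial>P) else 0)"
    if "i < n" for i j k
    unfolding T_def using that P Zm Zsq Zmean
    by (simp_all only: integrable_PiM_product integral_PiM_product)
  have expand: "(nrm n (vdiff (minibatch G m x \<xi>) g))\<^sup>2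
      = (\<Sum>i<n. \<Sum>j<m. \<Sum>k<m. Z i (\<xi> j) * Z i (\<xi> k)) / (real m)\<^sup>2" for \<xi> :: "nat \<Rightarrow> 'b"
  proof -
    have "minibatch G m x \<xi> i - g i = (\<Sum>j<m. Z i (\<xi> j)) / real m" for i
      using m by (simp add: minibatch_def Z_def sum_subtractf field_simps)
    then have "(nrm n (vdiff (minibatch G m x \<xi>) g))\<^sup>2 = (\<Sum>i<n. ((\<Sum>j<m. Z i (\<xi> j)) / real m)\<^sup>2)"
      by (simp add: L2_set_def vdiff_def sum_nonneg)
    also have "\<dots> = (\<Sum>i<n. \<Sum>j<m. \<Sum>k<m. Z i (\<xi> j) * Z i (\<xi> k)) / (real m)\<^sup>2"
      by (simp add: power_divide power2_eq_square sum_product sum_divide_distrib)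
    finally show ?thesis .
  qed
  show ?int
    unfolding expand T_def[symmetric]
    by (intro Bochner_Integration.integrable_divide Bochner_Integration.integrable_sum prod_int) auto
  show "(\<integral>\<xi>. minibatch G m x \<xi> i \<partial>PiM UNIV (\<lambda>_. P)) = g i" if i: "i < n"
  proof -
    have int: "integrable T (\<lambda>\<xi>. G x (\<xi> j) i)" for j
      unfolding T_def by (rule integrable_PiM_coordinate[OF P meas[OF i] Gint[OF i]])
    have eq: "(\<integral>\<xi>. G x (\<xi> j) i \<partial>T) = g i" for j
      unfolding T_def mean[OF i, symmetric] by (rule integral_PiM_coordinate[OF P meas[OF i]])
    have "(\<integral>\<xi>. minibatch G m x \<xi> i \<partial>T) = (\<Sum>j<m. \<integral>\<xi>. G x (\<xi> j) i \<partial>T) / real m"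
      unfolding minibatch_def using int by simp
    also have "\<dots> = g i"
      using m by (simp add: eq)
    finally show ?thesis by (simp add: T_def)
  qed
  have "(\<integral>\<xi>. (nrm n (vdiff (minibatch G m x \<xi>) g))\<^sup>2 \<partial>T)
      = (\<Sum>i<n. \<Sum>j<m. \<Sum>k<m. (\<integral>\<xi>. Z i (\<xi> j) * Z i (\<xi> k) \<partial>T)) / (real m)\<^sup>2"
    unfolding expand by (simp add: Bochner_Integration.integral_sum Bochner_Integration.integrable_sum prod_int)
  also have "\<dots> = (\<Sum>i<n. \<Sum>j<m. \<Sum>k<m. (if j = k then (\<integral>\<xi>. (Z i \<xi>)\<^sup>2 \<partial>P) else 0)) / (real m)\<^sup>2"
    by (simp add: prod_eq)
  also have "\<dots> = (\<Sum>i<n. (\<integral>\<xi>. (Z i \<xi>)\<^sup>2 \<partial>P)) * real m / (real m)\<^sup>2"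
    by (simp add: sum.delta sum_distrib_left[symmetric] mult.commute)
  also have "(\<Sum>i<n. (\<integral>\<xi>. (Z i \<xi>)\<^sup>2 \<partial>P)) = (\<integral>\<xi>. (nrm n (vdiff (G x \<xi>) g))\<^sup>2 \<partial>P)"
    using Zsq by (simp add: L2_set_def vdiff_def Z_def[symmetric] sum_nonneg Bochner_Integration.integral_sum)
  also have "\<dots> * real m / (real m)\<^sup>2 \<le> V * real m / (real m)\<^sup>2"
    using var by (intro divide_right_mono mult_right_mono) auto
  also have "\<dots> = V / m"
    using m by (simp add: power2_eq_square)
  finally show ?var unfolding T_def .
qed

section \<open>Measurability\<close>

lemma space_borel_Rn [simp]: "space (borel_Rn n) = Rn n"
  by (simp add: borel_Rn_def space_restrict_space)

lemma measurable_borel_Rn_coordinate [measurable]: "(\<lambda>x. x i) \<in> borel_measurable (borel_Rn n)"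
  unfolding borel_Rn_def
  by (intro measurable_restrict_space1 borel_measurable_continuous_onI continuous_on_product_coordinates)

lemma measurable_into_borel_Rn:
  assumes "\<And>\<omega>. \<omega> \<in> space M \<Longrightarrow> X \<omega> \<in> Rn n" "\<And>i. (\<lambda>\<omega>. X \<omega> i) \<in> borel_measurable M"
  shows "X \<in> M \<rightarrow>\<^sub>M borel_Rn n"
  unfolding borel_Rn_def using assms
  by (intro measurable_restrict_space2 measurable_coordinatewise_then_product) auto

text \<open>
  A convex function is the supremum of its affine minorants, so its sublevel sets are closed.
\<close>

lemma measurable_strongly_convex:
  assumes sc: "strongly_convex n \<mu> f g" and \<mu>: "\<mu> \<ge> 0"
  shows "f \<in> borel_measurable (borel_Rn n)"
proof (subst borel_measurable_iff_le, intro allI)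
  fix a
  define K where "K = (\<Inter>y\<in>Rn n. {x. f y + ip n (g y) (vdiff x y) \<le> a})"
  have "closed K"
    unfolding K_def ip_def vdiff_def
    by (intro closed_INT ballI closed_Collect_le continuous_intros continuous_on_product_coordinates)
  have minorant: "f y + ip n (g y) (vdiff x y) \<le> f x" if "x \<in> Rn n" "y \<in> Rn n" for x y
  proof -
    have "f x \<ge> f y + ip n (g y) (vdiff x y) + \<mu> / 2 * (nrm n (vdiff x y))\<^sup>2"
      using sc that by (auto simp: strongly_convex_def)
    then show ?thesis using \<mu> by (smt (verit) mult_nonneg_nonneg zero_le_power2 divide_nonneg_pos)
  qed
  have "{x \<in> space (borel_Rn n). f x \<le> a} = K \<inter> Rn n"
  proof (intro equalityI subsetI)
    fix x assume "x \<in> {x \<in> space (borel_Rn n). f x \<le> a}"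
    then show "x \<in> K \<inter> Rn n" using minorant by (force simp: K_def)
  next
    fix x assume x: "x \<in> K \<inter> Rn n"
    then have "f x + ip n (g x) (vdiff x x) \<le> a" by (auto simp: K_def)
    then show "x \<in> {x \<in> space (borel_Rn n). f x \<le> a}"
      using x by (simp add: ip_def vdiff_def)
  qed
  also have "\<dots> \<in> sets (borel_Rn n)"
    unfolding borel_Rn_def sets_restrict_space using \<open>closed K\<close> by (auto simp: Int_commute)
  finally show "{x \<in> space (borel_Rn n). f x \<le> a} \<in> sets (borel_Rn n)" .
qed

lemma measurable_clipped_step:
  assumes G: "(\<lambda>(x, \<xi>). G x \<xi>) \<in> borel_Rn n \<Otimes>\<^sub>M P \<rightarrow>\<^sub>M borel_Rn n"
    and X[measurable]: "X \<in> M \<rightarrow>\<^sub>M borel_Rn n" and W[measurable]: "\<And>j. (\<lambda>\<omega>. W \<omega> j) \<in> M \<rightarrow>\<^sub>M P"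
  shows "(\<lambda>\<omega> i. X \<omega> i - \<gamma> * clip n (minibatch G m (X \<omega>) (W \<omega>)) c i) \<in> M \<rightarrow>\<^sub>M borel_Rn n"
proof -
  have GW: "(\<lambda>\<omega>. G (X \<omega>) (W \<omega> j)) \<in> M \<rightarrow>\<^sub>M borel_Rn n" for j
    using measurable_compose[OF measurable_Pair[OF X W[of j]] G] by simp
  have [measurable]: "(\<lambda>\<omega>. G (X \<omega>) (W \<omega> j) i) \<in> borel_measurable M" for i j
    using measurable_compose[OF GW measurable_borel_Rn_coordinate] .
  have [measurable]: "(\<lambda>\<omega>. X \<omega> i) \<in> borel_measurable M" for i
    using measurable_compose[OF X measurable_borel_Rn_coordinate] .
  show ?thesis
  proof (rule measurable_into_borel_Rn)
    fix \<omega> assume \<omega>: "\<omega> \<in> space M"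
    have "G (X \<omega>) (W \<omega> j) \<in> Rn n" "X \<omega> \<in> Rn n" for j
      using measurable_space[OF GW \<omega>] measurable_space[OF X \<omega>] by simp_all
    then show "(\<lambda>i. X \<omega> i - \<gamma> * clip n (minibatch G m (X \<omega>) (W \<omega>)) c i) \<in> Rn n"
      by (simp add: Rn_def clip_def minibatch_def)
  next
    show "(\<lambda>\<omega>. X \<omega> i - \<gamma> * clip n (minibatch G m (X \<omega>) (W \<omega>)) c i) \<in> borel_measurable M" for i
      unfolding clip_def minibatch_def L2_set_def by measurable
  qed
qed

lemma measurable_clipped_SGD_iterate:
  assumes G: "(\<lambda>(x, \<xi>). G x \<xi>) \<in> borel_Rn n \<Otimes>\<^sub>M P \<rightarrow>\<^sub>M borel_Rn n"
    and X: "X \<in> M \<rightarrow>\<^sub>M borel_Rn n" and W: "\<And>k j. (\<lambda>\<omega>. W \<omega> k j) \<in> M \<rightarrow>\<^sub>M P"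
  shows "(\<lambda>\<omega>. clipped_SGD_iterate n G m \<gamma> B (X \<omega>) (W \<omega>) k) \<in> M \<rightarrow>\<^sub>M borel_Rn n"
proof (induction k)
  case (Suc k)
  show ?case
    using measurable_clipped_step[OF G Suc W] by (simp add: Let_def)
qed (simp add: X)

lemma measurable_clipped_SGD:
  assumes G: "(\<lambda>(x, \<xi>). G x \<xi>) \<in> borel_Rn n \<Otimes>\<^sub>M P \<rightarrow>\<^sub>M borel_Rn n"
    and X: "X \<in> M \<rightarrow>\<^sub>M borel_Rn n" and W: "\<And>k j. (\<lambda>\<omega>. W \<omega> k j) \<in> M \<rightarrow>\<^sub>M P"
  shows "(\<lambda>\<omega>. clipped_SGD n G N m \<gamma> B (X \<omega>) (W \<omega>)) \<in> M \<rightarrow>\<^sub>M borel_Rn n"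
proof (rule measurable_into_borel_Rn)
  note it = measurable_clipped_SGD_iterate[OF G X W, of m \<gamma> B]
  show "clipped_SGD n G N m \<gamma> B (X \<omega>) (W \<omega>) \<in> Rn n" if "\<omega> \<in> space M" for \<omega>
  proof -
    have "clipped_SGD_iterate n G m \<gamma> B (X \<omega>) (W \<omega>) k \<in> Rn n" for k
      using measurable_space[OF it that] by simp
    then show ?thesis by (simp add: clipped_SGD_def Rn_def)
  qed
  have [measurable]: "(\<lambda>\<omega>. clipped_SGD_iterate n G m \<gamma> B (X \<omega>) (W \<omega>) k i) \<in> borel_measurable M" for k i
    using measurable_compose[OF it measurable_borel_Rn_coordinate] .
  show "(\<lambda>\<omega>. clipped_SGD n G N m \<gamma> B (X \<omega>) (W \<omega>) i) \<in> borel_measurable M" for i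
    unfolding clipped_SGD_def by measurable
qed

lemma measurable_R_clipped_SGD:
  assumes G: "(\<lambda>(x, \<xi>). G x \<xi>) \<in> borel_Rn n \<Otimes>\<^sub>M P \<rightarrow>\<^sub>M borel_Rn n" and x0: "x0 \<in> Rn n"
  shows "(\<lambda>\<omega>. R_clipped_SGD n G N m \<gamma> B x0 \<omega> t) \<in> samples P \<rightarrow>\<^sub>M borel_Rn n"
proof (induction t)
  case (Suc t)
  have "(\<lambda>\<omega>. \<omega> (Suc t, k, j)) \<in> samples P \<rightarrow>\<^sub>M P" for k j
    unfolding samples_def by measurable
  from measurable_clipped_SGD[OF G Suc this]
  show ?case by simp
qed (simp add: x0)

section \<open>A single run of clipped SGD\<close>

lemma clipped_SGD_iterate_cong:
  assumes "\<And>l j. l < k \<Longrightarrow> W l j = W' l j"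
  shows "clipped_SGD_iterate n G m \<gamma> B x0 W k = clipped_SGD_iterate n G m \<gamma> B x0 W' k"
  using assms
proof (induction k)
  case (Suc k)
  have "W k = W' k" using Suc.prems by auto
  moreover have "clipped_SGD_iterate n G m \<gamma> B x0 W k = clipped_SGD_iterate n G m \<gamma> B x0 W' k"
    using Suc by auto
  ultimately show ?case by (simp add: Let_def)
qed simp

text \<open>
  The parameters of the method are not fixed here, since they are chosen before the dimension, the
  objective and the oracle.
\<close>

locale stochastic_problem =
  fixes \<nu> M \<mu> \<sigma> R0 :: real and n :: nat and f :: "(nat \<Rightarrow> real) \<Rightarrow> real"
    and g :: "(nat \<Rightarrow> real) \<Rightarrow> nat \<Rightarrow> real" and xs :: "nat \<Rightarrow> real"
    and P :: "'b measure" and G :: "(nat \<Rightarrow> real) \<Rightarrow> 'b \<Rightarrow> nat \<Rightarrow> real"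
  assumes \<nu>: "0 \<le> \<nu>" "\<nu> \<le> 1" and M: "M > 0" and \<mu>: "\<mu> > 0" and R0: "R0 > 0"
    and minimizer: "is_minimizer n f xs"
    and gradient: "grad_map n \<nu> f g xs"
    and convex: "strongly_convex n \<mu> f g"
    and stoch_grad: "oracle_on n P G g \<sigma> (cballn n xs (7 * R0))"
    and smooth: "smoothness_on n f g xs \<nu> M (cballn n xs (7 * R0))"
begin

abbreviation gap :: "(nat \<Rightarrow> real) \<Rightarrow> real" where "gap x \<equiv> f x - f xs"

abbreviation radius :: "(nat \<Rightarrow> real) \<Rightarrow> real" where "radius x \<equiv> nrm n (vdiff x xs)"

lemma prob_P: "prob_space P"
  and G_measurable: "(\<lambda>(x, \<xi>). G x \<xi>) \<in> borel_Rn n \<Otimes>\<^sub>M P \<rightarrow>\<^sub>M borel_Rn n"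
  using stoch_grad by (auto simp: oracle_on_def)

lemma xs_Rn: "xs \<in> Rn n"
  using minimizer by (simp add: is_minimizer_def)

lemma gap_nonneg: "x \<in> Rn n \<Longrightarrow> 0 \<le> gap x"
  using minimizer by (simp add: is_minimizer_def)

lemma f_measurable: "f \<in> borel_measurable (borel_Rn n)"
  using measurable_strongly_convex[OF convex] \<mu> by simp

lemma subgradient_inequality:
  assumes "x \<in> Rn n" "y \<in> Rn n"
  shows "f x + ip n (g x) (vdiff y x) + \<mu> / 2 * (nrm n (vdiff y x))\<^sup>2 \<le> f y"
  using convex assms by (auto simp: strongly_convex_def)

lemma subgradient_inequality':
  assumes "x \<in> Rn n" "y \<in> Rn n"
  shows "f x + ip n (g x) (vdiff y x) \<le> f y"
  using subgradient_inequality[OF assms] \<mu> zero_le_power2[of "nrm n (vdiff y x)"]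
    mult_nonneg_nonneg[of "\<mu> / 2" "(nrm n (vdiff y x))\<^sup>2"] by linarith

lemma gap_le_ip: "x \<in> Rn n \<Longrightarrow> gap x \<le> ip n (g x) (vdiff x xs)"
  using subgradient_inequality'[of x xs] xs_Rn
  by (simp add: ip_def vdiff_def algebra_simps sum_subtractf)

lemma xs_in_ball: "xs \<in> cballn n xs (7 * R0)"
  using xs_Rn R0 by (simp add: cballn_def vdiff_def L2_set_0')

text \<open>
  For \<open>\<nu> > 0\<close> this is the bound of the gradient by a power of the gap, taken at the minimizer.
\<close>

lemma gradient_xs: "nrm n (g xs) = 0"
proof (cases "\<nu> = 0")
  case True
  then show ?thesis using gradient by (simp add: grad_map_def L2_set_0')
next
  case False
  then have "nrm n (g xs) \<le> 0"
    using smooth xs_in_ball by (auto simp: smoothness_on_def)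
  then show ?thesis using L2_set_nonneg[of "g xs" "{..<n}"] by linarith
qed

lemma gap_ge_radius: "x \<in> Rn n \<Longrightarrow> \<mu> / 2 * (radius x)\<^sup>2 \<le> gap x"
  using subgradient_inequality[of xs x] xs_Rn gradient_xs abs_ip_le[of n "g xs" "vdiff x xs"]
  by simp

lemma gradient_le:
  assumes x: "x \<in> Rn n" "radius x \<le> r" "r \<le> 7 * R0"
  shows "nrm n (g x) \<le> M * r powr \<nu>"
proof -
  have "x \<in> cballn n xs (7 * R0)" using x by (simp add: cballn_def)
  then have "nrm n (vdiff (g x) (g xs)) \<le> M * radius x powr \<nu>"
    using smooth xs_in_ball by (auto simp: smoothness_on_def)
  also have "\<dots> \<le> M * r powr \<nu>"
    using M \<nu> x by (intro mult_left_mono powr_mono2) auto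
  finally show ?thesis
    using nrm_le_add_vdiff[where n = n and x = "g x" and y = "g xs"] gradient_xs by linarith
qed

text \<open>
  Up to an error of order \<open>\<delta>\<close> in the function value, \<open>f\<close> behaves on the ball like a function whose gradient
  is Lipschitz with this constant.
\<close>

definition curvature :: "real \<Rightarrow> real" where
  "curvature \<delta> = (1 / \<delta>) powr ((1 - \<nu>) / (1 + \<nu>)) * M powr (2 / (1 + \<nu>))"

lemma gradient_sq_le:
  assumes x: "x \<in> Rn n" "radius x \<le> 7 * R0" and \<delta>: "\<delta> > 0"
  shows "(nrm n (g x))\<^sup>2 \<le> 2 * curvature \<delta> * gap x + curvature \<delta> * \<delta>"
proof -
  have "x \<in> cballn n xs (7 * R0)" using x by (simp add: cballn_def)
  then have "(nrm n (g x))\<^sup>2 \<le>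
        2 * (1 / \<delta>) powr ((1 - \<nu>) / (1 + \<nu>)) * M powr (2 / (1 + \<nu>)) * gap x
        + \<delta> powr (2 * \<nu> / (1 + \<nu>)) * M powr (2 / (1 + \<nu>))"
    using smooth \<delta> by (auto simp: smoothness_on_def)
  also have "\<delta> powr (2 * \<nu> / (1 + \<nu>)) = (1 / \<delta>) powr ((1 - \<nu>) / (1 + \<nu>)) * \<delta>"
  proof -
    have "2 * \<nu> / (1 + \<nu>) = - ((1 - \<nu>) / (1 + \<nu>)) + 1"
      using \<nu> by (simp add: field_simps)
    then have "\<delta> powr (2 * \<nu> / (1 + \<nu>)) = \<delta> powr (- ((1 - \<nu>) / (1 + \<nu>))) * \<delta> powr 1"
      by (simp only: powr_add)
    then show ?thesis using \<delta> by (simp add: powr_minus powr_divide inverse_eq_divide)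
  qed
  finally show ?thesis by (simp add: curvature_def mult_ac)
qed

lemma gap_average_le:
  assumes x: "\<And>k. k < N \<Longrightarrow> x k \<in> Rn n" and N: "N \<ge> 1"
  shows "real N * gap (\<lambda>i. (\<Sum>k<N. x k i) / real N) \<le> (\<Sum>k<N. gap (x k))"
proof -
  define y where "y = (\<lambda>i. (\<Sum>k<N. x k i) / real N)"
  have y: "y \<in> Rn n" using x by (auto simp: y_def Rn_def)
  have Ny: "real N * y i = (\<Sum>k<N. x k i)" for i using N by (simp add: y_def)
  have "(\<Sum>k<N. ip n (g y) (vdiff (x k) y)) = (\<Sum>i<n. g y i * (\<Sum>k<N. x k i - y i))"
    unfolding ip_def vdiff_def by (subst sum.swap) (simp add: sum_distrib_left)
  also have "\<dots> = 0"
    by (simp add: sum_subtractf Ny)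
  finally have "(\<Sum>k<N. f y + ip n (g y) (vdiff (x k) y)) = real N * f y"
    by (simp add: sum.distrib)
  moreover have "(\<Sum>k<N. f y + ip n (g y) (vdiff (x k) y)) \<le> (\<Sum>k<N. f (x k))"
    using x y by (intro sum_mono subgradient_inequality') auto
  ultimately show ?thesis
    by (simp add: y_def[symmetric] sum_subtractf algebra_simps)
qed

definition step :: "nat \<Rightarrow> real \<Rightarrow> real \<Rightarrow> (nat \<Rightarrow> real) \<Rightarrow> (nat \<Rightarrow> 'b) \<Rightarrow> nat \<Rightarrow> real" where
  "step m \<gamma> B x \<xi> = (\<lambda>i. x i - \<gamma> * clip n (minibatch G m x \<xi>) (B / \<gamma>) i)"

text \<open>
  The choice \<open>s = 2 * \<theta> / R\<^sup>2\<close> and \<open>B = R / (20 * \<theta>)\<close> makes \<open>10 * s * B * R = 1\<close>, which is what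
  \<open>clipped_step_mgf\<close> needs. The bound \<open>\<gamma>2\<close> on the stepsize says that \<open>B / \<gamma>\<close> is at least twice the norm of the
  gradient on the ball of radius \<open>2 * R\<close>. The error \<open>\<gamma> * e / 2\<close> is made up of \<open>\<gamma> * e / 4\<close> from the squared
  norm of the gradient and \<open>\<gamma> * e / 4\<close> from the noise, the latter by the choice of the batch size.
\<close>

lemma step_mgf:
  assumes R: "0 < R" "R \<le> R0" and e: "e > 0" and \<theta>: "\<theta> \<ge> 1" and m: "m \<ge> 1" and \<gamma>: "\<gamma> > 0"
    and \<gamma>1: "\<gamma> * curvature e \<le> 1 / 4"
    and \<gamma>2: "80 * \<gamma> * M * R powr \<nu> * \<theta> \<le> R"
    and batch: "560 * \<theta> * \<gamma> * \<sigma>\<^sup>2 / e \<le> real m"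
    and x: "x \<in> Rn n" "radius x \<le> 2 * R"
  shows "(\<integral>\<^sup>+\<xi>. ennreal (exp (2 * \<theta> / R\<^sup>2 * (radius (step m \<gamma> (R / (20 * \<theta>)) x \<xi>))\<^sup>2)) \<partial>PiM UNIV (\<lambda>_. P))
    \<le> ennreal (exp (2 * \<theta> / R\<^sup>2 * ((radius x)\<^sup>2 - \<gamma> * gap x + \<gamma> * e / 2)))"
proof -
  define B where "B = R / (20 * \<theta>)"
  define s where "s = 2 * \<theta> / R\<^sup>2"
  interpret T: prob_space "PiM UNIV (\<lambda>_. P)"
    by (rule prob_space_PiM) (rule prob_P)
  have B: "0 < B" "B \<le> R" using R \<theta> by (auto simp: B_def field_simps)
  have s: "s > 0" using R \<theta> by (simp add: s_def)
  have sBR: "10 * s * B * R \<le> 1" using R \<theta> by (simp add: s_def B_def power2_eq_square)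
  have sR: "s * R\<^sup>2 = 2 * \<theta>" using R by (simp add: s_def)
  have RB: "5 * R / (2 * B) = 50 * \<theta>" using R \<theta> by (simp add: B_def)
  have xball: "x \<in> cballn n xs (7 * R0)" using x R by (simp add: cballn_def)
  have Gx: "(\<lambda>\<xi>. G x \<xi> i) \<in> borel_measurable P" for i
  proof -
    have "(\<lambda>\<xi>. G x \<xi>) \<in> P \<rightarrow>\<^sub>M borel_Rn n"
      using measurable_compose[OF measurable_Pair1' G_measurable, of x] x by simp
    then show ?thesis using measurable_compose[OF _ measurable_borel_Rn_coordinate] by blast
  qed
  have sq: "integrable P (\<lambda>\<xi>. (nrm n (vdiff (G x \<xi>) (g x)))\<^sup>2)"
    using stoch_grad x by (auto simp: oracle_on_def)
  have mean: "(\<integral>\<xi>. G x \<xi> i \<partial>P) = g x i" if "i < n" for i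
    using stoch_grad xball that by (auto simp: oracle_on_def)
  have var: "(\<integral>\<xi>. (nrm n (vdiff (G x \<xi>) (g x)))\<^sup>2 \<partial>P) \<le> \<sigma>\<^sup>2"
    using stoch_grad xball by (auto simp: oracle_on_def)
  note mom = minibatch_moments[where G = G and x = x, OF prob_P Gx sq mean var m]
  have mb: "(\<lambda>\<xi>. minibatch G m x \<xi> i) \<in> borel_measurable (PiM UNIV (\<lambda>_. P))" for i
    unfolding minibatch_def using Gx by measurable
  have "nrm n (g x) \<le> M * (2 * R) powr \<nu>"
    using x R by (intro gradient_le) auto
  also have "\<dots> \<le> M * (2 * R powr \<nu>)"
  proof (rule mult_left_mono)
    have "(2::real) powr \<nu> \<le> 2 powr 1" using \<nu> by (intro powr_mono) auto
    then show "(2 * R) powr \<nu> \<le> 2 * R powr \<nu>"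
      using R by (simp add: powr_mult mult_right_mono)
  qed (use M in simp)
  finally have "2 * nrm n (g x) \<le> 4 * M * R powr \<nu>" by simp
  also have "\<dots> \<le> B / \<gamma>"
    using \<gamma>2 \<theta> \<gamma> by (simp add: B_def field_simps)
  finally have gB: "2 * nrm n (g x) \<le> B / \<gamma>" .
  have V: "\<gamma>\<^sup>2 * (\<sigma>\<^sup>2 / real m) * (5 * R / (2 * B) + 1 + 43 * s * R\<^sup>2) \<le> \<gamma> * e / 4"
  proof -
    have "5 * R / (2 * B) + 1 + 43 * s * R\<^sup>2 = 50 * \<theta> + 1 + 43 * (s * R\<^sup>2)" by (simp add: RB)
    also have "\<dots> \<le> 140 * \<theta>" unfolding sR using \<theta> by simp
    finally have "\<gamma>\<^sup>2 * (\<sigma>\<^sup>2 / real m) * (5 * R / (2 * B) + 1 + 43 * s * R\<^sup>2) \<le> \<gamma>\<^sup>2 * (\<sigma>\<^sup>2 / real m) * (140 * \<theta>)"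
      by (intro mult_left_mono) auto
    also have "\<dots> = \<gamma> / 4 * (560 * \<theta> * \<gamma> * \<sigma>\<^sup>2 / real m)"
      by (simp add: power2_eq_square)
    also have "\<dots> \<le> \<gamma> / 4 * e"
    proof (rule mult_left_mono)
      have "560 * \<theta> * \<gamma> * \<sigma>\<^sup>2 \<le> real m * e"
        using batch e by (simp add: pos_divide_le_eq)
      then show "560 * \<theta> * \<gamma> * \<sigma>\<^sup>2 / real m \<le> e"
        using m by (simp add: pos_divide_le_eq mult.commute)
    qed (use \<gamma> in simp)
    finally show ?thesis by simp
  qed
  have quad: "- 2 * \<gamma> * ip n (g x) (vdiff x xs) + \<gamma>\<^sup>2 * (nrm n (g x))\<^sup>2 \<le> - \<gamma> * gap x + \<gamma> * e / 4"
  proof -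
    have "(nrm n (g x))\<^sup>2 \<le> 2 * curvature e * gap x + curvature e * e"
      using x R e by (intro gradient_sq_le) auto
    then have "\<gamma>\<^sup>2 * (nrm n (g x))\<^sup>2 \<le> \<gamma>\<^sup>2 * (2 * curvature e * gap x + curvature e * e)"
      by (rule mult_left_mono) simp
    also have "\<dots> = \<gamma> * (\<gamma> * curvature e) * (2 * gap x + e)"
      by (simp add: power2_eq_square algebra_simps)
    also have "\<dots> \<le> \<gamma> * (1 / 4) * (2 * gap x + e)"
      using \<gamma>1 \<gamma> e gap_nonneg[OF x(1)] by (intro mult_right_mono mult_left_mono) auto
    also have "\<dots> = \<gamma> * gap x / 2 + \<gamma> * e / 4" by (simp add: field_simps)
    finally have "\<gamma>\<^sup>2 * (nrm n (g x))\<^sup>2 \<le> \<gamma> * gap x / 2 + \<gamma> * e / 4" .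
    moreover have "\<gamma> * gap x \<le> \<gamma> * ip n (g x) (vdiff x xs)"
      using gap_le_ip[OF x(1)] \<gamma> by (intro mult_left_mono) auto
    moreover have "0 \<le> \<gamma> * gap x" using \<gamma> gap_nonneg[OF x(1)] by simp
    moreover have "- 2 * \<gamma> * ip n (g x) (vdiff x xs) = - 2 * (\<gamma> * ip n (g x) (vdiff x xs))" by simp
    ultimately show ?thesis by linarith
  qed
  have "vdiff (step m \<gamma> B x \<xi>) xs = (\<lambda>i. vdiff x xs i - \<gamma> * clip n (minibatch G m x \<xi>) (B / \<gamma>) i)" for \<xi>
    by (auto simp: vdiff_def step_def)
  then have "(\<integral>\<^sup>+\<xi>. ennreal (exp (s * (radius (step m \<gamma> B x \<xi>))\<^sup>2)) \<partial>PiM UNIV (\<lambda>_. P))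
    \<le> ennreal (exp (s * ((nrm n (vdiff x xs))\<^sup>2 - 2 * \<gamma> * ip n (g x) (vdiff x xs) + \<gamma>\<^sup>2 * (nrm n (g x))\<^sup>2
          + \<gamma>\<^sup>2 * (\<sigma>\<^sup>2 / real m) * (5 * R / (2 * B) + 1 + 43 * s * R\<^sup>2))))"
    using T.clipped_step_mgf[OF mb mom(1) mom(2) mom(3) x(2) B \<gamma> gB s sBR] by simp
  also have "\<dots> \<le> ennreal (exp (s * ((radius x)\<^sup>2 - \<gamma> * gap x + \<gamma> * e / 2)))"
  proof (intro ennreal_leI, unfold exp_le_cancel_iff, rule mult_left_mono)
    show "(radius x)\<^sup>2 - 2 * \<gamma> * ip n (g x) (vdiff x xs) + \<gamma>\<^sup>2 * (nrm n (g x))\<^sup>2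
        + \<gamma>\<^sup>2 * (\<sigma>\<^sup>2 / real m) * (5 * R / (2 * B) + 1 + 43 * s * R\<^sup>2)
      \<le> (radius x)\<^sup>2 - \<gamma> * gap x + \<gamma> * e / 2"
      using V quad by linarith
  qed (use s in simp)
  finally show ?thesis by (simp add: B_def s_def)
qed

text \<open>
  Up to the factor \<open>exp (s * \<gamma> * e / 2)\<close> per step, \<open>H k\<close> is a supermartingale, stopped on leaving the ball
  of radius \<open>2 * R\<close>. A constant is enough as its value after that time, since the process is at least
  \<open>exp (4 * s * R\<^sup>2)\<close> when it leaves the ball. The Markov inequality is applied to \<open>H N\<close> only, which
  is why the failure probability does not grow with the number of iterations.
\<close>

lemma clipped_SGD_failure:
  assumes R: "0 < R" "R \<le> R0" and e: "e > 0" and \<theta>: "\<theta> \<ge> 1"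
    and N: "N \<ge> 1" and m: "m \<ge> 1" and \<gamma>: "\<gamma> > 0"
    and \<gamma>N: "real N * \<gamma> * e = 3 * R\<^sup>2"
    and \<gamma>1: "\<gamma> * curvature e \<le> 1 / 4"
    and \<gamma>2: "80 * \<gamma> * M * R powr \<nu> * \<theta> \<le> R"
    and batch: "560 * \<theta> * \<gamma> * \<sigma>\<^sup>2 / e \<le> real m"
    and x0: "x0 \<in> Rn n" "radius x0 \<le> R"
  shows "emeasure (PiM UNIV (\<lambda>_::nat \<times> nat. P))
      {\<omega> \<in> space (PiM UNIV (\<lambda>_. P)).
        e < gap (clipped_SGD n G N m \<gamma> (R / (20 * \<theta>)) x0 (\<lambda>k j. \<omega> (k, j)))} \<le> ennreal (exp (- \<theta>))"
proof -
  define T where "T = PiM (UNIV :: (nat \<times> nat) set) (\<lambda>_. P)"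
  define T1 where "T1 = PiM (UNIV :: nat set) (\<lambda>_. P)"
  interpret T: prob_space T unfolding T_def by (rule prob_space_PiM) (rule prob_P)
  interpret T1: prob_space T1 unfolding T1_def by (rule prob_space_PiM) (rule prob_P)
  define B where "B = R / (20 * \<theta>)"
  define s where "s = 2 * \<theta> / R\<^sup>2"
  have s: "s > 0" using R \<theta> by (simp add: s_def)
  have sR: "s * R\<^sup>2 = 2 * \<theta>" using R by (simp add: s_def)
  define x where "x k \<omega> = clipped_SGD_iterate n G m \<gamma> B x0 (\<lambda>k j. \<omega> (k, j)) k"
    for k and \<omega> :: "nat \<times> nat \<Rightarrow> 'b"
  define A where "A k \<omega> = \<gamma> * (\<Sum>l<k. gap (x l \<omega>))" for k \<omega>
  define ok where "ok k \<omega> \<longleftrightarrow> (\<forall>l<k. radius (x l \<omega>) \<le> 2 * R)" for k \<omega>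
  define H where "H k \<omega> = (if ok k \<omega> then exp (s * ((radius (x k \<omega>))\<^sup>2 + A k \<omega>)) else exp (s * (4 * R\<^sup>2)))"
    for k \<omega>
  have coord: "(\<lambda>\<omega>. \<omega> (k, j)) \<in> T \<rightarrow>\<^sub>M P" for k j unfolding T_def by measurable
  have x_meas: "x k \<in> T \<rightarrow>\<^sub>M borel_Rn n" for k
    unfolding x_def using measurable_clipped_SGD_iterate[OF G_measurable _ coord, of "\<lambda>_. x0"] x0 by simp
  have x_Rn: "x k \<omega> \<in> Rn n" if "\<omega> \<in> space T" for k \<omega>
    using measurable_space[OF x_meas that] by simp
  have gap_meas[measurable]: "(\<lambda>\<omega>. gap (x k \<omega>)) \<in> borel_measurable T" for k
    using measurable_compose[OF x_meas f_measurable] by simp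
  have radius_borel: "radius \<in> borel_measurable (borel_Rn n)"
    unfolding L2_set_def vdiff_def by measurable
  have radius_meas[measurable]: "(\<lambda>\<omega>. radius (x k \<omega>)) \<in> borel_measurable T" for k
    using measurable_compose[OF x_meas radius_borel] .
  have A_meas[measurable]: "A k \<in> borel_measurable T" for k
    unfolding A_def by measurable
  have ok_meas[measurable]: "Measurable.pred T (ok k)" for k
    unfolding ok_def by measurable
  have H_meas[measurable]: "H k \<in> borel_measurable T" for k
    unfolding H_def by measurable
  have A_nonneg: "0 \<le> A k \<omega>" if "\<omega> \<in> space T" for k \<omega>
    unfolding A_def using \<gamma> gap_nonneg[OF x_Rn[OF that]] by (intro mult_nonneg_nonneg sum_nonneg) auto
  have H_bound: "(\<integral>\<^sup>+\<omega>. ennreal (H k \<omega>) \<partial>T) \<le> ennreal (exp (s * (R\<^sup>2 + real k * (\<gamma> * e / 2))))" for k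
  proof (induction k)
    case 0
    have "s * (radius x0)\<^sup>2 \<le> s * R\<^sup>2"
      using x0(2) s by (intro mult_left_mono power_mono) auto
    then show ?case
      by (simp add: H_def ok_def x_def A_def T.emeasure_space_1)
  next
    case (Suc k)
    \<comment> \<open>\<open>H (Suc k)\<close> as a function of the samples before iteration \<open>k\<close> and of the fresh samples \<open>\<xi>\<close>.\<close>
    define h where "h = (\<lambda>(\<omega>, \<xi>). if ok (Suc k) \<omega>
        then ennreal (exp (s * ((radius (step m \<gamma> B (x k \<omega>) \<xi>))\<^sup>2 + A (Suc k) \<omega>)))
        else ennreal (exp (s * (4 * R\<^sup>2))))"
    have step_meas: "(\<lambda>z. step m \<gamma> B (x k (fst z)) (snd z)) \<in> T \<Otimes>\<^sub>M T1 \<rightarrow>\<^sub>M borel_Rn n"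
      unfolding step_def
    proof (rule measurable_clipped_step[OF G_measurable])
      show "(\<lambda>z. x k (fst z)) \<in> T \<Otimes>\<^sub>M T1 \<rightarrow>\<^sub>M borel_Rn n"
        by (rule measurable_compose[OF measurable_fst x_meas])
      show "(\<lambda>z. snd z j) \<in> T \<Otimes>\<^sub>M T1 \<rightarrow>\<^sub>M P" for j
        unfolding T1_def by measurable
    qed
    have radius_step[measurable]: "(\<lambda>z. radius (step m \<gamma> B (x k (fst z)) (snd z))) \<in> borel_measurable (T \<Otimes>\<^sub>M T1)"
      using measurable_compose[OF step_meas radius_borel] .
    have h_meas: "h \<in> borel_measurable (T \<Otimes>\<^sub>M T1)"
      unfolding h_def split_beta by measurable
    have dep: "h (\<omega>, \<xi>) = h (\<omega>', \<xi>)" if "\<And>i. i \<in> {..<k} \<times> UNIV \<Longrightarrow> \<omega> i = \<omega>' i" for \<omega> \<omega>' \<xi>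
    proof -
      have "x l \<omega> = x l \<omega>'" if "l \<le> k" for l
        unfolding x_def using \<open>\<And>i. i \<in> {..<k} \<times> UNIV \<Longrightarrow> \<omega> i = \<omega>' i\<close> that
        by (intro clipped_SGD_iterate_cong) auto
      then have "x k \<omega> = x k \<omega>'" "ok (Suc k) \<omega> = ok (Suc k) \<omega>'" "A (Suc k) \<omega> = A (Suc k) \<omega>'"
        by (auto simp: ok_def A_def intro!: sum.cong)
      then show ?thesis by (simp add: h_def)
    qed
    have fresh: "(\<integral>\<^sup>+\<omega>. h (\<omega>, \<lambda>j. \<omega> (k, j)) \<partial>T) = (\<integral>\<^sup>+\<omega>. (\<integral>\<^sup>+\<xi>. h (\<omega>, \<xi>) \<partial>T1) \<partial>T)"
      unfolding T_def T1_def
    proof (rule nn_integral_PiM_fresh_block[OF prob_P])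
      show "inj (Pair k :: nat \<Rightarrow> nat \<times> nat)" by (simp add: inj_on_def)
      show "range (Pair k) \<inter> ({..<k} \<times> (UNIV :: nat set)) = {}" by auto
      show "h \<in> borel_measurable (PiM UNIV (\<lambda>_. P) \<Otimes>\<^sub>M PiM UNIV (\<lambda>_. P))"
        using h_meas unfolding T_def T1_def .
    qed (rule dep)
    have "ennreal (H (Suc k) \<omega>) = h (\<omega>, \<lambda>j. \<omega> (k, j))" for \<omega>
      by (simp add: H_def h_def x_def step_def Let_def)
    then have "(\<integral>\<^sup>+\<omega>. ennreal (H (Suc k) \<omega>) \<partial>T) = (\<integral>\<^sup>+\<omega>. (\<integral>\<^sup>+\<xi>. h (\<omega>, \<xi>) \<partial>T1) \<partial>T)"
      using fresh by simp
    also have "\<dots> \<le> (\<integral>\<^sup>+\<omega>. ennreal (exp (s * (\<gamma> * e / 2))) * ennreal (H k \<omega>) \<partial>T)"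
    proof (rule nn_integral_mono)
      fix \<omega> assume \<omega>: "\<omega> \<in> space T"
      show "(\<integral>\<^sup>+\<xi>. h (\<omega>, \<xi>) \<partial>T1) \<le> ennreal (exp (s * (\<gamma> * e / 2))) * ennreal (H k \<omega>)"
      proof (cases "ok (Suc k) \<omega>")
        case True
        then have ok: "ok k \<omega>" "radius (x k \<omega>) \<le> 2 * R" by (auto simp: ok_def)
        have "Pair \<omega> \<in> T1 \<rightarrow>\<^sub>M T \<Otimes>\<^sub>M T1" using \<omega> by simp
        from measurable_compose[OF this radius_step]
        have [measurable]: "(\<lambda>\<xi>. radius (step m \<gamma> B (x k \<omega>) \<xi>)) \<in> borel_measurable T1"
          by simp
        have "(\<integral>\<^sup>+\<xi>. h (\<omega>, \<xi>) \<partial>T1)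
          = (\<integral>\<^sup>+\<xi>. ennreal (exp (s * A (Suc k) \<omega>)) * ennreal (exp (s * (radius (step m \<gamma> B (x k \<omega>) \<xi>))\<^sup>2)) \<partial>T1)"
          using True by (simp add: h_def ennreal_mult[symmetric] exp_add[symmetric] algebra_simps)
        also have "\<dots> = ennreal (exp (s * A (Suc k) \<omega>)) *
            (\<integral>\<^sup>+\<xi>. ennreal (exp (s * (radius (step m \<gamma> B (x k \<omega>) \<xi>))\<^sup>2)) \<partial>T1)"
          by (rule nn_integral_cmult) measurable
        also have "\<dots> \<le> ennreal (exp (s * A (Suc k) \<omega>)) *
            ennreal (exp (s * ((radius (x k \<omega>))\<^sup>2 - \<gamma> * gap (x k \<omega>) + \<gamma> * e / 2)))"
          using step_mgf[OF R e \<theta> m \<gamma> \<gamma>1 \<gamma>2 batch x_Rn[OF \<omega>] ok(2)]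
          unfolding s_def B_def T1_def by (rule mult_left_mono) simp
        also have "\<dots> = ennreal (exp (s * (\<gamma> * e / 2))) * ennreal (H k \<omega>)"
          using ok(1) by (simp add: H_def A_def ennreal_mult[symmetric] exp_add[symmetric] algebra_simps)
        finally show ?thesis .
      next
        case False
        have "(\<integral>\<^sup>+\<xi>. h (\<omega>, \<xi>) \<partial>T1) = ennreal (exp (s * (4 * R\<^sup>2)))"
          using False by (simp add: h_def T1.emeasure_space_1)
        also have "exp (s * (4 * R\<^sup>2)) \<le> H k \<omega>"
        proof (cases "ok k \<omega>")
          case True
          then have "\<not> radius (x k \<omega>) \<le> 2 * R"
            using False by (auto simp: ok_def less_Suc_eq)
          then have "(2 * R)\<^sup>2 \<le> (radius (x k \<omega>))\<^sup>2"
            using R by (intro power_mono) auto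
          then have "s * (4 * R\<^sup>2) \<le> s * ((radius (x k \<omega>))\<^sup>2 + A k \<omega>)"
            using s A_nonneg[OF \<omega>, of k] by (intro mult_left_mono) (auto simp: power_mult_distrib)
          then show ?thesis using True by (simp add: H_def)
        qed (simp add: H_def)
        also have "H k \<omega> \<le> exp (s * (\<gamma> * e / 2)) * H k \<omega>"
          using s \<gamma> e by (simp add: H_def)
        finally show ?thesis by (simp add: ennreal_mult[symmetric] H_def ennreal_leI)
      qed
    qed
    also have "\<dots> = ennreal (exp (s * (\<gamma> * e / 2))) * (\<integral>\<^sup>+\<omega>. ennreal (H k \<omega>) \<partial>T)"
      by (rule nn_integral_cmult) measurable
    also have "\<dots> \<le> ennreal (exp (s * (\<gamma> * e / 2))) * ennreal (exp (s * (R\<^sup>2 + real k * (\<gamma> * e / 2))))"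
      by (intro mult_left_mono Suc) simp
    also have "\<dots> = ennreal (exp (s * (R\<^sup>2 + real (Suc k) * (\<gamma> * e / 2))))"
      by (simp add: ennreal_mult[symmetric] exp_add[symmetric] algebra_simps)
    finally show ?case .
  qed
  define bad where "bad = {\<omega> \<in> space T. e < gap (clipped_SGD n G N m \<gamma> B x0 (\<lambda>k j. \<omega> (k, j)))}"
  have bad_H: "exp (s * (3 * R\<^sup>2)) \<le> H N \<omega>" if "\<omega> \<in> bad" for \<omega>
  proof (cases "ok N \<omega>")
    case True
    have \<omega>: "\<omega> \<in> space T" using that by (simp add: bad_def)
    have "real N * e \<le> real N * gap (\<lambda>i. (\<Sum>k<N. x k \<omega> i) / real N)"
      using that by (intro mult_left_mono) (auto simp: bad_def clipped_SGD_def x_def)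
    also have "\<dots> \<le> (\<Sum>k<N. gap (x k \<omega>))"
      using x_Rn[OF \<omega>] N by (intro gap_average_le) auto
    finally have "\<gamma> * (real N * e) \<le> A N \<omega>"
      using \<gamma> unfolding A_def by (intro mult_left_mono) auto
    then have "3 * R\<^sup>2 \<le> A N \<omega>" using \<gamma>N by (simp add: mult_ac)
    then have "3 * R\<^sup>2 \<le> (radius (x N \<omega>))\<^sup>2 + A N \<omega>"
      using zero_le_power2[of "radius (x N \<omega>)"] by linarith
    then have "s * (3 * R\<^sup>2) \<le> s * ((radius (x N \<omega>))\<^sup>2 + A N \<omega>)"
      using s by (intro mult_left_mono) auto
    then show ?thesis using True by (simp add: H_def)
  next
    case False
    then show ?thesis using s by (simp add: H_def)
  qed
  have "emeasure T bad \<le> emeasure T {\<omega> \<in> space T. 1 \<le> ennreal (exp (- (s * (3 * R\<^sup>2)))) * ennreal (H N \<omega>)}"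
  proof (rule emeasure_mono)
    show "bad \<subseteq> {\<omega> \<in> space T. 1 \<le> ennreal (exp (- (s * (3 * R\<^sup>2)))) * ennreal (H N \<omega>)}"
    proof
      fix \<omega> assume \<omega>: "\<omega> \<in> bad"
      have "exp (- (s * (3 * R\<^sup>2))) * exp (s * (3 * R\<^sup>2)) \<le> exp (- (s * (3 * R\<^sup>2))) * H N \<omega>"
        using bad_H[OF \<omega>] by (intro mult_left_mono) auto
      then have "1 \<le> exp (- (s * (3 * R\<^sup>2))) * H N \<omega>"
        by (simp add: exp_add[symmetric])
      then have "ennreal 1 \<le> ennreal (exp (- (s * (3 * R\<^sup>2))) * H N \<omega>)"
        by (rule ennreal_leI)
      moreover have "0 \<le> H N \<omega>" by (simp add: H_def)
      ultimately show "\<omega> \<in> {\<omega> \<in> space T. 1 \<le> ennreal (exp (- (s * (3 * R\<^sup>2)))) * ennreal (H N \<omega>)}"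
        using \<omega> by (simp add: bad_def ennreal_mult)
    qed
  qed measurable
  also have "\<dots> \<le> ennreal (exp (- (s * (3 * R\<^sup>2)))) * (\<integral>\<^sup>+\<omega>. ennreal (H N \<omega>) * indicator (space T) \<omega> \<partial>T)"
    using nn_integral_Markov_inequality[of "\<lambda>\<omega>. ennreal (H N \<omega>)" "space T" T "ennreal (exp (- (s * (3 * R\<^sup>2))))"]
    by simp
  also have "(\<integral>\<^sup>+\<omega>. ennreal (H N \<omega>) * indicator (space T) \<omega> \<partial>T) = (\<integral>\<^sup>+\<omega>. ennreal (H N \<omega>) \<partial>T)"
    by (intro nn_integral_cong) simp
  also have "ennreal (exp (- (s * (3 * R\<^sup>2)))) * (\<integral>\<^sup>+\<omega>. ennreal (H N \<omega>) \<partial>T)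
      \<le> ennreal (exp (- (s * (3 * R\<^sup>2)))) * ennreal (exp (s * (R\<^sup>2 + real N * (\<gamma> * e / 2))))"
    by (intro mult_left_mono H_bound) simp
  also have "\<dots> = ennreal (exp (- \<theta>))"
  proof -
    have "real N * (\<gamma> * e / 2) = 3 / 2 * R\<^sup>2" using \<gamma>N by (simp add: mult_ac)
    then have "- (s * (3 * R\<^sup>2)) + s * (R\<^sup>2 + real N * (\<gamma> * e / 2)) = - (s * R\<^sup>2) / 2"
      by (simp add: algebra_simps)
    also have "\<dots> = - \<theta>" by (simp add: sR)
    finally show ?thesis by (simp add: ennreal_mult[symmetric] exp_add[symmetric])
  qed
  finally show ?thesis by (simp add: T_def bad_def B_def)
qed

end

section \<open>Parameters of a run\<close>

text \<open>
  A run starts within distance \<open>R\<close> of the minimizer and aims at the accuracy \<open>e\<close>. Its cost depends on the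
  ratio of the largest gap that the smoothness allows at distance \<open>R\<close> to \<open>e\<close>, a dimensionless quantity.
\<close>

definition run_ratio :: "real \<Rightarrow> real \<Rightarrow> real \<Rightarrow> real \<Rightarrow> real" where
  "run_ratio \<nu> M R e = M * R powr (1 + \<nu>) / e"

text \<open>
  The first term of the maximum makes the stepsize small compared with the inverse curvature at accuracy
  \<open>e\<close>, the second one makes the clipping level at least twice the norm of the gradient. Only the
  latter depends on the confidence parameter \<open>\<theta>\<close>.
\<close>

definition run_length :: "real \<Rightarrow> real \<Rightarrow> real \<Rightarrow> real \<Rightarrow> real \<Rightarrow> nat" where
  "run_length \<nu> M \<theta> R e =
     nat \<lceil>max (12 * run_ratio \<nu> M R e powr (2 / (1 + \<nu>))) (240 * run_ratio \<nu> M R e * \<theta>)\<rceil>"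

definition run_stepsize :: "real \<Rightarrow> real \<Rightarrow> real \<Rightarrow> real \<Rightarrow> real \<Rightarrow> real" where
  "run_stepsize \<nu> M \<theta> R e = 3 * R\<^sup>2 / (real (run_length \<nu> M \<theta> R e) * e)"

definition run_batch :: "real \<Rightarrow> real \<Rightarrow> real \<Rightarrow> real \<Rightarrow> real \<Rightarrow> real \<Rightarrow> nat" where
  "run_batch \<nu> M \<sigma> \<theta> R e = nat \<lceil>560 * \<theta> * run_stepsize \<nu> M \<theta> R e * \<sigma>\<^sup>2 / e\<rceil> + 1"

definition run_clip :: "real \<Rightarrow> real \<Rightarrow> real" where
  "run_clip \<theta> R = R / (20 * \<theta>)"

lemma
  fixes \<nu> M \<sigma> \<theta> R e :: real
  assumes M: "M > 0" and R: "R > 0" and e: "e > 0" and \<theta>: "\<theta> \<ge> 1"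
  defines "a \<equiv> run_ratio \<nu> M R e"
  shows run_length_ge: "12 * a powr (2 / (1 + \<nu>)) \<le> real (run_length \<nu> M \<theta> R e)"
      "240 * a * \<theta> \<le> real (run_length \<nu> M \<theta> R e)"
    and run_length_le: "real (run_length \<nu> M \<theta> R e) \<le> 12 * a powr (2 / (1 + \<nu>)) + 240 * a * \<theta> + 1"
    and run_length_pos: "1 \<le> run_length \<nu> M \<theta> R e"
    and run_stepsize_pos: "0 < run_stepsize \<nu> M \<theta> R e"
    and run_stepsize_eq: "real (run_length \<nu> M \<theta> R e) * run_stepsize \<nu> M \<theta> R e * e = 3 * R\<^sup>2"
    and run_batch_ge: "560 * \<theta> * run_stepsize \<nu> M \<theta> R e * \<sigma>\<^sup>2 / e \<le> real (run_batch \<nu> M \<sigma> \<theta> R e)"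
    and run_batch_pos: "1 \<le> run_batch \<nu> M \<sigma> \<theta> R e"
    and run_clip_pos: "0 < run_clip \<theta> R"
    and run_oracle_calls_le: "real (run_length \<nu> M \<theta> R e * run_batch \<nu> M \<sigma> \<theta> R e)
      \<le> 2 * real (run_length \<nu> M \<theta> R e) + 1680 * \<theta> * \<sigma>\<^sup>2 * R\<^sup>2 / e\<^sup>2"
proof -
  define b where "b = max (12 * a powr (2 / (1 + \<nu>))) (240 * a * \<theta>)"
  have a: "0 < a" using M R e by (simp add: a_def run_ratio_def)
  define N where "N = run_length \<nu> M \<theta> R e"
  have b: "0 < b" using a \<theta> by (simp add: b_def less_max_iff_disj)
  have N: "N = nat \<lceil>b\<rceil>" by (simp add: N_def run_length_def b_def a_def)
  have Nb: "b \<le> real N" "real N \<le> b + 1" using b unfolding N by linarith+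
  show "12 * a powr (2 / (1 + \<nu>)) \<le> real (run_length \<nu> M \<theta> R e)"
    "240 * a * \<theta> \<le> real (run_length \<nu> M \<theta> R e)"
    using Nb by (auto simp: b_def N_def)
  have "b \<le> 12 * a powr (2 / (1 + \<nu>)) + 240 * a * \<theta>" using a \<theta> by (auto simp: b_def max_def)
  then show "real (run_length \<nu> M \<theta> R e) \<le> 12 * a powr (2 / (1 + \<nu>)) + 240 * a * \<theta> + 1"
    using Nb by (simp add: N_def)
  have N1: "1 \<le> N" using b Nb by linarith
  then show "1 \<le> run_length \<nu> M \<theta> R e" by (simp add: N_def)
  define \<gamma> where "\<gamma> = run_stepsize \<nu> M \<theta> R e"
  have \<gamma>_eq: "\<gamma> = 3 * R\<^sup>2 / (real N * e)" by (simp add: \<gamma>_def run_stepsize_def N_def)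
  have \<gamma>: "0 < \<gamma>" using R e N1 by (simp add: \<gamma>_eq)
  then show "0 < run_stepsize \<nu> M \<theta> R e" by (simp add: \<gamma>_def)
  have N\<gamma>: "real N * \<gamma> * e = 3 * R\<^sup>2" using N1 e by (simp add: \<gamma>_eq)
  then show "real (run_length \<nu> M \<theta> R e) * run_stepsize \<nu> M \<theta> R e * e = 3 * R\<^sup>2"
    by (simp add: N_def \<gamma>_def)
  define c where "c = 560 * \<theta> * \<gamma> * \<sigma>\<^sup>2 / e"
  define m where "m = run_batch \<nu> M \<sigma> \<theta> R e"
  have m: "m = nat \<lceil>c\<rceil> + 1" by (simp add: m_def run_batch_def c_def \<gamma>_def)
  have c: "0 \<le> c" using \<theta> \<gamma> e by (simp add: c_def)
  have mc: "c \<le> real m" "real m \<le> c + 2" "1 \<le> m" using c unfolding m by linarith+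
  show "560 * \<theta> * run_stepsize \<nu> M \<theta> R e * \<sigma>\<^sup>2 / e \<le> real (run_batch \<nu> M \<sigma> \<theta> R e)"
    using mc(1) by (simp add: c_def m_def \<gamma>_def)
  show "1 \<le> run_batch \<nu> M \<sigma> \<theta> R e" using mc(3) by (simp add: m_def)
  show "0 < run_clip \<theta> R" using R \<theta> by (simp add: run_clip_def)
  have "real (N * m) \<le> real N * (c + 2)"
    using mc(2) by (simp add: mult_left_mono)
  also have "\<dots> = 2 * real N + 560 * \<theta> * \<sigma>\<^sup>2 * (real N * \<gamma> * e) / e\<^sup>2"
    using e by (simp add: c_def field_simps power2_eq_square)
  finally show "real (run_length \<nu> M \<theta> R e * run_batch \<nu> M \<sigma> \<theta> R e)
      \<le> 2 * real (run_length \<nu> M \<theta> R e) + 1680 * \<theta> * \<sigma>\<^sup>2 * R\<^sup>2 / e\<^sup>2"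
    unfolding N\<gamma> by (simp add: N_def m_def)
qed

section \<open>Restarts\<close>

lemma R_clipped_SGD_cong:
  assumes "\<And>s k j. s \<le> t \<Longrightarrow> \<omega> (s, k, j) = \<omega>' (s, k, j)"
  shows "R_clipped_SGD n G N m \<gamma> B x0 \<omega> t = R_clipped_SGD n G N m \<gamma> B x0 \<omega>' t"
  using assms by (induction t) auto

context stochastic_problem
begin

lemma run_stepsize_admissible:
  assumes R: "R > 0" and e: "e > 0" and \<theta>: "\<theta> \<ge> 1"
  shows "run_stepsize \<nu> M \<theta> R e * curvature e \<le> 1 / 4"
    and "80 * run_stepsize \<nu> M \<theta> R e * M * R powr \<nu> * \<theta> \<le> R"
proof -
  define a where "a = run_ratio \<nu> M R e"
  define N where "N = run_length \<nu> M \<theta> R e"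
  define \<gamma> where "\<gamma> = run_stepsize \<nu> M \<theta> R e"
  note N_ge = run_length_ge[OF M R e \<theta>, of \<nu>, folded a_def N_def]
  note N_pos = run_length_pos[OF M R e \<theta>, of \<nu>, folded N_def]
  note \<gamma>_pos = run_stepsize_pos[OF M R e \<theta>, of \<nu>, folded \<gamma>_def]
  note N\<gamma> = run_stepsize_eq[OF M R e \<theta>, of \<nu>, folded N_def \<gamma>_def]
  have KR: "R\<^sup>2 * curvature e = e * a powr (2 / (1 + \<nu>))"
  proof -
    have "a powr (2 / (1 + \<nu>)) = M powr (2 / (1 + \<nu>)) * R powr ((1 + \<nu>) * (2 / (1 + \<nu>))) / e powr (2 / (1 + \<nu>))"
      using M R e by (simp add: a_def run_ratio_def powr_mult powr_divide powr_powr)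
    also have "(1 + \<nu>) * (2 / (1 + \<nu>)) = 2" using \<nu> by (simp add: field_simps)
    also have "R powr 2 = R\<^sup>2" using R by simp
    also have "2 / (1 + \<nu>) = (1 - \<nu>) / (1 + \<nu>) + 1" using \<nu> by (simp add: field_simps)
    then have "e powr (2 / (1 + \<nu>)) = e powr ((1 - \<nu>) / (1 + \<nu>)) * e"
      using e by (simp add: powr_add)
    finally show ?thesis using e by (simp add: curvature_def powr_divide)
  qed
  have "4 * (\<gamma> * curvature e) * (real N * e) = 4 * curvature e * (real N * \<gamma> * e)"
    by simp
  also have "\<dots> = 12 * (R\<^sup>2 * curvature e)"
    unfolding N\<gamma> by simp
  also have "\<dots> = e * (12 * a powr (2 / (1 + \<nu>)))"
    unfolding KR by simp
  also have "\<dots> \<le> 1 * (real N * e)"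
    using N_ge(1) e by (simp add: mult.commute mult_left_mono)
  finally have "4 * (\<gamma> * curvature e) \<le> 1"
    using N_pos e by (subst (asm) mult_le_cancel_right) auto
  then show "run_stepsize \<nu> M \<theta> R e * curvature e \<le> 1 / 4" by (simp add: \<gamma>_def)
  have "a * e = M * R powr \<nu> * R"
    using R e by (simp add: a_def run_ratio_def powr_add)
  then have "80 * \<gamma> * M * R powr \<nu> * \<theta> * R = 80 * \<gamma> * \<theta> * (a * e)" by simp
  also have "\<dots> = \<gamma> * e * (240 * a * \<theta>) / 3" by simp
  also have "\<dots> \<le> \<gamma> * e * real N / 3"
    using N_ge(2) \<gamma>_pos e by (intro divide_right_mono mult_left_mono) auto
  also have "\<dots> = R * R" using N\<gamma> by (simp add: mult_ac power2_eq_square)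
  finally have "80 * \<gamma> * M * R powr \<nu> * \<theta> \<le> R" using R by (subst (asm) mult_le_cancel_right) auto
  then show "80 * run_stepsize \<nu> M \<theta> R e * M * R powr \<nu> * \<theta> \<le> R" by (simp add: \<gamma>_def)
qed

text \<open>
  Run \<open>t\<close> starts within distance \<open>R (t - 1)\<close> and has the target \<open>e t\<close>. Its samples are independent of its
  starting point, so on the event that the starting point is as close as planned it fails with
  probability at most \<open>exp (- \<theta>)\<close>; if it succeeds, strong convexity bounds the distance at which the next
  run starts.
\<close>

lemma R_clipped_SGD_failure:
  fixes R e :: "nat \<Rightarrow> real" and x0 \<tau> \<theta>
  defines "N \<equiv> \<lambda>t. run_length \<nu> M \<theta> (R (t - 1)) (e t)"
    and "m \<equiv> \<lambda>t. run_batch \<nu> M \<sigma> \<theta> (R (t - 1)) (e t)"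
    and "\<gamma> \<equiv> \<lambda>t. run_stepsize \<nu> M \<theta> (R (t - 1)) (e t)"
    and "B \<equiv> \<lambda>t. run_clip \<theta> (R (t - 1))"
  assumes \<theta>: "\<theta> \<ge> 1" and \<tau>: "\<tau> \<ge> 1"
    and R: "\<And>t. t < \<tau> \<Longrightarrow> 0 < R t" "\<And>t. t < \<tau> \<Longrightarrow> R t \<le> R0"
    and e: "\<And>t. t < \<tau> \<Longrightarrow> 0 < e (Suc t)"
    and next_radius: "\<And>t. Suc t < \<tau> \<Longrightarrow> 2 * e (Suc t) \<le> \<mu> * (R (Suc t))\<^sup>2"
    and x0: "x0 \<in> Rn n" "radius x0 \<le> R 0"
  shows "emeasure (samples P) {\<omega> \<in> space (samples P). e \<tau> < gap (R_clipped_SGD n G N m \<gamma> B x0 \<omega> \<tau>)}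
    \<le> ennreal (real \<tau> * exp (- \<theta>))"
proof -
  define S where "S = samples P"
  define T where "T = PiM (UNIV :: (nat \<times> nat) set) (\<lambda>_. P)"
  interpret S: prob_space S unfolding S_def samples_def by (rule prob_space_PiM) (rule prob_P)
  interpret T: prob_space T unfolding T_def by (rule prob_space_PiM) (rule prob_P)
  define x where "x t \<omega> = R_clipped_SGD n G N m \<gamma> B x0 \<omega> t" for t \<omega>
  have x_meas: "x t \<in> S \<rightarrow>\<^sub>M borel_Rn n" for t
    unfolding x_def S_def by (rule measurable_R_clipped_SGD[OF G_measurable x0(1)])
  have x_Rn: "x t \<omega> \<in> Rn n" if "\<omega> \<in> space S" for t \<omega>
    using measurable_space[OF x_meas that] by simp
  have gap_borel: "gap \<in> borel_measurable (borel_Rn n)"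
    using f_measurable by simp
  have radius_borel: "radius \<in> borel_measurable (borel_Rn n)"
    unfolding L2_set_def vdiff_def by measurable
  have [measurable]: "(\<lambda>\<omega>. gap (x t \<omega>)) \<in> borel_measurable S"
    "(\<lambda>\<omega>. radius (x t \<omega>)) \<in> borel_measurable S" for t
    using measurable_compose[OF x_meas gap_borel] measurable_compose[OF x_meas radius_borel] by simp_all
  have step: "emeasure S {\<omega> \<in> space S. e (Suc t) < gap (x (Suc t) \<omega>)} \<le> ennreal (real (Suc t) * exp (- \<theta>))"
    if t: "t < \<tau>" and IH: "emeasure S {\<omega> \<in> space S. R t < radius (x t \<omega>)} \<le> ennreal (real t * exp (- \<theta>))" for t
  proof -
    define run where "run y \<xi> = clipped_SGD n G (N (Suc t)) (m (Suc t)) (\<gamma> (Suc t)) (B (Suc t)) y (\<lambda>k j. \<xi> (k, j))"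
      for y and \<xi> :: "nat \<times> nat \<Rightarrow> 'b"
    have run_meas: "(\<lambda>z. run (x t (fst z)) (snd z)) \<in> S \<Otimes>\<^sub>M T \<rightarrow>\<^sub>M borel_Rn n"
      unfolding run_def
    proof (rule measurable_clipped_SGD[OF G_measurable])
      show "(\<lambda>z. x t (fst z)) \<in> S \<Otimes>\<^sub>M T \<rightarrow>\<^sub>M borel_Rn n"
        by (rule measurable_compose[OF measurable_fst x_meas])
      show "(\<lambda>z. snd z (k, j)) \<in> S \<Otimes>\<^sub>M T \<rightarrow>\<^sub>M P" for k j
        unfolding T_def by measurable
    qed
    have [measurable]: "(\<lambda>z. gap (run (x t (fst z)) (snd z))) \<in> borel_measurable (S \<Otimes>\<^sub>M T)"
      using measurable_compose[OF run_meas gap_borel] .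
    define h :: "_ \<Rightarrow> ennreal" where "h = (\<lambda>(\<omega>, \<xi>).
      if radius (x t \<omega>) \<le> R t \<and> e (Suc t) < gap (run (x t \<omega>) \<xi>) then 1 else 0)"
    have h_meas: "h \<in> borel_measurable (S \<Otimes>\<^sub>M T)"
      unfolding h_def split_beta by measurable
    have dep: "h (\<omega>, \<xi>) = h (\<omega>', \<xi>)" if "\<And>i. i \<in> {..t} \<times> UNIV \<Longrightarrow> \<omega> i = \<omega>' i" for \<omega> \<omega>' \<xi>
    proof -
      have "x t \<omega> = x t \<omega>'"
        unfolding x_def using that by (intro R_clipped_SGD_cong) auto
      then show ?thesis by (simp add: h_def)
    qed
    have fresh: "(\<integral>\<^sup>+\<omega>. h (\<omega>, \<lambda>j. \<omega> (Suc t, j)) \<partial>S) = (\<integral>\<^sup>+\<omega>. (\<integral>\<^sup>+\<xi>. h (\<omega>, \<xi>) \<partial>T) \<partial>S)"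
      unfolding S_def T_def samples_def
    proof (rule nn_integral_PiM_fresh_block[OF prob_P])
      show "inj (Pair (Suc t) :: nat \<times> nat \<Rightarrow> nat \<times> nat \<times> nat)" by (simp add: inj_on_def)
      show "range (Pair (Suc t)) \<inter> ({..t} \<times> (UNIV :: (nat \<times> nat) set)) = {}" by auto
      show "h \<in> borel_measurable (PiM UNIV (\<lambda>_. P) \<Otimes>\<^sub>M PiM UNIV (\<lambda>_. P))"
        using h_meas unfolding S_def T_def samples_def .
    qed (rule dep)
    define late where "late = {\<omega> \<in> space S. radius (x t \<omega>) \<le> R t \<and> e (Suc t) < gap (x (Suc t) \<omega>)}"
    have late_meas[measurable]: "late \<in> sets S" unfolding late_def by measurable
    have "emeasure S late = (\<integral>\<^sup>+\<omega>. indicator late \<omega> \<partial>S)"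
      by simp
    also have "\<dots> = (\<integral>\<^sup>+\<omega>. h (\<omega>, \<lambda>j. \<omega> (Suc t, j)) \<partial>S)"
      by (rule nn_integral_cong) (auto simp: h_def late_def run_def x_def indicator_def)
    also have "\<dots> \<le> (\<integral>\<^sup>+\<omega>. ennreal (exp (- \<theta>)) \<partial>S)"
      unfolding fresh
    proof (rule nn_integral_mono)
      fix \<omega> assume \<omega>: "\<omega> \<in> space S"
      show "(\<integral>\<^sup>+\<xi>. h (\<omega>, \<xi>) \<partial>T) \<le> ennreal (exp (- \<theta>))"
      proof (cases "radius (x t \<omega>) \<le> R t")
        case True
        have "Pair \<omega> \<in> T \<rightarrow>\<^sub>M S \<Otimes>\<^sub>M T" using \<omega> by simp
        from measurable_compose[OF this measurable_compose[OF run_meas gap_borel]]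
        have [measurable]: "(\<lambda>\<xi>. gap (run (x t \<omega>) \<xi>)) \<in> borel_measurable T" by simp
        have "(\<integral>\<^sup>+\<xi>. h (\<omega>, \<xi>) \<partial>T) = (\<integral>\<^sup>+\<xi>. indicator {\<xi> \<in> space T. e (Suc t) < gap (run (x t \<omega>) \<xi>)} \<xi> \<partial>T)"
          using True by (intro nn_integral_cong) (auto simp: h_def indicator_def)
        also have "\<dots> = emeasure T {\<xi> \<in> space T. e (Suc t) < gap (run (x t \<omega>) \<xi>)}"
          by (rule nn_integral_indicator) measurable
        also have "\<dots> \<le> ennreal (exp (- \<theta>))"
          using clipped_SGD_failure[OF R(1)[OF t] R(2)[OF t] e[OF t] \<theta>
            run_length_pos[OF M R(1)[OF t] e[OF t] \<theta>, of \<nu>]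
            run_batch_pos[OF M R(1)[OF t] e[OF t] \<theta>, of \<nu> \<sigma>]
            run_stepsize_pos[OF M R(1)[OF t] e[OF t] \<theta>, of \<nu>]
            run_stepsize_eq[OF M R(1)[OF t] e[OF t] \<theta>, of \<nu>]
            run_stepsize_admissible[OF R(1)[OF t] e[OF t] \<theta>]
            run_batch_ge[OF M R(1)[OF t] e[OF t] \<theta>, of \<nu> \<sigma>] x_Rn[OF \<omega>] True]
          by (simp add: T_def run_def N_def m_def \<gamma>_def B_def run_clip_def)
        finally show ?thesis .
      qed (simp add: h_def)
    qed
    finally have late: "emeasure S late \<le> ennreal (exp (- \<theta>))"
      by (simp add: S.emeasure_space_1)
    have "emeasure S {\<omega> \<in> space S. e (Suc t) < gap (x (Suc t) \<omega>)}
        \<le> emeasure S ({\<omega> \<in> space S. R t < radius (x t \<omega>)} \<union> late)"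
      by (rule emeasure_mono) (auto simp: late_def)
    also have "\<dots> \<le> emeasure S {\<omega> \<in> space S. R t < radius (x t \<omega>)} + emeasure S late"
      by (rule emeasure_subadditive) measurable
    also have "\<dots> \<le> ennreal (real t * exp (- \<theta>)) + ennreal (exp (- \<theta>))"
      by (rule add_mono[OF IH late])
    also have "\<dots> = ennreal (real (Suc t) * exp (- \<theta>))"
      by (simp add: ennreal_plus[symmetric] distrib_right del: ennreal_plus)
    finally show ?thesis .
  qed
  have start: "emeasure S {\<omega> \<in> space S. R t < radius (x t \<omega>)} \<le> ennreal (real t * exp (- \<theta>))" if "t < \<tau>" for t
    using that
  proof (induction t)
    case 0
    have empty: "{\<omega> \<in> space S. R 0 < radius (x 0 \<omega>)} = {}" using x0(2) by (auto simp: x_def)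
    show ?case unfolding empty by simp
  next
    case (Suc t)
    have "{\<omega> \<in> space S. R (Suc t) < radius (x (Suc t) \<omega>)} \<subseteq> {\<omega> \<in> space S. e (Suc t) < gap (x (Suc t) \<omega>)}"
    proof safe
      fix \<omega> assume \<omega>: "\<omega> \<in> space S" and less: "R (Suc t) < radius (x (Suc t) \<omega>)"
      have "\<mu> * (R (Suc t))\<^sup>2 < \<mu> * (radius (x (Suc t) \<omega>))\<^sup>2"
        using less \<mu> R(1)[OF Suc.prems] by (intro mult_strict_left_mono power_strict_mono) auto
      then show "e (Suc t) < gap (x (Suc t) \<omega>)"
        using next_radius[OF Suc.prems] gap_ge_radius[OF x_Rn[OF \<omega>], of "Suc t"] by simp
    qed
    then have "emeasure S {\<omega> \<in> space S. R (Suc t) < radius (x (Suc t) \<omega>)}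
        \<le> emeasure S {\<omega> \<in> space S. e (Suc t) < gap (x (Suc t) \<omega>)}"
      by (rule emeasure_mono) measurable
    also have "\<dots> \<le> ennreal (real (Suc t) * exp (- \<theta>))"
      using Suc by (intro step) auto
    finally show ?case .
  qed
  obtain t where t: "\<tau> = Suc t" using \<tau> by (cases \<tau>) auto
  show ?thesis using step[of t] start[of t] unfolding t S_def x_def by simp
qed

lemma R_clipped_SGD_success:
  fixes R e :: "nat \<Rightarrow> real" and x0 \<tau> \<theta>
  defines "N \<equiv> \<lambda>t. run_length \<nu> M \<theta> (R (t - 1)) (e t)"
    and "m \<equiv> \<lambda>t. run_batch \<nu> M \<sigma> \<theta> (R (t - 1)) (e t)"
    and "\<gamma> \<equiv> \<lambda>t. run_stepsize \<nu> M \<theta> (R (t - 1)) (e t)"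
    and "B \<equiv> \<lambda>t. run_clip \<theta> (R (t - 1))"
  assumes \<theta>: "\<theta> \<ge> 1" and \<tau>: "\<tau> \<ge> 1"
    and R: "\<And>t. t < \<tau> \<Longrightarrow> 0 < R t" "\<And>t. t < \<tau> \<Longrightarrow> R t \<le> R0"
    and e: "\<And>t. t < \<tau> \<Longrightarrow> 0 < e (Suc t)"
    and next_radius: "\<And>t. Suc t < \<tau> \<Longrightarrow> 2 * e (Suc t) \<le> \<mu> * (R (Suc t))\<^sup>2"
    and x0: "x0 \<in> Rn n" "radius x0 \<le> R 0"
    and \<epsilon>: "e \<tau> \<le> \<epsilon>" and \<beta>: "real \<tau> * exp (- \<theta>) \<le> \<beta>"
  shows "1 - \<beta> \<le> measure (samples P)
    {\<omega> \<in> space (samples P). gap (R_clipped_SGD n G N m \<gamma> B x0 \<omega> \<tau>) \<le> \<epsilon>}"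
proof -
  interpret S: prob_space "samples P" unfolding samples_def by (rule prob_space_PiM) (rule prob_P)
  define x where "x \<omega> = R_clipped_SGD n G N m \<gamma> B x0 \<omega> \<tau>" for \<omega>
  have "(\<lambda>\<omega>. f (x \<omega>)) \<in> borel_measurable (samples P)"
    unfolding x_def using measurable_compose[OF measurable_R_clipped_SGD[OF G_measurable x0(1)] f_measurable] .
  then have [measurable]: "(\<lambda>\<omega>. gap (x \<omega>)) \<in> borel_measurable (samples P)" by simp
  have "emeasure (samples P) {\<omega> \<in> space (samples P). \<epsilon> < gap (x \<omega>)}
      \<le> emeasure (samples P) {\<omega> \<in> space (samples P). e \<tau> < gap (x \<omega>)}"
    using \<epsilon> by (intro emeasure_mono) auto
  also have "\<dots> \<le> ennreal (real \<tau> * exp (- \<theta>))"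
    unfolding x_def N_def m_def \<gamma>_def B_def
    using R_clipped_SGD_failure[OF \<theta> \<tau> R e next_radius x0] by simp
  also have "\<dots> \<le> ennreal \<beta>" using \<beta> by (rule ennreal_leI)
  finally have "S.prob {\<omega> \<in> space (samples P). \<epsilon> < gap (x \<omega>)} \<le> \<beta>"
    using \<beta> by (simp add: S.emeasure_eq_measure order_trans[OF _ \<beta>])
  moreover have "{\<omega> \<in> space (samples P). gap (x \<omega>) \<le> \<epsilon>}
      = space (samples P) - {\<omega> \<in> space (samples P). \<epsilon> < gap (x \<omega>)}" by auto
  then have "S.prob {\<omega> \<in> space (samples P). gap (x \<omega>) \<le> \<epsilon>}
      = 1 - S.prob {\<omega> \<in> space (samples P). \<epsilon> < gap (x \<omega>)}"
    by (simp only:) (rule S.prob_compl, measurable)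
  ultimately show ?thesis by (simp add: x_def)
qed

text \<open>
  Strong convexity bounds the growth of the gradient from below and smoothness bounds it from above, at
  distance \<open>R0\<close> from the minimizer by \<open>\<mu> * R0\<close> and \<open>M * R0 powr \<nu>\<close>. In dimension zero there is no point at
  that distance and no such restriction.
\<close>

lemma D1_ge_1:
  assumes "n \<noteq> 0"
  shows "1 \<le> D1 \<nu> M \<mu> R0"
proof -
  define y where "y = (\<lambda>i. xs i + (if i = 0 then R0 else 0))"
  have y: "y \<in> Rn n" using xs_Rn assms by (simp add: y_def Rn_def)
  have "(radius y)\<^sup>2 = (\<Sum>i<n. if i = 0 then R0\<^sup>2 else 0)"
    by (simp add: L2_set_def vdiff_def y_def sum_nonneg if_distrib[of "\<lambda>x. x ^ 2"] cong: if_cong)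
  also have "\<dots> = R0\<^sup>2"
    using assms by (simp add: sum.delta)
  finally have ry: "radius y = R0" using R0 by (simp add: power2_eq_iff_nonneg)
  have "ip n (g y) (vdiff xs y) = - ip n (g y) (vdiff y xs)"
    by (simp add: ip_def vdiff_def sum_negf[symmetric] algebra_simps)
  then have "\<mu> * R0\<^sup>2 \<le> ip n (g y) (vdiff y xs)"
    using subgradient_inequality[OF y xs_Rn] gap_ge_radius[OF y] nrm_vdiff_commute[where n = n and x = xs and y = y] ry by simp
  also have "\<dots> \<le> nrm n (g y) * R0" using ip_le[of n "g y" "vdiff y xs"] ry by simp
  also have "\<dots> \<le> M * R0 powr \<nu> * R0"
    using gradient_le[OF y, of R0] ry R0 by (intro mult_right_mono) auto
  finally have "\<mu> * R0 \<le> M * R0 powr \<nu>" using R0 by (simp add: power2_eq_square)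
  then have "\<mu> * R0 powr (1 - \<nu>) \<le> M"
    using R0 by (simp add: powr_diff pos_divide_le_eq)
  then show ?thesis using \<mu> R0 by (simp add: D1_def)
qed

lemma gap_le_of_radius:
  assumes x: "x \<in> Rn n" "radius x \<le> R0"
  shows "gap x \<le> M * R0 powr (1 + \<nu>)"
proof -
  have "gap x \<le> nrm n (g x) * radius x"
    using gap_le_ip[OF x(1)] ip_le[of n "g x" "vdiff x xs"] by linarith
  also have "\<dots> \<le> (M * R0 powr \<nu>) * R0"
    using gradient_le[OF x] x R0 M by (intro mult_mono) auto
  also have "\<dots> = M * R0 powr (1 + \<nu>)" using R0 by (simp add: powr_add)
  finally show ?thesis .
qed

end

section \<open>Complexity of the restarts\<close>

lemma bounds_ge:
  fixes \<nu> M \<mu> R0 \<epsilon> \<beta> \<sigma> :: real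
  defines "L \<equiv> log_ratio \<mu> R0 \<epsilon>" and "l \<equiv> ln (DD \<nu> M \<mu> R0 \<epsilon> / \<beta>)"
  assumes l: "0 \<le> l"
  shows iteration_bound_ge:
      "D1 \<nu> M \<mu> R0 powr (2 / (1 + \<nu>)) * L \<le> iteration_bound \<nu> M \<mu> R0 \<epsilon> \<beta>"
      "D2 \<nu> M \<mu> \<epsilon> powr (2 / (1 + \<nu>)) \<le> iteration_bound \<nu> M \<mu> R0 \<epsilon> \<beta>"
      "max (D1 \<nu> M \<mu> R0 * L) (D2 \<nu> M \<mu> \<epsilon>) * l \<le> iteration_bound \<nu> M \<mu> R0 \<epsilon> \<beta>"
    and oracle_bound_ge:
      "iteration_bound \<nu> M \<mu> R0 \<epsilon> \<beta> \<le> oracle_bound \<nu> M \<mu> R0 \<sigma> \<epsilon> \<beta>"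
      "\<sigma>\<^sup>2 / (\<mu> * \<epsilon>) * l \<le> oracle_bound \<nu> M \<mu> R0 \<sigma> \<epsilon> \<beta>"
proof -
  define a b c d s where "a = D1 \<nu> M \<mu> R0 powr (2 / (1 + \<nu>)) * L" and "b = D2 \<nu> M \<mu> \<epsilon> powr (2 / (1 + \<nu>))"
    and "c = D1 \<nu> M \<mu> R0 * L" and "d = D2 \<nu> M \<mu> \<epsilon>" and "s = \<sigma>\<^sup>2 / (\<mu> * \<epsilon>)"
  have I: "iteration_bound \<nu> M \<mu> R0 \<epsilon> \<beta> = max a (max b (max c d * l))"
    by (simp add: iteration_bound_def a_def b_def c_def d_def l_def L_def)
  have O: "oracle_bound \<nu> M \<mu> R0 \<sigma> \<epsilon> \<beta> = max a (max b (max c (max d s) * l))"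
    by (simp add: oracle_bound_def a_def b_def c_def d_def l_def L_def s_def)
  have cds: "max c d * l \<le> max c (max d s) * l" "s * l \<le> max c (max d s) * l"
    using l by (auto intro!: mult_right_mono)
  have "a \<le> iteration_bound \<nu> M \<mu> R0 \<epsilon> \<beta>" "b \<le> iteration_bound \<nu> M \<mu> R0 \<epsilon> \<beta>"
    "max c d * l \<le> iteration_bound \<nu> M \<mu> R0 \<epsilon> \<beta>"
    unfolding I by (simp_all only: le_max_iff_disj order_refl simp_thms)
  then show "D1 \<nu> M \<mu> R0 powr (2 / (1 + \<nu>)) * L \<le> iteration_bound \<nu> M \<mu> R0 \<epsilon> \<beta>"
      "D2 \<nu> M \<mu> \<epsilon> powr (2 / (1 + \<nu>)) \<le> iteration_bound \<nu> M \<mu> R0 \<epsilon> \<beta>"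
      "max (D1 \<nu> M \<mu> R0 * L) (D2 \<nu> M \<mu> \<epsilon>) * l \<le> iteration_bound \<nu> M \<mu> R0 \<epsilon> \<beta>"
    unfolding a_def b_def c_def d_def .
  have "iteration_bound \<nu> M \<mu> R0 \<epsilon> \<beta> \<le> oracle_bound \<nu> M \<mu> R0 \<sigma> \<epsilon> \<beta>"
      "s * l \<le> oracle_bound \<nu> M \<mu> R0 \<sigma> \<epsilon> \<beta>"
    unfolding I O using cds by (intro max.mono order_refl, auto simp only: le_max_iff_disj simp_thms)
  then show "iteration_bound \<nu> M \<mu> R0 \<epsilon> \<beta> \<le> oracle_bound \<nu> M \<mu> R0 \<sigma> \<epsilon> \<beta>"
      "\<sigma>\<^sup>2 / (\<mu> * \<epsilon>) * l \<le> oracle_bound \<nu> M \<mu> R0 \<sigma> \<epsilon> \<beta>"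
    unfolding s_def .
qed

text \<open>
  The failure probability \<open>\<beta>\<close> is divided among \<open>\<tau>\<close> runs; the factor \<open>3 > exp 1\<close> makes the confidence parameter
  at least \<open>1\<close>. As \<open>D / \<beta> \<ge> 2\<close>, constant factors and the number of runs are absorbed by the logarithm of
  its cube.
\<close>

lemma confidence_level:
  fixes \<beta> D :: real and \<tau> :: nat
  assumes \<beta>: "0 < \<beta>" "\<beta> < 1" and \<tau>: "1 \<le> \<tau>" "real \<tau> \<le> D" and D: "2 \<le> D"
  shows "1 \<le> ln (3 * real \<tau> / \<beta>)" and "ln (3 * real \<tau> / \<beta>) \<le> 3 * ln (D / \<beta>)" and "0 \<le> ln (D / \<beta>)"
    and "real \<tau> * exp (- ln (3 * real \<tau> / \<beta>)) \<le> \<beta>"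
proof -
  have "3 \<le> 3 * real \<tau> / \<beta>" using \<beta> \<tau> by (simp add: pos_le_divide_eq)
  then have "exp 1 \<le> 3 * real \<tau> / \<beta>" using exp_le by linarith
  then show "1 \<le> ln (3 * real \<tau> / \<beta>)"
    using \<beta> \<tau> by (simp add: ln_ge_iff)
  have D\<beta>: "2 \<le> D / \<beta>" using \<beta> D by (simp add: pos_le_divide_eq)
  then show "0 \<le> ln (D / \<beta>)" by simp
  have "3 \<le> (D / \<beta>)\<^sup>2" using power_mono[OF D\<beta>, of 2] by simp
  then have "3 * (real \<tau> / \<beta>) \<le> (D / \<beta>)\<^sup>2 * (D / \<beta>)"
    using \<beta> \<tau> D\<beta> by (intro mult_mono divide_right_mono) auto
  then have "3 * real \<tau> / \<beta> \<le> (D / \<beta>) ^ 3"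
    by (simp add: power2_eq_square power3_eq_cube)
  then have "ln (3 * real \<tau> / \<beta>) \<le> ln ((D / \<beta>) ^ 3)"
    using \<beta> \<tau> D by simp
  also have "\<dots> = 3 * ln (D / \<beta>)"
    using D\<beta> by (subst ln_realpow) auto
  finally show "ln (3 * real \<tau> / \<beta>) \<le> 3 * ln (D / \<beta>)" .
  have "exp (- ln (3 * real \<tau> / \<beta>)) = \<beta> / (3 * real \<tau>)"
    using \<beta> \<tau> by (simp add: exp_minus)
  then show "real \<tau> * exp (- ln (3 * real \<tau> / \<beta>)) \<le> \<beta>"
    using \<beta> \<tau> by simp
qed

text \<open>
  The squared distance to the minimizer is halved by every run, so the ratio of a run grows by the factor
  \<open>2 powr ((1 - \<nu>) / 2)\<close>. For \<open>\<nu> < 1\<close> the sum is geometric and its last term dominates, with a constant that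
  depends on \<open>\<nu>\<close>; for \<open>\<nu> = 1\<close> all terms are equal and their number enters.
\<close>

lemma restart_sum_le:
  fixes \<nu> p :: real
  assumes \<nu>: "0 \<le> \<nu>" "\<nu> \<le> 1" and p: "p > 0"
  shows "\<exists>c>0. \<forall>D \<rho>. D > 0 \<and> 1 \<le> \<rho> \<longrightarrow>
    (\<Sum>t<nat \<lfloor>log 2 \<rho>\<rfloor> + 1. (D * 2 powr (real t * ((1 - \<nu>) / 2))) powr p)
      \<le> c * max (D powr p * ln \<rho>) ((D * \<rho> powr ((1 - \<nu>) / 2)) powr p)"
proof -
  define \<kappa> where "\<kappa> = (1 - \<nu>) / 2 * p"
  define w where "w = 2 powr \<kappa>"
  have summand: "(D * 2 powr (real t * ((1 - \<nu>) / 2))) powr p = D powr p * w ^ t" if "D > 0" for D t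
    using that by (simp add: powr_mult powr_powr w_def \<kappa>_def powr_power mult_ac)
  have last: "(D * \<rho> powr ((1 - \<nu>) / 2)) powr p = D powr p * \<rho> powr \<kappa>" if "D > 0" "1 \<le> \<rho>" for D \<rho>
    using that by (simp add: powr_mult powr_powr \<kappa>_def)
  show ?thesis
  proof (cases "\<nu> = 1")
    case True
    then have w: "w = 1" "\<kappa> = 0" by (simp_all add: w_def \<kappa>_def)
    show ?thesis
    proof (intro exI[of _ 3] conjI allI impI)
      fix D \<rho> :: real assume D: "D > 0 \<and> 1 \<le> \<rho>"
      have "log 2 \<rho> \<le> 2 * ln \<rho>"
      proof -
        have "ln \<rho> * 1 \<le> ln \<rho> * (2 * ln 2)" using D ln2_ge_two_thirds by (intro mult_left_mono) auto
        then show ?thesis by (simp add: log_def pos_divide_le_eq mult_ac)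
      qed
      moreover have "0 \<le> log 2 \<rho>" using D by simp
      ultimately have "real (nat \<lfloor>log 2 \<rho>\<rfloor> + 1) \<le> 2 * ln \<rho> + 1" by linarith
      also have "\<dots> \<le> 3 * max (ln \<rho>) 1" by linarith
      finally have "D powr p * real (nat \<lfloor>log 2 \<rho>\<rfloor> + 1) \<le> D powr p * (3 * max (ln \<rho>) 1)"
        by (rule mult_left_mono) simp
      also have "\<dots> = 3 * max (D powr p * ln \<rho>) (D powr p)"
        by (simp add: max_mult_distrib_left)
      finally show "(\<Sum>t<nat \<lfloor>log 2 \<rho>\<rfloor> + 1. (D * 2 powr (real t * ((1 - \<nu>) / 2))) powr p)
          \<le> 3 * max (D powr p * ln \<rho>) ((D * \<rho> powr ((1 - \<nu>) / 2)) powr p)"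
        using D by (simp only: summand last w) (simp add: mult.commute)
    qed simp
  next
    case False
    then have \<kappa>: "\<kappa> > 0" using \<nu> p by (simp add: \<kappa>_def)
    then have w: "w > 1" using powr_less_mono[of 0 \<kappa> 2] by (simp add: w_def)
    show ?thesis
    proof (intro exI[of _ "w / (w - 1)"] conjI allI impI)
      fix D \<rho> :: real assume D: "D > 0 \<and> 1 \<le> \<rho>"
      define K where "K = nat \<lfloor>log 2 \<rho>\<rfloor>"
      have K: "real K \<le> log 2 \<rho>" unfolding K_def using D by (simp add: of_nat_nat)
      have "w ^ K = 2 powr (\<kappa> * real K)"
        by (simp add: w_def powr_powr[symmetric] powr_realpow)
      also have "\<dots> \<le> 2 powr (\<kappa> * log 2 \<rho>)"
        using K \<kappa> by (intro powr_mono mult_left_mono) auto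
      also have "\<dots> = \<rho> powr \<kappa>"
        using D by (simp add: mult.commute[of \<kappa>] powr_powr[symmetric])
      finally have wK: "w ^ K \<le> \<rho> powr \<kappa>" .
      have "(\<Sum>t<K + 1. w ^ t) = (w ^ (K + 1) - 1) / (w - 1)"
        using w by (intro geometric_sum) simp
      also have "\<dots> \<le> w ^ (K + 1) / (w - 1)"
        using w by (intro divide_right_mono) auto
      also have "\<dots> = w / (w - 1) * w ^ K" by simp
      also have "\<dots> \<le> w / (w - 1) * \<rho> powr \<kappa>"
        using w wK by (intro mult_left_mono) auto
      finally have "D powr p * (\<Sum>t<K + 1. w ^ t) \<le> D powr p * (w / (w - 1) * \<rho> powr \<kappa>)"
        by (rule mult_left_mono) simp
      also have "\<dots> = w / (w - 1) * (D powr p * \<rho> powr \<kappa>)" by simp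
      also have "\<dots> \<le> w / (w - 1) * max (D powr p * ln \<rho>) (D powr p * \<rho> powr \<kappa>)"
        using w by (intro mult_left_mono) auto
      finally show "(\<Sum>t<nat \<lfloor>log 2 \<rho>\<rfloor> + 1. (D * 2 powr (real t * ((1 - \<nu>) / 2))) powr p)
          \<le> w / (w - 1) * max (D powr p * ln \<rho>) ((D * \<rho> powr ((1 - \<nu>) / 2)) powr p)"
        using D by (simp only: K_def[symmetric] summand last sum_distrib_left)
    qed (use w in simp)
  qed
qed

text \<open>
  The number \<open>D1\<close> belongs to the distance \<open>R0\<close>, and \<open>D2\<close> is the same quantity for a distance whose square is
  \<open>\<epsilon> / \<mu>\<close>.
\<close>

lemma D2_eq_D1:
  assumes "\<mu> > 0" "R0 > 0" "\<epsilon> > 0"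
  shows "D2 \<nu> M \<mu> \<epsilon> = D1 \<nu> M \<mu> R0 * (\<mu> * R0\<^sup>2 / \<epsilon>) powr ((1 - \<nu>) / 2)"
proof -
  have R: "(R0\<^sup>2) powr ((1 - \<nu>) / 2) = R0 powr (1 - \<nu>)"
  proof -
    have "R0\<^sup>2 = R0 powr 2" using assms by simp
    moreover have "2 * ((1 - \<nu>) / 2) = 1 - \<nu>" by simp
    ultimately show ?thesis by (simp only: powr_powr)
  qed
  have \<mu>: "\<mu> powr ((1 + \<nu>) / 2) * \<mu> powr ((1 - \<nu>) / 2) = \<mu>"
    using assms by (simp add: powr_add[symmetric] add_divide_distrib[symmetric])
  have "D1 \<nu> M \<mu> R0 * (\<mu> * R0\<^sup>2 / \<epsilon>) powr ((1 - \<nu>) / 2)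
      = M * \<mu> powr ((1 - \<nu>) / 2) / (\<mu> * \<epsilon> powr ((1 - \<nu>) / 2))"
    using assms by (simp add: D1_def powr_mult powr_divide R)
  also have "\<dots> = M * \<mu> powr ((1 - \<nu>) / 2) / (\<mu> powr ((1 + \<nu>) / 2) * \<mu> powr ((1 - \<nu>) / 2) * \<epsilon> powr ((1 - \<nu>) / 2))"
    by (simp only: \<mu>)
  also have "\<dots> = D2 \<nu> M \<mu> \<epsilon>"
    using assms by (simp add: D2_def)
  finally show ?thesis by simp
qed

lemma run_ratio_eq_D1:
  assumes "\<mu> > 0" "R > 0"
  shows "run_ratio \<nu> M R (\<mu> * R\<^sup>2 / 4) = 4 * D1 \<nu> M \<mu> R"
proof -
  have "R powr (1 + \<nu>) * R powr (1 - \<nu>) = R\<^sup>2"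
    using assms by (simp add: powr_add[symmetric])
  then have "R powr (1 + \<nu>) / R\<^sup>2 = 1 / R powr (1 - \<nu>)"
    using assms by (simp add: field_simps)
  moreover have "run_ratio \<nu> M R (\<mu> * R\<^sup>2 / 4) = 4 * M / \<mu> * (R powr (1 + \<nu>) / R\<^sup>2)"
    by (simp add: run_ratio_def)
  ultimately show ?thesis by (simp add: D1_def)
qed

lemma run_ratio_eq_D2:
  assumes "\<mu> > 0" "R0 > 0" "\<epsilon> > 0"
  shows "run_ratio \<nu> M R0 \<epsilon> = D2 \<nu> M \<mu> \<epsilon> * (\<mu> * R0\<^sup>2 / \<epsilon>) powr ((1 + \<nu>) / 2)"
proof -
  have R: "(R0\<^sup>2) powr ((1 + \<nu>) / 2) = R0 powr (1 + \<nu>)"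
  proof -
    have "R0\<^sup>2 = R0 powr 2" using assms by simp
    moreover have "2 * ((1 + \<nu>) / 2) = 1 + \<nu>" by simp
    ultimately show ?thesis by (simp only: powr_powr)
  qed
  have \<epsilon>: "\<epsilon> powr ((1 - \<nu>) / 2) * \<epsilon> powr ((1 + \<nu>) / 2) = \<epsilon>"
    using assms by (simp add: powr_add[symmetric] add_divide_distrib[symmetric])
  have "D2 \<nu> M \<mu> \<epsilon> * (\<mu> * R0\<^sup>2 / \<epsilon>) powr ((1 + \<nu>) / 2)
     = M * R0 powr (1 + \<nu>) / (\<epsilon> powr ((1 - \<nu>) / 2) * \<epsilon> powr ((1 + \<nu>) / 2))"
    using assms by (simp add: D2_def powr_mult powr_divide R)
  then show ?thesis by (simp add: \<epsilon> run_ratio_def)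
qed

text \<open>
  As for the restarts, run \<open>t\<close> starts within distance \<open>R (t - 1)\<close> and has the target \<open>e t\<close>, for \<open>t\<close> from
  \<open>1\<close> to \<open>\<tau>\<close>; so \<open>R t\<close> belongs to \<open>e (Suc t)\<close>. The three sums are the costs that do not depend on the confidence
  level, those that are multiplied by \<open>\<theta>\<close>, and the squared distances over squared targets, to which the
  number of oracle calls that reduce the variance is proportional.
\<close>

definition affordable_schedule ::
  "real \<Rightarrow> real \<Rightarrow> real \<Rightarrow> real \<Rightarrow> real \<Rightarrow> real \<Rightarrow> nat \<Rightarrow> (nat \<Rightarrow> real) \<Rightarrow> (nat \<Rightarrow> real) \<Rightarrow> bool" where
  "affordable_schedule \<nu> M \<mu> R0 \<epsilon> k \<tau> R e \<longleftrightarrow>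
     1 \<le> \<tau> \<and> real \<tau> \<le> DD \<nu> M \<mu> R0 \<epsilon> \<and> 2 \<le> DD \<nu> M \<mu> R0 \<epsilon> \<and> R 0 = R0 \<and> e \<tau> \<le> \<epsilon> \<and>
     (\<forall>t<\<tau>. 0 < R t \<and> R t \<le> R0 \<and> 0 < e (Suc t) \<and> 1 \<le> run_ratio \<nu> M (R t) (e (Suc t))) \<and>
     (\<forall>t. Suc t < \<tau> \<longrightarrow> 2 * e (Suc t) \<le> \<mu> * (R (Suc t))\<^sup>2) \<and>
     (\<Sum>t<\<tau>. run_ratio \<nu> M (R t) (e (Suc t)) powr (2 / (1 + \<nu>)))
       \<le> k * max (D1 \<nu> M \<mu> R0 powr (2 / (1 + \<nu>)) * log_ratio \<mu> R0 \<epsilon>) (D2 \<nu> M \<mu> \<epsilon> powr (2 / (1 + \<nu>))) \<and>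
     (\<Sum>t<\<tau>. run_ratio \<nu> M (R t) (e (Suc t)))
       \<le> k * max (D1 \<nu> M \<mu> R0 * log_ratio \<mu> R0 \<epsilon>) (D2 \<nu> M \<mu> \<epsilon>) \<and>
     (\<Sum>t<\<tau>. (R t)\<^sup>2 / (e (Suc t))\<^sup>2) \<le> k * (1 / (\<mu> * \<epsilon>))"

text \<open>
  The ratios are at least one, so rounding up the number of iterations is paid for by the first sum. The
  confidence parameter is at most \<open>3 * ln (DD \<nu> M \<mu> R0 \<epsilon> / \<beta>)\<close>, which turns the other two sums into
  the terms with a logarithm.
\<close>

lemma schedule_complexity:
  fixes R e :: "nat \<Rightarrow> real" and \<nu> M \<mu> R0 \<epsilon> \<beta> \<sigma> :: real and \<tau> :: nat
  defines "p \<equiv> 2 / (1 + \<nu>)" and "L \<equiv> log_ratio \<mu> R0 \<epsilon>"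
    and "\<theta> \<equiv> ln (3 * real \<tau> / \<beta>)" and "a \<equiv> \<lambda>t. run_ratio \<nu> M (R t) (e (Suc t))"
  assumes \<nu>: "0 \<le> \<nu>" "\<nu> \<le> 1" and M: "M > 0" and \<beta>: "0 < \<beta>" "\<beta> < 1"
    and sched: "affordable_schedule \<nu> M \<mu> R0 \<epsilon> k \<tau> R e" and k: "0 \<le> k"
  shows "(\<Sum>t<\<tau>. real (run_length \<nu> M \<theta> (R t) (e (Suc t))))
      \<le> (6506 * k) * iteration_bound \<nu> M \<mu> R0 \<epsilon> \<beta>"
    and "(\<Sum>t<\<tau>. real (run_length \<nu> M \<theta> (R t) (e (Suc t)) * run_batch \<nu> M \<sigma> \<theta> (R t) (e (Suc t))))
      \<le> (6506 * k) * oracle_bound \<nu> M \<mu> R0 \<sigma> \<epsilon> \<beta>"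
proof -
  have \<tau>: "1 \<le> \<tau>" "real \<tau> \<le> DD \<nu> M \<mu> R0 \<epsilon>" and DD: "2 \<le> DD \<nu> M \<mu> R0 \<epsilon>"
    and R: "\<And>t. t < \<tau> \<Longrightarrow> 0 < R t" and e: "\<And>t. t < \<tau> \<Longrightarrow> 0 < e (Suc t)" and a: "\<And>t. t < \<tau> \<Longrightarrow> 1 \<le> a t"
    and sum_p: "(\<Sum>t<\<tau>. a t powr p) \<le> k * max (D1 \<nu> M \<mu> R0 powr p * L) (D2 \<nu> M \<mu> \<epsilon> powr p)"
    and sum_1: "(\<Sum>t<\<tau>. a t) \<le> k * max (D1 \<nu> M \<mu> R0 * L) (D2 \<nu> M \<mu> \<epsilon>)"
    and sum_2: "(\<Sum>t<\<tau>. (R t)\<^sup>2 / (e (Suc t))\<^sup>2) \<le> k * (1 / (\<mu> * \<epsilon>))"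
    using sched unfolding affordable_schedule_def a_def p_def L_def by simp_all
  define I where "I = iteration_bound \<nu> M \<mu> R0 \<epsilon> \<beta>"
  define J where "J = oracle_bound \<nu> M \<mu> R0 \<sigma> \<epsilon> \<beta>"
  define l where "l = ln (DD \<nu> M \<mu> R0 \<epsilon> / \<beta>)"
  note conf = confidence_level[OF \<beta> \<tau> DD, folded \<theta>_def l_def]
  note ib = iteration_bound_ge[OF conf(3)[unfolded l_def], folded I_def l_def L_def p_def]
  note ob = oracle_bound_ge[OF conf(3)[unfolded l_def], of \<sigma>, folded I_def J_def l_def]
  define N where "N t = real (run_length \<nu> M \<theta> (R t) (e (Suc t)))" for t
  have I0: "0 \<le> I" by (rule order_trans[OF _ ib(2)]) simp
  have "N t \<le> 13 * a t powr p + 240 * \<theta> * a t" if t: "t < \<tau>" for t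
  proof -
    have "1 \<le> a t powr p" using a[OF t] \<nu> by (simp add: p_def ge_one_powr_ge_zero)
    then show ?thesis
      using run_length_le[OF M R[OF t] e[OF t] conf(1), of \<nu>]
      by (simp add: N_def a_def p_def mult_ac)
  qed
  then have "(\<Sum>t<\<tau>. N t) \<le> (\<Sum>t<\<tau>. 13 * a t powr p + 240 * \<theta> * a t)"
    by (intro sum_mono) auto
  also have "\<dots> = 13 * (\<Sum>t<\<tau>. a t powr p) + 240 * (\<theta> * (\<Sum>t<\<tau>. a t))"
    by (simp only: sum.distrib sum_distrib_left[symmetric] mult.assoc)
  also have "\<dots> \<le> 13 * (k * I) + 240 * (3 * (k * I))"
  proof -
    have "max (D1 \<nu> M \<mu> R0 powr p * L) (D2 \<nu> M \<mu> \<epsilon> powr p) \<le> I"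
      using ib(1,2) by simp
    then have "k * max (D1 \<nu> M \<mu> R0 powr p * L) (D2 \<nu> M \<mu> \<epsilon> powr p) \<le> k * I"
      using k by (rule mult_left_mono)
    then have "(\<Sum>t<\<tau>. a t powr p) \<le> k * I"
      using sum_p by (rule order_trans[rotated])
    moreover have "\<theta> * (\<Sum>t<\<tau>. a t) \<le> 3 * (k * I)"
    proof -
      have "0 \<le> (\<Sum>t<\<tau>. a t)" using a by (intro sum_nonneg) force
      then have "\<theta> * (\<Sum>t<\<tau>. a t) \<le> (3 * l) * (\<Sum>t<\<tau>. a t)"
        using conf(2) by (rule mult_right_mono[rotated])
      also have "\<dots> \<le> (3 * l) * (k * max (D1 \<nu> M \<mu> R0 * L) (D2 \<nu> M \<mu> \<epsilon>))"
        using sum_1 conf(3) by (intro mult_left_mono) auto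
      also have "\<dots> = 3 * (k * (max (D1 \<nu> M \<mu> R0 * L) (D2 \<nu> M \<mu> \<epsilon>) * l))"
        by (simp only: mult_ac)
      also have "\<dots> \<le> 3 * (k * I)"
        using ib(3) k by (intro mult_left_mono) auto
      finally show ?thesis .
    qed
    ultimately show ?thesis by linarith
  qed
  finally have sumN: "(\<Sum>t<\<tau>. N t) \<le> (733 * k) * I"
    by (simp add: algebra_simps)
  also have "\<dots> \<le> (6506 * k) * I"
    using k I0 by (intro mult_right_mono) auto
  finally show "(\<Sum>t<\<tau>. real (run_length \<nu> M \<theta> (R t) (e (Suc t))))
      \<le> (6506 * k) * iteration_bound \<nu> M \<mu> R0 \<epsilon> \<beta>"
    by (simp add: N_def I_def)
  have "(\<Sum>t<\<tau>. real (run_length \<nu> M \<theta> (R t) (e (Suc t)) * run_batch \<nu> M \<sigma> \<theta> (R t) (e (Suc t))))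
      \<le> (\<Sum>t<\<tau>. 2 * N t + 1680 * \<theta> * \<sigma>\<^sup>2 * ((R t)\<^sup>2 / (e (Suc t))\<^sup>2))"
    using run_oracle_calls_le[OF M R e conf(1), where \<nu> = \<nu> and \<sigma> = \<sigma>]
    by (intro sum_mono) (auto simp: N_def)
  also have "\<dots> = 2 * (\<Sum>t<\<tau>. N t) + 1680 * \<sigma>\<^sup>2 * (\<theta> * (\<Sum>t<\<tau>. (R t)\<^sup>2 / (e (Suc t))\<^sup>2))"
    by (simp only: sum.distrib sum_distrib_left mult_ac)
  also have "\<dots> \<le> 2 * ((733 * k) * J) + 1680 * (3 * k * J)"
  proof -
    have "(733 * k) * I \<le> (733 * k) * J"
      using ob(1) k by (intro mult_left_mono) auto
    moreover have "\<sigma>\<^sup>2 * (\<theta> * (\<Sum>t<\<tau>. (R t)\<^sup>2 / (e (Suc t))\<^sup>2)) \<le> 3 * k * J"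
    proof -
      have "\<theta> * (\<Sum>t<\<tau>. (R t)\<^sup>2 / (e (Suc t))\<^sup>2) \<le> 3 * l * (\<Sum>t<\<tau>. (R t)\<^sup>2 / (e (Suc t))\<^sup>2)"
        using conf(2) by (intro mult_right_mono sum_nonneg) auto
      also have "\<dots> \<le> 3 * l * (k * (1 / (\<mu> * \<epsilon>)))"
        using sum_2 conf(3) by (intro mult_left_mono) auto
      finally have "\<sigma>\<^sup>2 * (\<theta> * (\<Sum>t<\<tau>. (R t)\<^sup>2 / (e (Suc t))\<^sup>2)) \<le> \<sigma>\<^sup>2 * (3 * l * (k * (1 / (\<mu> * \<epsilon>))))"
        by (rule mult_left_mono) simp
      also have "\<dots> = 3 * k * (\<sigma>\<^sup>2 / (\<mu> * \<epsilon>) * l)" by simp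
      also have "\<dots> \<le> 3 * k * J"
        using ob(2) k by (intro mult_left_mono) auto
      finally show ?thesis .
    qed
    ultimately show ?thesis using sumN by linarith
  qed
  also have "\<dots> = (6506 * k) * J"
    by (simp add: algebra_simps)
  finally show "(\<Sum>t<\<tau>. real (run_length \<nu> M \<theta> (R t) (e (Suc t)) * run_batch \<nu> M \<sigma> \<theta> (R t) (e (Suc t))))
      \<le> (6506 * k) * oracle_bound \<nu> M \<mu> R0 \<sigma> \<epsilon> \<beta>"
    by (simp add: J_def)
qed

text \<open>
  If \<open>\<mu> * R0\<^sup>2 \<ge> \<epsilon>\<close>, every run halves the squared distance to the minimizer, and the last one starts
  at a squared distance of order \<open>\<epsilon> / \<mu>\<close>.
\<close>

lemma halving_schedule:
  fixes \<nu> :: real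
  assumes \<nu>: "0 \<le> \<nu>" "\<nu> \<le> 1"
  shows "\<exists>k\<ge>1. \<forall>M R0 \<mu> \<epsilon>. M > 0 \<and> R0 > 0 \<and> \<mu> > 0 \<and> \<epsilon> > 0 \<and> 1 \<le> D1 \<nu> M \<mu> R0 \<and> \<epsilon> \<le> \<mu> * R0\<^sup>2 \<longrightarrow>
    (\<exists>\<tau> R e. affordable_schedule \<nu> M \<mu> R0 \<epsilon> k \<tau> R e)"
proof -
  define p where "p = 2 / (1 + \<nu>)"
  have p: "0 < p" "p \<le> 2" using \<nu> by (auto simp: p_def field_simps)
  obtain c where c: "c > 0" and sum_p: "\<And>D \<rho>. D > 0 \<Longrightarrow> 1 \<le> \<rho> \<Longrightarrow>
    (\<Sum>t<nat \<lfloor>log 2 \<rho>\<rfloor> + 1. (D * 2 powr (real t * ((1 - \<nu>) / 2))) powr p)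
      \<le> c * max (D powr p * ln \<rho>) ((D * \<rho> powr ((1 - \<nu>) / 2)) powr p)"
    using restart_sum_le[OF \<nu> p(1)] by blast
  obtain c' where c': "c' > 0" and sum_1: "\<And>D \<rho>. D > 0 \<Longrightarrow> 1 \<le> \<rho> \<Longrightarrow>
    (\<Sum>t<nat \<lfloor>log 2 \<rho>\<rfloor> + 1. (D * 2 powr (real t * ((1 - \<nu>) / 2))) powr 1)
      \<le> c' * max (D powr 1 * ln \<rho>) ((D * \<rho> powr ((1 - \<nu>) / 2)) powr 1)"
    using restart_sum_le[OF \<nu>, of 1] by fastforce
  define k where "k = 16 * c + 4 * c' + 32"
  have k: "16 * c \<le> k" "4 * c' \<le> k" "32 \<le> k" using c c' by (simp_all add: k_def)
  show ?thesis
  proof (intro exI[of _ k] conjI allI impI)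
    show "1 \<le> k" using k(3) by simp
    fix M R0 \<mu> \<epsilon> :: real
    assume *: "M > 0 \<and> R0 > 0 \<and> \<mu> > 0 \<and> \<epsilon> > 0 \<and> 1 \<le> D1 \<nu> M \<mu> R0 \<and> \<epsilon> \<le> \<mu> * R0\<^sup>2"
    then have pos: "M > 0" "R0 > 0" "\<mu> > 0" "\<epsilon> > 0" and d1: "1 \<le> D1 \<nu> M \<mu> R0" and le: "\<epsilon> \<le> \<mu> * R0\<^sup>2"
      by auto
    define \<rho> where "\<rho> = \<mu> * R0\<^sup>2 / \<epsilon>"
    define K where "K = nat \<lfloor>log 2 \<rho>\<rfloor>"
    \<comment> \<open>The target \<open>e t\<close> equals \<open>\<mu> * (R t)\<^sup>2 / 2\<close>, the gap that strong convexity converts into the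
      distance \<open>R t\<close>.\<close>
    define R where "R t = R0 * 2 powr (- (real t / 2))" for t
    define e where "e t = \<mu> * (R (t - 1))\<^sup>2 / 4" for t :: nat
    define d where "d = D1 \<nu> M \<mu> R0"
    define L where "L = log_ratio \<mu> R0 \<epsilon>"
    have \<rho>: "1 \<le> \<rho>" using pos le by (simp add: \<rho>_def)
    have L: "L = ln \<rho>" "0 \<le> L" using \<rho> by (simp_all add: L_def log_ratio_def \<rho>_def[symmetric])
    have d: "1 \<le> d" using d1 by (simp add: d_def)
    have D2: "D2 \<nu> M \<mu> \<epsilon> = d * \<rho> powr ((1 - \<nu>) / 2)"
      unfolding d_def \<rho>_def by (rule D2_eq_D1[OF pos(3,2,4)])
    have "1 \<le> \<rho> powr ((1 - \<nu>) / 2)" using \<rho> \<nu> by (simp add: ge_one_powr_ge_zero)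
    then have D2_ge: "1 \<le> D2 \<nu> M \<mu> \<epsilon>"
      unfolding D2 using d mult_mono[of 1 d 1 "\<rho> powr ((1 - \<nu>) / 2)"] by simp
    have log: "0 \<le> log 2 \<rho>" "log 2 \<rho> \<le> 2 * L"
    proof -
      show "0 \<le> log 2 \<rho>" using \<rho> by simp
      have "L * 1 \<le> L * (2 * ln 2)" using L ln2_ge_two_thirds by (intro mult_left_mono) auto
      then show "log 2 \<rho> \<le> 2 * L" by (simp add: log_def pos_divide_le_eq mult_ac flip: L(1))
    qed
    have K: "real K \<le> log 2 \<rho>" "log 2 \<rho> < real K + 1" using log(1) unfolding K_def by linarith+
    have K_pow: "2 ^ K \<le> \<rho>" "\<rho> \<le> 2 * 2 ^ K"
    proof -
      have "2 powr real K \<le> 2 powr log 2 \<rho>" "2 powr log 2 \<rho> \<le> 2 powr (real K + 1)"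
        using K by (auto intro!: powr_mono)
      then show "2 ^ K \<le> \<rho>" "\<rho> \<le> 2 * 2 ^ K"
        using \<rho> by (simp_all add: powr_realpow powr_add)
    qed
    have R_sq: "(R t)\<^sup>2 = R0\<^sup>2 / 2 ^ t" for t
    proof -
      have "(2 powr (- (real t / 2)))\<^sup>2 = 2 powr (- (real t / 2) + - (real t / 2))"
        by (simp only: power2_eq_square powr_add)
      also have "\<dots> = 1 / 2 ^ t" by (simp add: powr_minus powr_realpow inverse_eq_divide)
      finally show ?thesis by (simp add: R_def power_mult_distrib)
    qed
    have R_pos: "0 < R t" for t using pos by (simp add: R_def)
    have R_le: "R t \<le> R0" for t
    proof -
      have "2 powr (- (real t / 2)) \<le> 2 powr (0::real)" by (rule powr_mono) auto
      then show ?thesis using pos by (simp add: R_def)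
    qed
    have e_pos: "0 < e t" for t using pos R_pos[of "t - 1"] by (simp add: e_def)
    have ratio: "run_ratio \<nu> M (R t) (e (Suc t)) = 4 * (d * 2 powr (real t * ((1 - \<nu>) / 2)))" for t
    proof -
      have "run_ratio \<nu> M (R t) (e (Suc t)) = 4 * D1 \<nu> M \<mu> (R t)"
        unfolding e_def diff_Suc_1 by (rule run_ratio_eq_D1[OF pos(3) R_pos])
      also have "R t powr (1 - \<nu>) = R0 powr (1 - \<nu>) * 2 powr (- (real t / 2) * (1 - \<nu>))"
        using pos by (simp add: R_def powr_mult powr_powr)
      then have "D1 \<nu> M \<mu> (R t) = d * 2 powr (- (- (real t / 2) * (1 - \<nu>)))"
        by (simp only: D1_def d_def powr_minus) (simp add: field_simps)
      also have "- (- (real t / 2) * (1 - \<nu>)) = real t * ((1 - \<nu>) / 2)" by simp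
      finally show ?thesis by simp
    qed
    have ratio_ge: "1 \<le> run_ratio \<nu> M (R t) (e (Suc t))" for t
    proof -
      have "1 \<le> 2 powr (real t * ((1 - \<nu>) / 2))" using \<nu> by (intro ge_one_powr_ge_zero) auto
      then have "1 * 1 \<le> d * 2 powr (real t * ((1 - \<nu>) / 2))" using d by (intro mult_mono) auto
      then show ?thesis unfolding ratio by simp
    qed
    have DD: "2 * L + 2 \<le> DD \<nu> M \<mu> R0 \<epsilon>"
    proof -
      have "1 \<le> d powr p" "1 \<le> D2 \<nu> M \<mu> \<epsilon> powr p"
        using d D2_ge p by (auto intro!: ge_one_powr_ge_zero)
      moreover from this have "2 * L \<le> (d powr p + d) * L"
        using d L by (intro mult_right_mono) auto
      ultimately show ?thesis
        using D2_ge by (simp add: DD_def d_def[symmetric] p_def[symmetric] L_def[symmetric])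
    qed
    have sump: "(\<Sum>t<K + 1. run_ratio \<nu> M (R t) (e (Suc t)) powr p)
        \<le> 16 * c * max (d powr p * L) (D2 \<nu> M \<mu> \<epsilon> powr p)"
    proof -
      have "(\<Sum>t<K + 1. run_ratio \<nu> M (R t) (e (Suc t)) powr p)
          = 4 powr p * (\<Sum>t<K + 1. (d * 2 powr (real t * ((1 - \<nu>) / 2))) powr p)"
        unfolding ratio sum_distrib_left using d by (intro sum.cong) (auto simp: powr_mult)
      also have "\<dots> \<le> 4 powr p * (c * max (d powr p * L) (D2 \<nu> M \<mu> \<epsilon> powr p))"
        unfolding K_def L(1) D2 using d \<rho> by (intro mult_left_mono sum_p) auto
      also have "\<dots> \<le> 16 * (c * max (d powr p * L) (D2 \<nu> M \<mu> \<epsilon> powr p))"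
      proof (rule mult_right_mono)
        show "4 powr p \<le> (16 :: real)" using powr_mono[OF p(2), of 4] by simp
        show "0 \<le> c * max (d powr p * L) (D2 \<nu> M \<mu> \<epsilon> powr p)"
          using c by (intro mult_nonneg_nonneg) (auto simp: le_max_iff_disj)
      qed
      finally show ?thesis by simp
    qed
    have sum1: "(\<Sum>t<K + 1. run_ratio \<nu> M (R t) (e (Suc t))) \<le> 4 * c' * max (d * L) (D2 \<nu> M \<mu> \<epsilon>)"
    proof -
      have "(\<Sum>t<K + 1. run_ratio \<nu> M (R t) (e (Suc t)))
          = 4 * (\<Sum>t<K + 1. (d * 2 powr (real t * ((1 - \<nu>) / 2))) powr 1)"
        unfolding ratio sum_distrib_left using d by (intro sum.cong) auto
      also have "\<dots> \<le> 4 * (c' * max (d powr 1 * L) ((d * \<rho> powr ((1 - \<nu>) / 2)) powr 1))"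
        unfolding K_def L(1) using d \<rho> by (intro mult_left_mono sum_1) auto
      also have "\<dots> = 4 * c' * max (d * L) (D2 \<nu> M \<mu> \<epsilon>)"
        unfolding D2 using d by simp
      finally show ?thesis .
    qed
    have sum2: "(\<Sum>t<K + 1. (R t)\<^sup>2 / (e (Suc t))\<^sup>2) \<le> 32 * (1 / (\<mu> * \<epsilon>))"
    proof -
      have "(R t)\<^sup>2 / (e (Suc t))\<^sup>2 = 16 / (\<mu>\<^sup>2 * R0\<^sup>2) * 2 ^ t" for t
      proof -
        have "(R t)\<^sup>2 / (e (Suc t))\<^sup>2 = 16 / (\<mu>\<^sup>2 * (R t)\<^sup>2)"
          using R_pos[of t] pos by (simp add: e_def power2_eq_square field_simps)
        then show ?thesis unfolding R_sq by simp
      qed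
      then have "(\<Sum>t<K + 1. (R t)\<^sup>2 / (e (Suc t))\<^sup>2) = 16 / (\<mu>\<^sup>2 * R0\<^sup>2) * (\<Sum>t<K + 1. 2 ^ t)"
        by (simp only: sum_distrib_left)
      also have "(\<Sum>t<K + 1. (2::real) ^ t) = 2 ^ (K + 1) - 1"
        by (subst geometric_sum) auto
      also have "16 / (\<mu>\<^sup>2 * R0\<^sup>2) * (2 ^ (K + 1) - 1) \<le> 16 / (\<mu>\<^sup>2 * R0\<^sup>2) * (2 * \<rho>)"
        using K_pow(1) by (intro mult_left_mono) auto
      also have "\<dots> = 32 * (1 / (\<mu> * \<epsilon>))"
        using pos by (simp add: \<rho>_def power2_eq_square)
      finally show ?thesis .
    qed
    have e_last: "e (K + 1) \<le> \<epsilon>"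
    proof -
      have "\<mu> * R0\<^sup>2 \<le> 2 * 2 ^ K * \<epsilon>"
        using K_pow(2) pos by (simp add: \<rho>_def pos_divide_le_eq)
      also have "\<dots> \<le> 4 * (2 ^ K * \<epsilon>)" using pos by simp
      finally have "\<mu> * R0\<^sup>2 \<le> 4 * (2 ^ K * \<epsilon>)" .
      then show ?thesis using pos by (simp add: e_def R_sq field_simps)
    qed
    have e_next: "2 * e (Suc t) = \<mu> * (R (Suc t))\<^sup>2" for t
      by (simp add: e_def R_sq)
    have K_le: "real (K + 1) \<le> DD \<nu> M \<mu> R0 \<epsilon>" using DD K(1) log(2) L(2) by simp
    show "\<exists>\<tau> R e. affordable_schedule \<nu> M \<mu> R0 \<epsilon> k \<tau> R e"
      unfolding affordable_schedule_def
    proof (rule exI[of _ "K + 1"], rule exI[of _ R], rule exI[of _ e], intro conjI allI impI)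
      fix t
      show "2 * e (Suc t) \<le> \<mu> * (R (Suc t))\<^sup>2" using e_next by simp
      show "0 < R t" "R t \<le> R0" "0 < e (Suc t)" "1 \<le> run_ratio \<nu> M (R t) (e (Suc t))"
        by (rule R_pos R_le e_pos ratio_ge)+
    next
      show "R 0 = R0" by (simp add: R_def)
      show "2 \<le> DD \<nu> M \<mu> R0 \<epsilon>" using DD L(2) by simp
      show "1 \<le> K + 1" "real (K + 1) \<le> DD \<nu> M \<mu> R0 \<epsilon>" "e (K + 1) \<le> \<epsilon>"
        using K_le e_last by simp_all
      have "0 \<le> max (d powr p * L) (D2 \<nu> M \<mu> \<epsilon> powr p)" by (simp add: le_max_iff_disj)
      then have "16 * c * max (d powr p * L) (D2 \<nu> M \<mu> \<epsilon> powr p) \<le> k * max (d powr p * L) (D2 \<nu> M \<mu> \<epsilon> powr p)"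
        using k(1) by (rule mult_right_mono[rotated])
      then show "(\<Sum>t<K + 1. run_ratio \<nu> M (R t) (e (Suc t)) powr (2 / (1 + \<nu>)))
        \<le> k * max (D1 \<nu> M \<mu> R0 powr (2 / (1 + \<nu>)) * log_ratio \<mu> R0 \<epsilon>) (D2 \<nu> M \<mu> \<epsilon> powr (2 / (1 + \<nu>)))"
        using sump unfolding p_def d_def L_def by linarith
      have "0 \<le> max (d * L) (D2 \<nu> M \<mu> \<epsilon>)" using D2_ge by (simp add: le_max_iff_disj)
      then have "4 * c' * max (d * L) (D2 \<nu> M \<mu> \<epsilon>) \<le> k * max (d * L) (D2 \<nu> M \<mu> \<epsilon>)"
        using k(2) by (rule mult_right_mono[rotated])
      then show "(\<Sum>t<K + 1. run_ratio \<nu> M (R t) (e (Suc t)))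
        \<le> k * max (D1 \<nu> M \<mu> R0 * log_ratio \<mu> R0 \<epsilon>) (D2 \<nu> M \<mu> \<epsilon>)"
        using sum1 unfolding d_def L_def by linarith
      have "32 * (1 / (\<mu> * \<epsilon>)) \<le> k * (1 / (\<mu> * \<epsilon>))"
        using k(3) pos by (intro mult_right_mono) auto
      then show "(\<Sum>t<K + 1. (R t)\<^sup>2 / (e (Suc t))\<^sup>2) \<le> k * (1 / (\<mu> * \<epsilon>))"
        using sum2 by linarith
    qed
  qed
qed

text \<open>
  If \<open>\<mu> * R0\<^sup>2 < \<epsilon>\<close>, one run with the target \<open>\<epsilon>\<close> is cheap enough. The hypothesis \<open>far\<close> leaves out the
  accuracies that every admissible starting point has already; it makes the ratio of the run at least
  one, so that rounding the number of iterations up costs a constant factor.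
\<close>

lemma single_run_schedule:
  fixes \<nu> M R0 \<mu> \<epsilon> k :: real
  assumes \<nu>: "0 \<le> \<nu>" "\<nu> \<le> 1" and pos: "M > 0" "R0 > 0" "\<mu> > 0" "\<epsilon> > 0"
    and less: "\<mu> * R0\<^sup>2 < \<epsilon>" and far: "\<epsilon> < M * R0 powr (1 + \<nu>)"
    and k: "1 \<le> k"
  shows "affordable_schedule \<nu> M \<mu> R0 \<epsilon> k 1 (\<lambda>_. R0) (\<lambda>_. \<epsilon>)"
proof -
  have a: "1 \<le> run_ratio \<nu> M R0 \<epsilon>" using far pos by (simp add: run_ratio_def)
  have "0 < \<mu> * R0\<^sup>2 / \<epsilon>" "\<mu> * R0\<^sup>2 / \<epsilon> \<le> 1" using pos less by simp_all
  then have "(\<mu> * R0\<^sup>2 / \<epsilon>) powr ((1 + \<nu>) / 2) \<le> 1"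
    using \<nu> by (intro powr_le1) auto
  then have "D2 \<nu> M \<mu> \<epsilon> * (\<mu> * R0\<^sup>2 / \<epsilon>) powr ((1 + \<nu>) / 2) \<le> D2 \<nu> M \<mu> \<epsilon> * 1"
    using pos by (intro mult_left_mono) (auto simp: D2_def)
  then have aD: "run_ratio \<nu> M R0 \<epsilon> \<le> D2 \<nu> M \<mu> \<epsilon>"
    using run_ratio_eq_D2[OF pos(3,2,4)] by simp
  have D2: "1 \<le> D2 \<nu> M \<mu> \<epsilon>" using a aD by linarith
  then have "1 \<le> D2 \<nu> M \<mu> \<epsilon> powr (2 / (1 + \<nu>))" using \<nu> by (intro ge_one_powr_ge_zero) auto
  moreover have "0 \<le> (D1 \<nu> M \<mu> R0 powr (2 / (1 + \<nu>)) + D1 \<nu> M \<mu> R0) * log_ratio \<mu> R0 \<epsilon>"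
    using pos by (intro mult_nonneg_nonneg add_nonneg_nonneg) (auto simp: D1_def log_ratio_def)
  ultimately have DD: "2 \<le> DD \<nu> M \<mu> R0 \<epsilon>" using D2 by (simp add: DD_def)
  define X where "X = max (D1 \<nu> M \<mu> R0 powr (2 / (1 + \<nu>)) * log_ratio \<mu> R0 \<epsilon>) (D2 \<nu> M \<mu> \<epsilon> powr (2 / (1 + \<nu>)))"
  define Y where "Y = max (D1 \<nu> M \<mu> R0 * log_ratio \<mu> R0 \<epsilon>) (D2 \<nu> M \<mu> \<epsilon>)"
  have XY: "0 \<le> X" "0 \<le> Y" using D2 by (auto simp: X_def Y_def le_max_iff_disj)
  have "run_ratio \<nu> M R0 \<epsilon> powr (2 / (1 + \<nu>)) \<le> D2 \<nu> M \<mu> \<epsilon> powr (2 / (1 + \<nu>))"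
    using a aD \<nu> by (intro powr_mono2) auto
  also have "\<dots> \<le> X" by (simp add: X_def)
  also have "X \<le> k * X" using XY(1) k mult_right_mono[of 1 k X] by simp
  finally have cost_p: "run_ratio \<nu> M R0 \<epsilon> powr (2 / (1 + \<nu>)) \<le> k * X" .
  have "run_ratio \<nu> M R0 \<epsilon> \<le> Y" using aD by (simp add: Y_def)
  also have "Y \<le> k * Y" using XY(2) k mult_right_mono[of 1 k Y] by simp
  finally have cost_1: "run_ratio \<nu> M R0 \<epsilon> \<le> k * Y" .
  have "R0\<^sup>2 / \<epsilon>\<^sup>2 \<le> 1 / (\<mu> * \<epsilon>)"
    using pos less by (simp add: field_simps power2_eq_square)
  also have "\<dots> \<le> k * (1 / (\<mu> * \<epsilon>))" using pos k mult_right_mono[of 1 k "1 / (\<mu> * \<epsilon>)"] by simp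
  finally show ?thesis
    using DD a cost_p cost_1 pos unfolding affordable_schedule_def X_def Y_def by simp
qed

section \<open>The complexity theorem\<close>

theorem theorem3p2:
  fixes \<nu> :: real
  assumes "0 \<le> \<nu>" and "\<nu> \<le> 1"
  shows "\<exists>C>0. \<forall>M R0 \<sigma> \<mu> \<epsilon> \<beta>.
    M > 0 \<and> R0 > 0 \<and> \<sigma> > 0 \<and> \<mu> > 0 \<and> \<epsilon> > 0 \<and> 0 < \<beta> \<and> \<beta> < 1 \<longrightarrow>
    (\<exists>(\<tau>::nat) (N::nat \<Rightarrow> nat) (m::nat \<Rightarrow> nat) (\<gamma>::nat \<Rightarrow> real) (B::nat \<Rightarrow> real).
      (\<forall>t\<in>{1..\<tau>}. N t \<ge> 1 \<and> m t \<ge> 1 \<and> \<gamma> t > 0 \<and> B t > 0) \<and>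
      real (total_iterations \<tau> N) \<le> C * iteration_bound \<nu> M \<mu> R0 \<epsilon> \<beta> \<and>
      real (oracle_calls \<tau> N m) \<le> C * oracle_bound \<nu> M \<mu> R0 \<sigma> \<epsilon> \<beta> \<and>
      (\<forall>(n::nat) (f::(nat \<Rightarrow> real) \<Rightarrow> real) (g::(nat \<Rightarrow> real) \<Rightarrow> nat \<Rightarrow> real)
        (xs::nat \<Rightarrow> real) (x0::nat \<Rightarrow> real)
        (P::'b measure) (G::(nat \<Rightarrow> real) \<Rightarrow> 'b \<Rightarrow> nat \<Rightarrow> real).
        is_minimizer n f xs \<and> grad_map n \<nu> f g xs \<and> strongly_convex n \<mu> f g \<and>
        x0 \<in> Rn n \<and> nrm n (vdiff x0 xs) \<le> R0 \<and>
        oracle_on n P G g \<sigma> (cballn n xs (7 * R0)) \<and>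
        smoothness_on n f g xs \<nu> M (cballn n xs (7 * R0)) \<longrightarrow>
        measure (samples P)
          {\<omega> \<in> space (samples P). f (R_clipped_SGD n G N m \<gamma> B x0 \<omega> \<tau>) - f xs \<le> \<epsilon>} \<ge> 1 - \<beta>))"
proof -
  note \<nu> = assms
  obtain k where k: "1 \<le> k" and halving: "\<forall>M R0 \<mu> \<epsilon>. M > 0 \<and> R0 > 0 \<and> \<mu> > 0 \<and> \<epsilon> > 0 \<and> 1 \<le> D1 \<nu> M \<mu> R0 \<and> \<epsilon> \<le> \<mu> * R0\<^sup>2 \<longrightarrow>
    (\<exists>\<tau> R e. affordable_schedule \<nu> M \<mu> R0 \<epsilon> k \<tau> R e)"
    using halving_schedule[OF \<nu>] by (elim exE conjE) (rule that)
  define C where "C = 6506 * k"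
  have "C > 0" using k by (simp add: C_def)
  have parameters: "\<exists>(\<tau>::nat) (N::nat \<Rightarrow> nat) (m::nat \<Rightarrow> nat) (\<gamma>::nat \<Rightarrow> real) (B::nat \<Rightarrow> real).
      (\<forall>t\<in>{1..\<tau>}. N t \<ge> 1 \<and> m t \<ge> 1 \<and> \<gamma> t > 0 \<and> B t > 0) \<and>
      real (total_iterations \<tau> N) \<le> C * iteration_bound \<nu> M \<mu> R0 \<epsilon> \<beta> \<and>
      real (oracle_calls \<tau> N m) \<le> C * oracle_bound \<nu> M \<mu> R0 \<sigma> \<epsilon> \<beta> \<and>
      (\<forall>(n::nat) (f::(nat \<Rightarrow> real) \<Rightarrow> real) (g::(nat \<Rightarrow> real) \<Rightarrow> nat \<Rightarrow> real)
        (xs::nat \<Rightarrow> real) (x0::nat \<Rightarrow> real)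
        (P::'b measure) (G::(nat \<Rightarrow> real) \<Rightarrow> 'b \<Rightarrow> nat \<Rightarrow> real).
        is_minimizer n f xs \<and> grad_map n \<nu> f g xs \<and> strongly_convex n \<mu> f g \<and>
        x0 \<in> Rn n \<and> nrm n (vdiff x0 xs) \<le> R0 \<and>
        oracle_on n P G g \<sigma> (cballn n xs (7 * R0)) \<and>
        smoothness_on n f g xs \<nu> M (cballn n xs (7 * R0)) \<longrightarrow>
        measure (samples P)
          {\<omega> \<in> space (samples P). f (R_clipped_SGD n G N m \<gamma> B x0 \<omega> \<tau>) - f xs \<le> \<epsilon>} \<ge> 1 - \<beta>)"
    if pos: "M > 0" "R0 > 0" "\<sigma> > 0" "\<mu> > 0" "\<epsilon> > 0" and \<beta>: "0 < \<beta>" "\<beta> < 1"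
    for M R0 \<sigma> \<mu> \<epsilon> \<beta> :: real
  proof (cases "D1 \<nu> M \<mu> R0 < 1 \<or> M * R0 powr (1 + \<nu>) \<le> \<epsilon>")
    case True
    \<comment> \<open>No run is made. If \<open>D1 < 1\<close>, the problem has dimension zero.\<close>
    have "0 \<le> D2 \<nu> M \<mu> \<epsilon> powr (2 / (1 + \<nu>))" by simp
    moreover have "D2 \<nu> M \<mu> \<epsilon> powr (2 / (1 + \<nu>)) \<le> iteration_bound \<nu> M \<mu> R0 \<epsilon> \<beta>"
      "D2 \<nu> M \<mu> \<epsilon> powr (2 / (1 + \<nu>)) \<le> oracle_bound \<nu> M \<mu> R0 \<sigma> \<epsilon> \<beta>"
      unfolding iteration_bound_def oracle_bound_def by (rule Max_ge; simp)+
    ultimately have "0 \<le> iteration_bound \<nu> M \<mu> R0 \<epsilon> \<beta>" "0 \<le> oracle_bound \<nu> M \<mu> R0 \<sigma> \<epsilon> \<beta>"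
      by linarith+
    then have "0 \<le> C * iteration_bound \<nu> M \<mu> R0 \<epsilon> \<beta>" "0 \<le> C * oracle_bound \<nu> M \<mu> R0 \<sigma> \<epsilon> \<beta>"
      using \<open>C > 0\<close> by simp_all
    moreover have "1 - \<beta> \<le> measure (samples P) {\<omega> \<in> space (samples P). f x0 - f xs \<le> \<epsilon>}"
      if "is_minimizer n f xs" "grad_map n \<nu> f g xs" "strongly_convex n \<mu> f g"
        "x0 \<in> Rn n" "nrm n (vdiff x0 xs) \<le> R0"
        "oracle_on n P G g \<sigma> (cballn n xs (7 * R0))"
        "smoothness_on n f g xs \<nu> M (cballn n xs (7 * R0))"
      for n f g xs x0 and P :: "'b measure" and G
    proof -
      interpret stochastic_problem \<nu> M \<mu> \<sigma> R0 n f g xs P G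
        using \<nu> pos that by unfold_locales auto
      have "gap x0 \<le> \<epsilon>"
      proof (cases "n = 0")
        case True
        then have "x0 = xs" using that(4) xs_Rn by (auto simp: Rn_def)
        then show ?thesis using pos by simp
      next
        case False
        then have "M * R0 powr (1 + \<nu>) \<le> \<epsilon>" using True D1_ge_1 by force
        then show ?thesis using gap_le_of_radius[OF that(4,5)] by linarith
      qed
      interpret S: prob_space "samples P" unfolding samples_def by (rule prob_space_PiM) (rule prob_P)
      have "{\<omega> \<in> space (samples P). f x0 - f xs \<le> \<epsilon>} = space (samples P)"
        using \<open>gap x0 \<le> \<epsilon>\<close> by simp
      then show ?thesis using \<beta> by (simp only: S.prob_space)
    qed
    ultimately show ?thesis
      by (intro exI[of _ 0]) (auto simp: total_iterations_def oracle_calls_def)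
  next
    case False
    have "\<exists>\<tau> R e. affordable_schedule \<nu> M \<mu> R0 \<epsilon> k \<tau> R e"
    proof (cases "\<epsilon> \<le> \<mu> * R0\<^sup>2")
      case True
      then show ?thesis using halving pos False by auto
    next
      case less: False
      have "affordable_schedule \<nu> M \<mu> R0 \<epsilon> k 1 (\<lambda>_. R0) (\<lambda>_. \<epsilon>)"
        using less False by (intro single_run_schedule[OF \<nu> pos(1,2,4,5) _ _ k]) auto
      then show ?thesis by blast
    qed
    then obtain \<tau> R e where sched: "affordable_schedule \<nu> M \<mu> R0 \<epsilon> k \<tau> R e"
      by blast
    then have \<tau>: "1 \<le> \<tau>" "real \<tau> \<le> DD \<nu> M \<mu> R0 \<epsilon>" and DD: "2 \<le> DD \<nu> M \<mu> R0 \<epsilon>"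
      and R_0: "R 0 = R0" and e_last: "e \<tau> \<le> \<epsilon>"
      and R: "\<And>t. t < \<tau> \<Longrightarrow> 0 < R t" "\<And>t. t < \<tau> \<Longrightarrow> R t \<le> R0" and e: "\<And>t. t < \<tau> \<Longrightarrow> 0 < e (Suc t)"
      and next_radius: "\<And>t. Suc t < \<tau> \<Longrightarrow> 2 * e (Suc t) \<le> \<mu> * (R (Suc t))\<^sup>2"
      unfolding affordable_schedule_def by simp_all
    define \<theta> where "\<theta> = ln (3 * real \<tau> / \<beta>)"
    define N where "N t = run_length \<nu> M \<theta> (R (t - 1)) (e t)" for t
    define m where "m t = run_batch \<nu> M \<sigma> \<theta> (R (t - 1)) (e t)" for t
    define \<gamma> where "\<gamma> t = run_stepsize \<nu> M \<theta> (R (t - 1)) (e t)" for t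
    define B where "B t = run_clip \<theta> (R (t - 1))" for t
    note conf = confidence_level[OF \<beta> \<tau> DD, folded \<theta>_def]
    note cost = schedule_complexity[OF \<nu> pos(1) \<beta> sched order_trans[OF zero_le_one k], folded C_def \<theta>_def]
    show ?thesis
    proof (rule exI[of _ \<tau>], rule exI[of _ N], rule exI[of _ m], rule exI[of _ \<gamma>], rule exI[of _ B],
        intro conjI ballI allI impI)
      fix t assume "t \<in> {1..\<tau>}"
      then obtain s where s: "t = Suc s" "s < \<tau>" by (cases t) auto
      note par = pos(1) R(1)[OF s(2)] e[OF s(2)] conf(1)
      show "1 \<le> N t" "1 \<le> m t" "0 < \<gamma> t" "0 < B t"
        unfolding N_def m_def \<gamma>_def B_def s(1) diff_Suc_1
        using run_length_pos[OF par] run_batch_pos[OF par] run_stepsize_pos[OF par] run_clip_pos[OF par] by auto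
    next
      show "real (total_iterations \<tau> N) \<le> C * iteration_bound \<nu> M \<mu> R0 \<epsilon> \<beta>"
        using cost(1) by (simp add: total_iterations_def N_def sum.atLeast1_atMost_eq)
      show "real (oracle_calls \<tau> N m) \<le> C * oracle_bound \<nu> M \<mu> R0 \<sigma> \<epsilon> \<beta>"
        using cost(2) by (simp add: oracle_calls_def N_def m_def sum.atLeast1_atMost_eq)
    next
      fix n f g xs x0 and P :: "'b measure" and G
      assume *: "is_minimizer n f xs \<and> grad_map n \<nu> f g xs \<and> strongly_convex n \<mu> f g \<and>
        x0 \<in> Rn n \<and> nrm n (vdiff x0 xs) \<le> R0 \<and>
        oracle_on n P G g \<sigma> (cballn n xs (7 * R0)) \<and>
        smoothness_on n f g xs \<nu> M (cballn n xs (7 * R0))"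
      interpret stochastic_problem \<nu> M \<mu> \<sigma> R0 n f g xs P G
        using \<nu> pos * by unfold_locales auto
      show "1 - \<beta> \<le> measure (samples P)
          {\<omega> \<in> space (samples P). f (R_clipped_SGD n G N m \<gamma> B x0 \<omega> \<tau>) - f xs \<le> \<epsilon>}"
        unfolding N_def[abs_def] m_def[abs_def] \<gamma>_def[abs_def] B_def[abs_def]
        using * R_0 by (intro R_clipped_SGD_success[OF conf(1) \<tau>(1) R e next_radius _ _ e_last conf(4)]) auto
    qed
  qed
  show ?thesis
    by (rule exI[of _ C], rule conjI, rule \<open>C > 0\<close>, intro allI impI, elim conjE, rule parameters, assumption+)
qed

end
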